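(* Let $\boldsymbol p\in\mathbb N_0^2\setminus\{(0,0)\}$. A map $W:\mathcal B(\mathcal H_{\boldsymbol p})\to C^\infty_{\mathbb C}(\mathcal E)$, $A\mapsto W_A$, is a symbol correspondence if and only if $$W_A(\mathrm z)=\operatorname{tr}(A\,K(\mathrm z))\qquad(A\in\mathcal B(\mathcal H_{\boldsymbol p}),\ \mathrm z\in\mathcal E)$$ for an operator $K\in\mathcal B(\mathcal H_{\boldsymbol p})$ (its operator kernel) of the form $$K=\frac1{\dim(\boldsymbol p)}\mathds 1+\sum_{\substack{(\boldsymbol a;\sigma)\\ \boldsymbol a\neq(0,0)}}\ \sum_{\gamma=1}^{m(\boldsymbol a)}\overline{c^\sigma_\gamma(\boldsymbol a)}\sqrt{\frac{\dim(\boldsymbol a)}{\dim(\boldsymbol p)}}\;\boldsymbol e((\boldsymbol a;\sigma);\boldsymbol 0_{\boldsymbol a},J^\gamma_{\boldsymbol a}),$$ where $(\boldsymbol a;\sigma)$ runs over the Clebsch-Gordan series of $\boldsymbol p\otimes\check{\boldsymbol p}$ and $c^\sigma_\gamma(\boldsymbol a)$ is the $\gamma\times\sigma$ entry of a complex full rank matrix $\mathbf C(\boldsymbol a)$ of order $m(\boldsymbol a)\times\mathfrak m(\boldsymbol p;\boldsymbol a)$, these matrices satisfying $\overline{\mathbf C(\boldsymbol a)}=\mathbf C(\check{\boldsymbol a})$ and $\mathbf C(0,0)=1$. In particular, $W$ maps $$\sqrt{\dim(\boldsymbol p)}\;\boldsymbol e((\boldsymbol a;\sigma);\boldsymbol\nu,J)\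 \mapsto\ \sum_{\gamma=1}^{m(\boldsymbol a)}c^\sigma_\gamma(\boldsymbol a)\,Z^{(\boldsymbol a,\gamma)}_{\boldsymbol\nu,J}.$$
   Context: Representations. In a representation of $SU(3)$ (extended to $\mathfrak{sl}(3,\mathbb C)$) let $T_+,T_-,T_3,U_+,U_-,U_3$ be the images of $E_{12},E_{21},\tfrac12(E_{11}-E_{22}),E_{23},E_{32},\tfrac12(E_{22}-E_{33})$. For $\boldsymbol p=(p,q)\in\mathbb N_0^2$, "the irrep $\boldsymbol p$" is the unitary irrep on a Hilbert space $\mathcal H_{\boldsymbol p}$ whose highest weight vector has eigenvalue $p/2$ for $T_3$ and $q/2$ for $U_3$; $\dim(\boldsymbol p)=\frac{(p+1)(q+1)(p+q+2)}2$, $|\boldsymbol p|=p+q$, $\check{\boldsymbol p}=(q,p)$ (the dual irrep). Inner products are linear in the second entry. Gelfand-Tsetlin (GT) basis: an orthonormal basis $\{\boldsymbol e(\boldsymbol p;\boldsymbol\nu,J)\}$ indexed by $\boldsymbol\nu=(\nu_1,\nu_2,\nu_3)$ and $J$ where, for integers $0\le r_-\le q\le r_+\le p+q$ and $r_-\le\nu_3\le r_+$: $\nu_1=p+2q-(r_++r_-)$, $\nu_2=r_++r_--\nu_3$, $J=\frac12(r_+-r_-)$. Put $t_{\boldsymbol\nu}=\frac{\nu_1-\nu_2}2$, $u_{\boldsymbol\nu}=\frac{\nu_2-\nu_3}2$ (the eigenvalues of $T_3,U_3$). The basis is determined by a unit highest weight vector $\boldsymbol e(\boldsymbol p;(p+q,q,0),q/2)$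 via, with $u=u_{\boldsymbol\nu}$, $U_-\boldsymbol e(\boldsymbol p;\boldsymbol\nu,J)=\sqrt{(J+u)(J-u+1)}\,\boldsymbol e(\boldsymbol p;(\nu_1,\nu_2-1,\nu_3+1),J)$ and $T_-\boldsymbol e(\boldsymbol p;\boldsymbol\nu,J)=\sqrt{\tfrac{(J-u)(p+q+J-u-\nu_3+1)(q+J-u-\nu_3)(u-J+\nu_3+1)}{2J(2J+1)}}\,\boldsymbol e(\boldsymbol p;(\nu_1-1,\nu_2+1,\nu_3),J-\tfrac12)+\sqrt{\tfrac{(J+u+1)(p+q-J-u-\nu_3)(J+u+1+\nu_3-q)(J+u+2+\nu_3)}{2(J+1)(2J+1)}}\,\boldsymbol e(\boldsymbol p;(\nu_1-1,\nu_2+1,\nu_3),J+\tfrac12)$ (terms with zero numerator are $0$). For a GT label $\boldsymbol\nu$ of $\boldsymbol a$ put $\check{\boldsymbol\nu}=(|\boldsymbol a|,|\boldsymbol a|,|\boldsymbol a|)-\boldsymbol\nu$, a GT label of $\check{\boldsymbol a}$. Wigner functions: $D^{\boldsymbol a}_{\boldsymbol\nu J,\boldsymbol\mu L}(g)=\langle\boldsymbol e(\boldsymbol a;\boldsymbol\nu,J)|\rho(g)\boldsymbol e(\boldsymbol a;\boldsymbol\mu,L)\rangle$. Operators. $\mathcal B(\mathcal H_{\boldsymbol p})\simeq\mathcal H_{\boldsymbol p}\otimes\mathcal H_{\boldsymbol p}^*$ (the representation $\boldsymbol p\otimes\check{\boldsymbol p}$) carries the action $A^g=\rho(g)A\rho(g)^{-1}$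 and the inner product $\operatorname{tr}(A^\dagger B)$. $\mathfrak m(\boldsymbol p;\boldsymbol a)$ is the multiplicity of $\boldsymbol a$ in $\boldsymbol p\otimes\check{\boldsymbol p}$. A decomposition of $\mathcal B(\mathcal H_{\boldsymbol p})$ into mutually orthogonal irreps $(\boldsymbol a;\sigma)$, $1\le\sigma\le\mathfrak m(\boldsymbol p;\boldsymbol a)$, each of class $\boldsymbol a$, together with GT bases $\boldsymbol e((\boldsymbol a;\sigma);\boldsymbol\nu,J)$ of each $(\boldsymbol a;\sigma)$ (a coupled basis), is fixed so that $\boldsymbol e((\boldsymbol a;\sigma);\boldsymbol\nu,J)^\dagger=(-1)^{2(t_{\boldsymbol\nu}+u_{\boldsymbol\nu})}\boldsymbol e((\check{\boldsymbol a};\sigma);\check{\boldsymbol\nu},J)$ and $\boldsymbol e((0,0);(0,0,0),0)=\mathds 1/\sqrt{\dim\boldsymbol p}$. (Such a choice exists.) Phase space. $\mathcal E\simeq SU(3)/T$ is the full flag manifold, $T$ the diagonal maximal torus, $\mathrm z_0\in\mathcal E$ a point with isotropy group $T$, with the $SU(3)$-invariant integral of total mass $1$. For $\boldsymbol a=(a,b)$ with $a\equiv b\pmod 3$ (every $\boldsymbol a$ in the Clebsch-Gordan series of $\boldsymbol p\otimes\check{\boldsymbol p}$ is such): $m(\boldsymbol a)=\min\{a,b\}+1$, $\boldsymbol 0_{\boldsymbol a}=(c,c,c)$ with $c=(a+2b)/3$, and $J^\gamma_{\boldsymbol a}=\gamma-1+|a-b|/3$ for $1\le\gamma\le m(\boldsymbol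 a)$. Harmonics: $Z^{(\boldsymbol a,\gamma)}_{\boldsymbol\nu,J}(g\mathrm z_0)=\sqrt{\dim(\boldsymbol a)}\;\overline{D^{\boldsymbol a}_{\boldsymbol\nu J,\,\boldsymbol 0_{\boldsymbol a}J^\gamma_{\boldsymbol a}}(g)}$. For $K\in\mathcal B(\mathcal H_{\boldsymbol p})$ fixed by $T$, $K(g\mathrm z_0):=K^g$. A symbol correspondence $W:\mathcal B(\mathcal H_{\boldsymbol p})\to C^\infty_{\mathbb C}(\mathcal E)$ is an injective linear map with: (1) $W_{A^g}=(W_A)^g$ for all $g\in SU(3)$, where $f^g(\mathrm z)=f(g^{-1}\mathrm z)$; (2) $W_{A^\dagger}=\overline{W_A}$; (3) $\int_{\mathcal E}W_A\,d\mathrm z=\operatorname{tr}(A)/\dim(\boldsymbol p)$. *)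

theory Defs
  imports "HOL-Analysis.Analysis"
begin

text \<open>Complex normed vector spaces. Vectors and matrices over the complex numbers are scaled
  componentwise.\<close>

class complex_normed_vector = real_normed_vector +
  fixes scaleC :: "complex \<Rightarrow> 'a \<Rightarrow> 'a"  (infixr \<open>*\<^sub>C\<close> 75)
  assumes scaleC_add_right: "c *\<^sub>C (x + y) = c *\<^sub>C x + c *\<^sub>C y"
    and scaleC_add_left: "(c + d) *\<^sub>C x = c *\<^sub>C x + d *\<^sub>C x"
    and scaleC_scaleC: "c *\<^sub>C d *\<^sub>C x = (c * d) *\<^sub>C x"
    and scaleC_of_real: "complex_of_real r *\<^sub>C x = r *\<^sub>R x"
    and norm_scaleC: "norm (c *\<^sub>C x) = cmod c * norm x"

instantiation complex :: complex_normed_vector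
begin
definition scaleC_complex_def: "c *\<^sub>C (x::complex) = c * x"
instance
  by standard (simp_all add: scaleC_complex_def algebra_simps norm_mult scaleR_conv_of_real)
end

instantiation vec :: (complex_normed_vector, finite) complex_normed_vector
begin
definition scaleC_vec_def: "c *\<^sub>C (x::'a ^ 'b) = (\<chi> i. c *\<^sub>C (x $ i))"
instance
proof
  fix c d :: complex and r :: real and x y :: "'a ^ 'b"
  show "c *\<^sub>C (x + y) = c *\<^sub>C x + c *\<^sub>C y"
    by (simp add: scaleC_vec_def vec_eq_iff scaleC_add_right)
  show "(c + d) *\<^sub>C x = c *\<^sub>C x + d *\<^sub>C x"
    by (simp add: scaleC_vec_def vec_eq_iff scaleC_add_left)
  show "c *\<^sub>C d *\<^sub>C x = (c * d) *\<^sub>C x"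
    by (simp add: scaleC_vec_def vec_eq_iff scaleC_scaleC)
  show "complex_of_real r *\<^sub>C x = r *\<^sub>R x"
    by (simp add: scaleC_vec_def vec_eq_iff scaleC_of_real)
  show "norm (c *\<^sub>C x) = cmod c * norm x"
    by (simp add: scaleC_vec_def norm_vec_def norm_scaleC L2_set_right_distrib)
qed
end

global_interpretation complex_vector: vector_space "scaleC :: complex \<Rightarrow> 'a \<Rightarrow> 'a::complex_normed_vector"
proof
  fix c d :: complex and x y :: 'a
  show "1 *\<^sub>C x = x"
    using scaleC_of_real[of 1 x] by simp
qed (simp_all add: scaleC_add_right scaleC_add_left scaleC_scaleC)


section \<open>The group\<close>

definition dagger :: "complex ^ 'n ^ 'm \<Rightarrow> complex ^ 'm ^ 'n" where
  "dagger A = (\<chi> i j. cnj (A $ j $ i))"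

definition SU3 :: "(complex ^ 3 ^ 3) set" where
  "SU3 = {g. dagger g ** g = mat 1 \<and> det g = 1}"

definition torus :: "(complex ^ 3 ^ 3) set" where
  "torus = {g \<in> SU3. \<forall>i j. i \<noteq> j \<longrightarrow> g $ i $ j = 0}"

definition mexp :: "complex ^ 3 ^ 3 \<Rightarrow> complex ^ 3 ^ 3" where
  "mexp X = (\<Sum>n. (1 / fact n) *\<^sub>R (((\<lambda>Y. X ** Y) ^^ n) (mat 1)))"

definition unit_mat :: "3 \<Rightarrow> 3 \<Rightarrow> complex ^ 3 ^ 3" where
  "unit_mat i j = (\<chi> k l. if k = i \<and> l = j then 1 else 0)"


section \<open>Unitary representations\<close>

text \<open>The carrier may be a proper subspace of its type, so that subrepresentations are
  representations; inner products are linear in the second entry.\<close>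

record 'v rep =
  carr :: "'v set"
  ip :: "'v \<Rightarrow> 'v \<Rightarrow> complex"
  act :: "complex ^ 3 ^ 3 \<Rightarrow> 'v \<Rightarrow> 'v"

definition inner_product_on :: "'v::complex_normed_vector set \<Rightarrow> ('v \<Rightarrow> 'v \<Rightarrow> complex) \<Rightarrow> bool" where
  "inner_product_on V f \<longleftrightarrow>
     (\<forall>x\<in>V. \<forall>y\<in>V. f y x = cnj (f x y)) \<and>
     (\<forall>x\<in>V. \<forall>y\<in>V. \<forall>z\<in>V. f x (y + z) = f x y + f x z) \<and>
     (\<forall>x\<in>V. \<forall>y\<in>V. \<forall>c. f x (c *\<^sub>C y) = c * f x y) \<and>
     (\<forall>x\<in>V. x \<noteq> 0 \<longrightarrow> Re (f x x) > 0)"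

definition unitary_rep :: "'v::complex_normed_vector rep \<Rightarrow> bool" where
  "unitary_rep R \<longleftrightarrow>
     complex_vector.subspace (carr R) \<and>
     (\<exists>B. finite B \<and> carr R = complex_vector.span B) \<and>
     inner_product_on (carr R) (ip R) \<and>
     (\<forall>g\<in>SU3. \<forall>x\<in>carr R. act R g x \<in> carr R) \<and>
     (\<forall>g\<in>SU3. \<forall>x\<in>carr R. \<forall>y\<in>carr R. act R g (x + y) = act R g x + act R g y) \<and>
     (\<forall>g\<in>SU3. \<forall>x\<in>carr R. \<forall>c. act R g (c *\<^sub>C x) = c *\<^sub>C act R g x) \<and>
     (\<forall>x\<in>carr R. act R (mat 1) x = x) \<and>
     (\<forall>g\<in>SU3. \<forall>h\<in>SU3. \<forall>x\<in>carr R. act R (g ** h) x = act R g (act R h x)) \<and>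
     (\<forall>g\<in>SU3. \<forall>x\<in>carr R. \<forall>y\<in>carr R. ip R (act R g x) (act R g y) = ip R x y) \<and>
     (\<forall>x\<in>carr R. continuous_on SU3 (\<lambda>g. act R g x))"

definition irreducible_rep :: "'v::complex_normed_vector rep \<Rightarrow> bool" where
  "irreducible_rep R \<longleftrightarrow>
     carr R \<noteq> {0} \<and>
     (\<forall>U. complex_vector.subspace U \<and> U \<subseteq> carr R \<and> (\<forall>g\<in>SU3. \<forall>x\<in>U. act R g x \<in> U)
        \<longrightarrow> U = {0} \<or> U = carr R)"

definition restrict_rep :: "'v rep \<Rightarrow> 'v set \<Rightarrow> 'v rep" where
  "restrict_rep R U = R\<lparr>carr := U\<rparr>"

definition su3_act :: "'v::complex_normed_vector rep \<Rightarrow> complex ^ 3 ^ 3 \<Rightarrow> 'v \<Rightarrow> 'v" where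
  "su3_act R X v = vector_derivative (\<lambda>t. act R (mexp (t *\<^sub>R X)) v) (at 0)"

text \<open>Complex-linear extension to sl(3,C), along the decomposition of a matrix as \<open>A + \<i> B\<close> with
  \<open>A\<close> and \<open>B\<close> skew-Hermitian.\<close>

definition sl3_act :: "'v::complex_normed_vector rep \<Rightarrow> complex ^ 3 ^ 3 \<Rightarrow> 'v \<Rightarrow> 'v" where
  "sl3_act R X v =
     su3_act R ((1/2) *\<^sub>C (X - dagger X)) v + \<i> *\<^sub>C su3_act R ((- \<i>/2) *\<^sub>C (X + dagger X)) v"

definition "T_plus R = sl3_act R (unit_mat 1 2)"
definition "T_minus R = sl3_act R (unit_mat 2 1)"
definition "T_three R = sl3_act R ((1/2) *\<^sub>C (unit_mat 1 1 - unit_mat 2 2))"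
definition "U_plus R = sl3_act R (unit_mat 2 3)"
definition "U_minus R = sl3_act R (unit_mat 3 2)"
definition "U_three R = sl3_act R ((1/2) *\<^sub>C (unit_mat 2 2 - unit_mat 3 3))"

definition highest_weight_vector :: "nat \<times> nat \<Rightarrow> 'v::complex_normed_vector rep \<Rightarrow> 'v \<Rightarrow> bool" where
  "highest_weight_vector = (\<lambda>(p, q) R v.
     v \<in> carr R \<and> v \<noteq> 0 \<and> T_plus R v = 0 \<and> U_plus R v = 0 \<and>
     T_three R v = (of_nat p / 2) *\<^sub>C v \<and> U_three R v = (of_nat q / 2) *\<^sub>C v)"

definition irrep :: "nat \<times> nat \<Rightarrow> 'v::complex_normed_vector rep \<Rightarrow> bool" where
  "irrep p R \<longleftrightarrow> unitary_rep R \<and> irreducible_rep R \<and> (\<exists>v. highest_weight_vector p R v)"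

definition dim_irrep :: "nat \<times> nat \<Rightarrow> real" where
  "dim_irrep = (\<lambda>(p, q). (real p + 1) * (real q + 1) * (real p + real q + 2) / 2)"

definition dual :: "nat \<times> nat \<Rightarrow> nat \<times> nat" where
  "dual = (\<lambda>(p, q). (q, p))"

text \<open>The number of irreps of class \<open>a\<close> in an orthogonal decomposition of \<open>R\<close> into irreps; it is
  the same for all decompositions.\<close>

definition multiplicity_irrep :: "'v::complex_normed_vector rep \<Rightarrow> nat \<times> nat \<Rightarrow> nat" where
  "multiplicity_irrep R a = (THE m. \<exists>(N::nat) U cls.
     (\<forall>i<N. U i \<subseteq> carr R \<and> irrep (cls i) (restrict_rep R (U i))) \<and>
     (\<forall>i<N. \<forall>j<N. i \<noteq> j \<longrightarrow> (\<forall>x\<in>U i. \<forall>y\<in>U j. ip R x y = 0)) \<and>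
     complex_vector.span (\<Union>i<N. U i) = carr R \<and>
     m = card {i. i < N \<and> cls i = a})"


section \<open>Gelfand-Tsetlin bases\<close>

type_synonym gt_label = "(int \<times> int \<times> int) \<times> real"

definition gt_labels :: "nat \<times> nat \<Rightarrow> gt_label set" where
  "gt_labels = (\<lambda>(p, q). {((n1, n2, n3), J). \<exists>rm rp :: int.
     0 \<le> rm \<and> rm \<le> int q \<and> int q \<le> rp \<and> rp \<le> int p + int q \<and> rm \<le> n3 \<and> n3 \<le> rp \<and>
     n1 = int p + 2 * int q - (rp + rm) \<and> n2 = rp + rm - n3 \<and> J = real_of_int (rp - rm) / 2})"

definition gt_basis :: "nat \<times> nat \<Rightarrow> 'v::complex_normed_vector rep \<Rightarrow> (gt_label \<Rightarrow> 'v) \<Rightarrow> bool" where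
  "gt_basis = (\<lambda>(p, q) R e.
     (\<forall>l\<in>gt_labels (p, q). e l \<in> carr R) \<and>
     (\<forall>l\<in>gt_labels (p, q). \<forall>l'\<in>gt_labels (p, q). ip R (e l) (e l') = (if l = l' then 1 else 0)) \<and>
     complex_vector.span (e ` gt_labels (p, q)) = carr R \<and>
     highest_weight_vector (p, q) R (e ((int p + int q, int q, 0), real q / 2)) \<and>
     (\<forall>n1 n2 n3 J. ((n1, n2, n3), J) \<in> gt_labels (p, q) \<longrightarrow>
       (let u = real_of_int (n2 - n3) / 2; P = real p; Q = real q; N = real_of_int n3 in
         U_minus R (e ((n1, n2, n3), J)) =
           of_real (sqrt ((J + u) * (J - u + 1))) *\<^sub>C e ((n1, n2 - 1, n3 + 1), J) \<and>
         T_minus R (e ((n1, n2, n3), J)) =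
           of_real (sqrt ((J - u) * (P + Q + J - u - N + 1) * (Q + J - u - N) * (u - J + N + 1)
                            / (2 * J * (2 * J + 1))))
             *\<^sub>C e ((n1 - 1, n2 + 1, n3), J - 1/2) +
           of_real (sqrt ((J + u + 1) * (P + Q - J - u - N) * (J + u + 1 + N - Q) * (J + u + 2 + N)
                            / (2 * (J + 1) * (2 * J + 1))))
             *\<^sub>C e ((n1 - 1, n2 + 1, n3), J + 1/2))))"

definition dual_label :: "nat \<times> nat \<Rightarrow> gt_label \<Rightarrow> gt_label" where
  "dual_label = (\<lambda>(a, b) ((n1, n2, n3), J).
     ((int (a + b) - n1, int (a + b) - n2, int (a + b) - n3), J))"

definition wigner_D ::
  "'v rep \<Rightarrow> (gt_label \<Rightarrow> 'v) \<Rightarrow> gt_label \<Rightarrow> gt_label \<Rightarrow> complex ^ 3 ^ 3 \<Rightarrow> complex" where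
  "wigner_D R e l l' g = ip R (e l) (act R g (e l'))"


section \<open>Operators\<close>

definition vec_rep :: "(complex ^ 3 ^ 3 \<Rightarrow> complex ^ 'n ^ 'n) \<Rightarrow> (complex ^ 'n) rep" where
  "vec_rep \<rho> = \<lparr>carr = UNIV, ip = (\<lambda>x y. \<Sum>i\<in>UNIV. cnj (x $ i) * y $ i), act = (\<lambda>g x. \<rho> g *v x)\<rparr>"

definition op_act ::
  "(complex ^ 3 ^ 3 \<Rightarrow> complex ^ 'n ^ 'n) \<Rightarrow> complex ^ 3 ^ 3 \<Rightarrow> complex ^ 'n ^ 'n \<Rightarrow> complex ^ 'n ^ 'n" where
  "op_act \<rho> g A = \<rho> g ** A ** matrix_inv (\<rho> g)"

definition op_rep :: "(complex ^ 3 ^ 3 \<Rightarrow> complex ^ 'n ^ 'n) \<Rightarrow> (complex ^ 'n ^ 'n) rep" where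
  "op_rep \<rho> = \<lparr>carr = UNIV, ip = (\<lambda>A B. trace (dagger A ** B)), act = op_act \<rho>\<rparr>"

definition cg_mult :: "(complex ^ 3 ^ 3 \<Rightarrow> complex ^ 'n ^ 'n) \<Rightarrow> nat \<times> nat \<Rightarrow> nat" where
  "cg_mult \<rho> a = multiplicity_irrep (op_rep \<rho>) a"

definition cg_series :: "(complex ^ 3 ^ 3 \<Rightarrow> complex ^ 'n ^ 'n) \<Rightarrow> (nat \<times> nat) set" where
  "cg_series \<rho> = {a. 0 < cg_mult \<rho> a}"

text \<open>\<open>E a s\<close> is the GT basis of the irrep \<open>(a;s)\<close>, whose carrier is its span. In the sign,
  \<open>n1 - n3\<close> is twice the sum of the eigenvalues \<open>(n1 - n2)/2\<close> and \<open>(n2 - n3)/2\<close>.\<close>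

definition coupled_basis ::
  "nat \<times> nat \<Rightarrow> (complex ^ 3 ^ 3 \<Rightarrow> complex ^ 'n ^ 'n) \<Rightarrow>
   (nat \<times> nat \<Rightarrow> nat \<Rightarrow> gt_label \<Rightarrow> complex ^ 'n ^ 'n) \<Rightarrow> bool" where
  "coupled_basis p \<rho> E \<longleftrightarrow>
     (\<forall>a. \<forall>s\<in>{1..cg_mult \<rho> a}.
        let R = restrict_rep (op_rep \<rho>) (complex_vector.span (E a s ` gt_labels a))
        in irrep a R \<and> gt_basis a R (E a s)) \<and>
     (\<forall>a a'. \<forall>s\<in>{1..cg_mult \<rho> a}. \<forall>s'\<in>{1..cg_mult \<rho> a'}. (a, s) \<noteq> (a', s') \<longrightarrow>
        (\<forall>l\<in>gt_labels a. \<forall>l'\<in>gt_labels a'. ip (op_rep \<rho>) (E a s l) (E a' s' l') = 0)) \<and>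
     complex_vector.span (\<Union>a. \<Union>s\<in>{1..cg_mult \<rho> a}. E a s ` gt_labels a) = UNIV \<and>
     (\<forall>a. \<forall>s\<in>{1..cg_mult \<rho> a}. \<forall>n1 n2 n3 J. ((n1, n2, n3), J) \<in> gt_labels a \<longrightarrow>
        dagger (E a s ((n1, n2, n3), J)) =
          ((-1) powi (n1 - n3)) *\<^sub>C E (dual a) s (dual_label a ((n1, n2, n3), J))) \<and>
     E (0, 0) 1 ((0, 0, 0), 0) = of_real (1 / sqrt (dim_irrep p)) *\<^sub>C mat 1"


section \<open>Phase space\<close>

text \<open>The flag manifold as the set of cosets \<open>g T\<close>, with the quotient topology.\<close>

typedef flag = "(\<lambda>g. (\<lambda>t. g ** t) ` torus) ` SU3"
proof -
  have "dagger (mat 1 :: complex ^ 3 ^ 3) = mat 1"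
    by (simp add: dagger_def mat_def vec_eq_iff)
  then have "mat 1 \<in> SU3"
    by (simp add: SU3_def)
  then show ?thesis
    by blast
qed

definition flag_base :: flag where
  "flag_base = Abs_flag torus"

definition flag_act :: "complex ^ 3 ^ 3 \<Rightarrow> flag \<Rightarrow> flag" where
  "flag_act g z = Abs_flag ((\<lambda>h. g ** h) ` Rep_flag z)"

instantiation flag :: topological_space
begin
definition open_flag_def:
  "open (S :: flag set) \<longleftrightarrow> openin (top_of_set SU3) {g \<in> SU3. flag_act g flag_base \<in> S}"
instance
proof
  show "open (UNIV :: flag set)"
    by (simp add: open_flag_def)
  fix S T :: "flag set"
  assume "open S" "open T"
  moreover have "{g \<in> SU3. flag_act g flag_base \<in> S \<inter> T} =
      {g \<in> SU3. flag_act g flag_base \<in> S} \<inter> {g \<in> SU3. flag_act g flag_base \<in> T}"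
    by blast
  ultimately show "open (S \<inter> T)"
    unfolding open_flag_def by (simp only: openin_Int)
next
  fix K :: "flag set set"
  assume *: "\<forall>S\<in>K. open S"
  have "{g \<in> SU3. flag_act g flag_base \<in> \<Union>K} = (\<Union>S\<in>K. {g \<in> SU3. flag_act g flag_base \<in> S})"
    by blast
  with * show "open (\<Union>K)"
    unfolding open_flag_def by (simp only:) (rule openin_Union, blast)
qed
end

text \<open>By uniqueness of the Haar integral there is exactly one such measure.\<close>

definition invariant_flag_measure :: "flag measure \<Rightarrow> bool" where
  "invariant_flag_measure M \<longleftrightarrow>
     sets M = sets borel \<and> emeasure M (space M) = 1 \<and> (\<forall>g\<in>SU3. distr M M (flag_act g) = M)"

primrec Ck_on :: "nat \<Rightarrow> ('a::real_normed_vector \<Rightarrow> 'b::real_normed_vector) \<Rightarrow> 'a set \<Rightarrow> bool" where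
  "Ck_on 0 f S \<longleftrightarrow> continuous_on S f"
| "Ck_on (Suc k) f S \<longleftrightarrow>
     (\<exists>f'. (\<forall>x\<in>S. (f has_derivative f' x) (at x)) \<and> (\<forall>v. Ck_on k (\<lambda>x. f' x v) S))"

text \<open>A function on the quotient is smooth iff its lift to \<open>SU3\<close> is, and a function on the
  embedded submanifold \<open>SU3\<close> is smooth iff it extends locally to smooth functions on open sets of
  matrices.\<close>

definition smooth_flag :: "(flag \<Rightarrow> complex) set" where
  "smooth_flag = {f. \<forall>g\<in>SU3. \<exists>U F. open U \<and> g \<in> U \<and> (\<forall>k. Ck_on k F U) \<and>
     (\<forall>h\<in>U \<inter> SU3. F h = f (flag_act h flag_base))}"

definition m_zero :: "nat \<times> nat \<Rightarrow> nat" where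
  "m_zero = (\<lambda>(a, b). min a b + 1)"

text \<open>The label \<open>(0\<^sub>a, J\<^sup>\<gamma>\<^sub>a)\<close>, used for \<open>a \<equiv> b\<close> modulo 3 only, where the division is exact.\<close>

definition zero_label :: "nat \<times> nat \<Rightarrow> nat \<Rightarrow> gt_label" where
  "zero_label = (\<lambda>(a, b) \<gamma>. let c = (int a + 2 * int b) div 3 in
     ((c, c, c), real \<gamma> - 1 + \<bar>real a - real b\<bar> / 3))"

text \<open>In the next two definitions the value at \<open>g z\<^sub>0\<close> does not depend on \<open>g\<close>: vectors with label
  \<open>zero_label a \<gamma>\<close> are fixed by the torus, and \<open>op_at\<close> is meant for operators fixed by the torus.\<close>

definition harmonic ::
  "nat \<times> nat \<Rightarrow> 'v rep \<Rightarrow> (gt_label \<Rightarrow> 'v) \<Rightarrow> nat \<Rightarrow> gt_label \<Rightarrow> flag \<Rightarrow> complex" where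
  "harmonic a R e \<gamma> l z = (THE w. \<exists>g\<in>SU3. z = flag_act g flag_base \<and>
     w = of_real (sqrt (dim_irrep a)) * cnj (wigner_D R e l (zero_label a \<gamma>) g))"

definition op_at ::
  "(complex ^ 3 ^ 3 \<Rightarrow> complex ^ 'n ^ 'n) \<Rightarrow> complex ^ 'n ^ 'n \<Rightarrow> flag \<Rightarrow> complex ^ 'n ^ 'n" where
  "op_at \<rho> K z = (THE B. \<exists>g\<in>SU3. z = flag_act g flag_base \<and> B = op_act \<rho> g K)"


section \<open>Symbol correspondences\<close>

definition symbol_correspondence ::
  "nat \<times> nat \<Rightarrow> (complex ^ 3 ^ 3 \<Rightarrow> complex ^ 'n ^ 'n) \<Rightarrow> flag measure \<Rightarrow>
   (complex ^ 'n ^ 'n \<Rightarrow> flag \<Rightarrow> complex) \<Rightarrow> bool" where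
  "symbol_correspondence p \<rho> M W \<longleftrightarrow>
     W \<in> UNIV \<rightarrow> smooth_flag \<and>
     (\<forall>A B z. W (A + B) z = W A z + W B z) \<and>
     (\<forall>c A z. W (c *\<^sub>C A) z = c * W A z) \<and>
     inj W \<and>
     (\<forall>g\<in>SU3. \<forall>A z. W (op_act \<rho> g A) z = W A (flag_act (matrix_inv g) z)) \<and>
     (\<forall>A z. W (dagger A) z = cnj (W A z)) \<and>
     (\<forall>A. (LINT z|M. W A z) = trace A / of_real (dim_irrep p))"

text \<open>Matrices of order \<open>m \<times> n\<close> as functions on \<open>{1..m} \<times> {1..n}\<close>; the rank is the maximal number
  of linearly independent columns.\<close>

definition columns_independent :: "nat \<Rightarrow> (nat \<Rightarrow> nat \<Rightarrow> complex) \<Rightarrow> nat set \<Rightarrow> bool" where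
  "columns_independent m C S \<longleftrightarrow>
     (\<forall>x. (\<forall>i\<in>{1..m}. (\<Sum>j\<in>S. x j * C i j) = 0) \<longrightarrow> (\<forall>j\<in>S. x j = 0))"

definition matrix_rank :: "nat \<Rightarrow> nat \<Rightarrow> (nat \<Rightarrow> nat \<Rightarrow> complex) \<Rightarrow> nat" where
  "matrix_rank m n C = Max {card S |S. S \<subseteq> {1..n} \<and> columns_independent m C S}"

definition full_rank :: "nat \<Rightarrow> nat \<Rightarrow> (nat \<Rightarrow> nat \<Rightarrow> complex) \<Rightarrow> bool" where
  "full_rank m n C \<longleftrightarrow> matrix_rank m n C = min m n"

text \<open>\<open>C a \<gamma> s\<close> is the entry in row \<open>\<gamma>\<close> and column \<open>s\<close> of the matrix \<open>C a\<close>.\<close>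

definition characteristic_matrices ::
  "(complex ^ 3 ^ 3 \<Rightarrow> complex ^ 'n ^ 'n) \<Rightarrow> (nat \<times> nat \<Rightarrow> nat \<Rightarrow> nat \<Rightarrow> complex) \<Rightarrow> bool" where
  "characteristic_matrices \<rho> C \<longleftrightarrow>
     (\<forall>a\<in>cg_series \<rho>. full_rank (m_zero a) (cg_mult \<rho> a) (C a)) \<and>
     (\<forall>a\<in>cg_series \<rho>. \<forall>\<gamma>\<in>{1..m_zero a}. \<forall>s\<in>{1..cg_mult \<rho> a}. cnj (C a \<gamma> s) = C (dual a) \<gamma> s) \<and>
     C (0, 0) 1 1 = 1"

definition kernel_of ::
  "nat \<times> nat \<Rightarrow> (complex ^ 3 ^ 3 \<Rightarrow> complex ^ 'n ^ 'n) \<Rightarrow>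
   (nat \<times> nat \<Rightarrow> nat \<Rightarrow> gt_label \<Rightarrow> complex ^ 'n ^ 'n) \<Rightarrow>
   (nat \<times> nat \<Rightarrow> nat \<Rightarrow> nat \<Rightarrow> complex) \<Rightarrow> complex ^ 'n ^ 'n" where
  "kernel_of p \<rho> E C =
     of_real (1 / dim_irrep p) *\<^sub>C mat 1 +
     (\<Sum>a\<in>cg_series \<rho> - {(0, 0)}. \<Sum>s\<in>{1..cg_mult \<rho> a}. \<Sum>\<gamma>\<in>{1..m_zero a}.
        (cnj (C a \<gamma> s) * of_real (sqrt (dim_irrep a / dim_irrep p))) *\<^sub>C E a s (zero_label a \<gamma>))"

end

theory Submission
  imports Defs "HOL-Library.Function_Algebras"
begin

text \<open>A symbol correspondence is determined by the functional \<open>A \<mapsto> W\<^sub>A(z\<^sub>0)\<close>, which is \<open>tr(A K)\<close> for a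
  Hermitian operator \<open>K\<close> of trace one fixed by the torus; such an operator is a combination of the zero
  weight vectors of the coupled basis. By Schur's lemma the symbol map is injective iff, for every class
  \<open>a\<close>, the columns of \<open>C(a)\<close> are linearly independent. This is the full rank condition because
  the multiplicity of \<open>a\<close> is at most the dimension \<open>m(a)\<close> of its zero weight space: by the injectivity of
  the Berezin symbol \<open>A \<mapsto> \<langle>g v, A g v\<rangle>\<close>, where \<open>v\<close> is a highest weight vector, an equivariant
  embedding of the irrep \<open>a\<close> into the operators is determined by the invariant functional
  \<open>x \<mapsto> \<langle>v, x v\<rangle>\<close> on the zero weight space. Wigner functions of different realizations of the
  same class agree since the lowering operators, hence by unitarity the raising operators, have the same
  matrices, and since \<open>SU(3)\<close> is generated by the one-parameter groups of four skew-Hermitian combinations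
  of these.\<close>

section \<open>Complex matrices\<close>

text \<open>Representations are only assumed continuous, whereas a Gelfand-Tsetlin basis is
  described through derivatives. So differentiability along one-parameter groups and additivity of
  the differential have to be proved: averages over orbits give the former, a Lipschitz bound for
  \<rho> at the identity the latter. Moreover the basis is prescribed only by the lowering operators
  and the weight at the top. The torus weights of the other basis vectors, on which every selection
  of zero weights rests, come from a rigidity argument: translating the basis by a torus element and
  undoing the expected phases leaves the lowering matrices unchanged. Full rank means independent
  columns precisely when there are no more columns than rows, so the multiplicity bound must precede
  both directions of the equivalence. The integral condition concerns the trivial class alone: an
  invariant functional on operators is a multiple of the trace.\<close>

lemma scaleC_vec_nth [simp]: "(c *\<^sub>C x) $ i = c *\<^sub>C (x $ i)"
  by (simp add: scaleC_vec_def)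

lemma scaleC_complex [simp]: "c *\<^sub>C (z::complex) = c * z"
  by (simp add: scaleC_complex_def)

lemma dagger_nth [simp]: "dagger A $ i $ j = cnj (A $ j $ i)"
  by (simp add: dagger_def)

lemma dagger_dagger [simp]: "dagger (dagger A) = A"
  by (simp add: vec_eq_iff)

lemma dagger_add [simp]: "dagger (A + B) = dagger A + dagger B"
  by (simp add: vec_eq_iff)

lemma dagger_diff [simp]: "dagger (A - B) = dagger A - dagger B"
  by (simp add: vec_eq_iff)

lemma dagger_minus [simp]: "dagger (- A) = - dagger A"
  by (simp add: vec_eq_iff)

lemma dagger_0 [simp]: "dagger 0 = 0"
  by (simp add: vec_eq_iff)

lemma dagger_scaleC [simp]: "dagger (c *\<^sub>C A) = cnj c *\<^sub>C dagger A"
  by (simp add: vec_eq_iff)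

lemma dagger_scaleR [simp]: "dagger (r *\<^sub>R A) = r *\<^sub>R dagger A"
  by (simp add: vec_eq_iff)

lemma dagger_mult [simp]: "dagger (A ** B) = dagger B ** dagger A"
  by (simp add: vec_eq_iff matrix_matrix_mult_def mult.commute)

lemma dagger_mat [simp]: "dagger (mat c) = mat (cnj c)"
  by (simp add: vec_eq_iff mat_def)

lemma trace_dagger: "trace (dagger A) = cnj (trace A)"
  by (simp add: trace_def)

lemma trace_scaleC: "trace (c *\<^sub>C A) = c * trace A"
  by (simp add: trace_def sum_distrib_left)

lemma matrix_scaleC_left [simp]: "(c *\<^sub>C A) ** B = c *\<^sub>C (A ** B)"
  for A :: "complex ^ 'n ^ 'm"
  by (simp add: vec_eq_iff matrix_matrix_mult_def sum_distrib_left mult.assoc)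

lemma matrix_scaleC_right [simp]: "A ** (c *\<^sub>C B) = c *\<^sub>C (A ** B)"
  for A :: "complex ^ 'n ^ 'm"
  by (simp add: vec_eq_iff matrix_matrix_mult_def sum_distrib_left mult.left_commute)

lemma matrix_scaleR_left [simp]: "(c *\<^sub>R A) ** B = c *\<^sub>R (A ** B)"
  for A :: "complex ^ 'n ^ 'm"
  by (simp add: vec_eq_iff matrix_matrix_mult_def scaleR_sum_right)

lemma matrix_scaleR_right [simp]: "A ** (c *\<^sub>R B) = c *\<^sub>R (A ** B)"
  for A :: "complex ^ 'n ^ 'm"
  by (simp add: vec_eq_iff matrix_matrix_mult_def scaleR_sum_right)

lemma matrix_add_distrib_right: "(A + B) ** C = A ** C + B ** C"
  for A :: "complex ^ 'n ^ 'm"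
  by (simp add: vec_eq_iff matrix_matrix_mult_def algebra_simps sum.distrib)

lemma matrix_diff_left: "(A - B) ** C = A ** C - B ** C"
  for A :: "complex ^ 'n ^ 'm"
  by (simp add: vec_eq_iff matrix_matrix_mult_def algebra_simps sum_subtractf)

lemma matrix_diff_right: "A ** (B - C) = A ** B - A ** C"
  for A :: "complex ^ 'n ^ 'm"
  by (simp add: vec_eq_iff matrix_matrix_mult_def algebra_simps sum_subtractf)

lemma matrix_minus_left [simp]: "(- A) ** B = - (A ** B)"
  for A :: "complex ^ 'n ^ 'm"
  by (simp add: vec_eq_iff matrix_matrix_mult_def sum_negf)

lemma matrix_minus_right [simp]: "A ** (- B) = - (A ** B)"
  for A :: "complex ^ 'n ^ 'm"
  by (simp add: vec_eq_iff matrix_matrix_mult_def sum_negf)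

lemma matrix_zero_left [simp]: "0 ** B = 0" and matrix_zero_right [simp]: "A ** 0 = 0"
  for A B :: "complex ^ 'n ^ 'm"
  by (simp_all add: vec_eq_iff matrix_matrix_mult_def)

lemma bounded_bilinear_matrix_mult:
  "bounded_bilinear ((**) :: complex ^ 'n ^ 'm \<Rightarrow> complex ^ 'k ^ 'n \<Rightarrow> complex ^ 'k ^ 'm)"
  unfolding bilinear_conv_bounded_bilinear[symmetric] bilinear_def
  by (auto intro!: linearI simp: matrix_add_ldistrib matrix_add_distrib_right)

lemma bounded_bilinear_matrix_vector_mult:
  "bounded_bilinear ((*v) :: complex ^ 'n ^ 'm \<Rightarrow> complex ^ 'n \<Rightarrow> complex ^ 'm)"
  unfolding bilinear_conv_bounded_bilinear[symmetric] bilinear_def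
  by (auto intro!: linearI simp: vec_eq_iff matrix_vector_mult_def scaleR_sum_right sum.distrib algebra_simps)

lemmas has_vector_derivative_matrix_mult [derivative_intros] =
  bounded_bilinear.has_vector_derivative[OF bounded_bilinear_matrix_mult]

lemmas has_vector_derivative_matrix_vector_mult [derivative_intros] =
  bounded_bilinear.has_vector_derivative[OF bounded_bilinear_matrix_vector_mult]

lemma bounded_linear_dagger: "bounded_linear (dagger :: complex ^ 'n ^ 'm \<Rightarrow> complex ^ 'm ^ 'n)"
  by (intro linear_conv_bounded_linear[THEN iffD1] linearI) auto

lemma has_vector_derivative_componentwise:
  fixes f :: "real \<Rightarrow> 'a::euclidean_space ^ 'n"
  assumes "\<And>i. ((\<lambda>t. f t $ i) has_vector_derivative D $ i) (at x within S)"
  shows "(f has_vector_derivative D) (at x within S)"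
  unfolding has_vector_derivative_def
proof (subst has_derivative_componentwise_within, intro ballI)
  fix b :: "'a ^ 'n"
  assume "b \<in> Basis"
  then obtain i u where b: "b = axis i u" "u \<in> Basis"
    by (auto simp: Basis_vec_def)
  have "((\<lambda>t. f t $ i \<bullet> u) has_derivative (\<lambda>h. (h *\<^sub>R D $ i) \<bullet> u)) (at x within S)"
    using assms[of i] unfolding has_vector_derivative_def
    by (rule has_derivative_inner_left)
  then show "((\<lambda>t. f t \<bullet> b) has_derivative (\<lambda>h. h *\<^sub>R D \<bullet> b)) (at x within S)"
    by (simp add: b inner_axis)
qed

lemma has_vector_derivative_nth:
  "(f has_vector_derivative D) F \<Longrightarrow> ((\<lambda>t. f t $ i) has_vector_derivative D $ i) F"
  by (rule bounded_linear.has_vector_derivative[OF bounded_linear_vec_nth])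

text \<open>Uniqueness for linear differential equations reduces to this: a solution is multiplied
  by the inverse of the expected one, and the derivative of the product vanishes.\<close>

lemma vector_derivative_zero_const:
  fixes f :: "real \<Rightarrow> 'a::real_normed_vector"
  assumes "\<And>t. (f has_vector_derivative 0) (at t)"
  shows "f s = f t"
proof -
  have "(f has_derivative (\<lambda>h. 0)) (at u within UNIV)" for u
    using assms[of u] by (simp add: has_vector_derivative_def)
  from has_derivative_zero_unique[OF convex_UNIV this] show ?thesis by auto
qed

section \<open>The matrix exponential\<close>

definition mpow :: "complex ^ 3 ^ 3 \<Rightarrow> nat \<Rightarrow> complex ^ 3 ^ 3" where
  "mpow X n = ((\<lambda>Y. X ** Y) ^^ n) (mat 1)"

lemma mpow_0 [simp]: "mpow X 0 = mat 1"
  and mpow_Suc: "mpow X (Suc n) = X ** mpow X n"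
  by (simp_all add: mpow_def)

lemma mpow_commute: "mpow X n ** X = X ** mpow X n"
  by (induction n) (simp_all add: mpow_Suc matrix_mul_assoc[symmetric])

lemma mpow_scaleR: "mpow (t *\<^sub>R X) n = t ^ n *\<^sub>R mpow X n"
  by (induction n) (simp_all add: mpow_Suc)

text \<open>The norm is used as submultiplicative up to a constant K, so the terms are dominated by
  those of the scalar exponential series at \<open>norm X * K\<close>, times the norm of the
  identity.\<close>

lemma summable_mpow: "summable (\<lambda>n. (1 / fact n) *\<^sub>R mpow X n)"
proof -
  obtain K where K: "K > 0" "\<And>(A :: complex ^ 3 ^ 3) (B :: complex ^ 3 ^ 3). norm (A ** B) \<le> norm A * norm B * K"
    using bounded_bilinear.pos_bounded[OF bounded_bilinear_matrix_mult] by blast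
  have b: "norm (mpow X n) \<le> (norm X * K) ^ n * norm (mat 1 :: complex ^ 3 ^ 3)" for n
  proof (induction n)
    case (Suc n)
    have "norm (mpow X (Suc n)) \<le> norm X * norm (mpow X n) * K"
      unfolding mpow_Suc by (rule K(2))
    also have "\<dots> = (norm X * K) * norm (mpow X n)" by simp
    also have "\<dots> \<le> (norm X * K) * ((norm X * K) ^ n * norm (mat 1 :: complex ^ 3 ^ 3))"
      using K Suc by (intro mult_left_mono) auto
    finally show ?case by simp
  qed simp
  show ?thesis
  proof (rule summable_comparison_test)
    show "summable (\<lambda>n. (norm X * K) ^ n /\<^sub>R fact n * norm (mat 1 :: complex ^ 3 ^ 3))"
      by (intro summable_mult2 summable_exp_generic)
    show "\<exists>N. \<forall>n\<ge>N. norm ((1 / fact n) *\<^sub>R mpow X n)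
        \<le> (norm X * K) ^ n /\<^sub>R fact n * norm (mat 1 :: complex ^ 3 ^ 3)"
      using b by (auto simp: divide_simps)
  qed
qed

lemma mexp_sums: "(\<lambda>n. (1 / fact n) *\<^sub>R mpow X n) sums mexp X"
  unfolding mexp_def mpow_def[symmetric] by (rule summable_sums[OF summable_mpow])

text \<open>Entrywise, exp(tX) is a scalar power series in t; this form makes termwise
  differentiation available.\<close>

lemma mexp_entry_sums: "(\<lambda>n. mpow X n $ i $ j / fact n * of_real t ^ n) sums (mexp (t *\<^sub>R X) $ i $ j)"
proof -
  have "bounded_linear (\<lambda>A :: complex ^ 3 ^ 3. A $ i $ j)"
    by (intro bounded_linear_compose[OF bounded_linear_vec_nth] bounded_linear_vec_nth)
  from bounded_linear.sums[OF this mexp_sums[of "t *\<^sub>R X"]]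
  have "(\<lambda>n. (1 / fact n * t ^ n) *\<^sub>R (mpow X n $ i $ j)) sums (mexp (t *\<^sub>R X) $ i $ j)"
    by (simp add: mpow_scaleR)
  then show ?thesis
    by (simp add: scaleR_conv_of_real[where 'a=complex] mult_ac)
qed

lemma mexp_commute: "mexp X ** X = X ** mexp X"
proof -
  have "(\<lambda>n. (1 / fact n) *\<^sub>R mpow X n ** X) sums (mexp X ** X)"
    by (rule bounded_linear.sums[OF bounded_bilinear.bounded_linear_left
          [OF bounded_bilinear_matrix_mult] mexp_sums])
  moreover have "(\<lambda>n. X ** ((1 / fact n) *\<^sub>R mpow X n)) sums (X ** mexp X)"
    by (rule bounded_linear.sums[OF bounded_bilinear.bounded_linear_right
          [OF bounded_bilinear_matrix_mult] mexp_sums])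
  ultimately show ?thesis
    by (simp add: mpow_commute sums_iff)
qed

lemma mexp_0 [simp]: "mexp 0 = mat 1"
proof -
  have "mexp (0 *\<^sub>R X) $ i $ j = mat 1 $ i $ j" for i j X
    using mexp_entry_sums[of X i j 0] powser_sums_zero[of "\<lambda>n. mpow X n $ i $ j / fact n"]
    by (auto simp: sums_iff)
  then show ?thesis by (simp add: vec_eq_iff)
qed

lemma mexp_has_vector_derivative:
  "((\<lambda>t. mexp (t *\<^sub>R X)) has_vector_derivative X ** mexp (t *\<^sub>R X)) (at t)"
proof (intro has_vector_derivative_componentwise)
  fix i j
  define c where "c = (\<lambda>n. mpow X n $ i $ j / fact n)"
  \<comment> \<open>Convergence is known at every real t. At a complex z it follows by comparison
    with the real point \<open>norm z + 1\<close>, which has larger modulus.\<close>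
  have S: "summable (\<lambda>n. c n * z ^ n)" for z :: complex
  proof (rule powser_insidea[THEN summable_norm_cancel])
    show "summable (\<lambda>n. c n * of_real (norm z + 1) ^ n)"
      using mexp_entry_sums[of X i j "norm z + 1"] unfolding c_def by (auto simp: sums_iff)
  qed (simp add: abs_of_nonneg del: of_real_add)
  define F where "F = (\<lambda>z. \<Sum>n. c n * z ^ n)"
  have "(F has_field_derivative (\<Sum>n. diffs c n * of_real t ^ n)) (at (of_real t))"
    unfolding F_def by (rule termdiffs_strong_converges_everywhere) (rule S)
  moreover have "diffs c n * of_real t ^ n
      = (\<Sum>k\<in>UNIV. X $ i $ k * (mpow X n $ k $ j / fact n * of_real t ^ n))" for n
  proof -
    have "diffs c n = (\<Sum>k\<in>UNIV. X $ i $ k * mpow X n $ k $ j) / fact n"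
      unfolding diffs_def c_def mpow_Suc fact_Suc matrix_matrix_mult_def
      by (simp del: of_nat_Suc add: field_simps)
    then show ?thesis
      by (simp add: sum_divide_distrib sum_distrib_right mult.assoc)
  qed
  moreover have "(\<lambda>n. \<Sum>k\<in>UNIV. X $ i $ k * (mpow X n $ k $ j / fact n * of_real t ^ n))
      sums (X ** mexp (t *\<^sub>R X)) $ i $ j"
    unfolding matrix_matrix_mult_def vec_lambda_beta
    by (intro sums_sum sums_mult mexp_entry_sums)
  ultimately have "(F has_field_derivative (X ** mexp (t *\<^sub>R X)) $ i $ j) (at (of_real t))"
    by (simp add: sums_iff)
  from has_vector_derivative_real_field[OF this]
  have "((\<lambda>t. F (of_real t)) has_vector_derivative (X ** mexp (t *\<^sub>R X)) $ i $ j) (at t)" .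
  moreover have "F (of_real t) = mexp (t *\<^sub>R X) $ i $ j" for t
    using mexp_entry_sums[of X i j t] by (simp add: F_def c_def sums_iff)
  ultimately show "((\<lambda>t. mexp (t *\<^sub>R X) $ i $ j) has_vector_derivative
      (X ** mexp (t *\<^sub>R X)) $ i $ j) (at t)"
    by simp
qed

lemma mexp_minus_has_vector_derivative:
  "((\<lambda>t. mexp (- t *\<^sub>R X)) has_vector_derivative - (mexp (- t *\<^sub>R X) ** X)) (at t)"
proof -
  have "((\<lambda>t. mexp (t *\<^sub>R (- X))) has_vector_derivative (- X) ** mexp (t *\<^sub>R (- X))) (at t)"
    by (rule mexp_has_vector_derivative)
  moreover have "X ** mexp (t *\<^sub>R (- X)) = mexp (t *\<^sub>R (- X)) ** X"
  proof (cases "t = 0")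
    case False
    have "mexp (t *\<^sub>R (- X)) ** (t *\<^sub>R (- X)) = (t *\<^sub>R (- X)) ** mexp (t *\<^sub>R (- X))"
      by (rule mexp_commute)
    with False show ?thesis by simp
  qed simp
  ultimately show ?thesis by simp
qed

lemma mexp_unique_aux:
  assumes M: "\<And>t. (M has_vector_derivative X ** M t) (at t)" and "M 0 = mat 1"
  shows "mexp (- t *\<^sub>R X) ** M t = mat 1"
proof -
  have "((\<lambda>t. mexp (- t *\<^sub>R X) ** M t) has_vector_derivative 0) (at t)" for t
    by (rule has_vector_derivative_eq_rhs[OF has_vector_derivative_matrix_mult
          [OF mexp_minus_has_vector_derivative M]]) (simp add: matrix_mul_assoc)
  then have "mexp (- t *\<^sub>R X) ** M t = mexp (- 0 *\<^sub>R X) ** M 0"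
    by (rule vector_derivative_zero_const)
  with assms(2) show ?thesis by simp
qed

lemma mexp_minus_left: "mexp (- t *\<^sub>R X) ** mexp (t *\<^sub>R X) = mat 1"
  using mexp_unique_aux[of "\<lambda>t. mexp (t *\<^sub>R X)"] mexp_has_vector_derivative by simp

lemma mexp_minus_right: "mexp (t *\<^sub>R X) ** mexp (- t *\<^sub>R X) = mat 1"
  using mexp_minus_left[of "- t" X] by simp

lemma mexp_unique:
  assumes "\<And>t. (M has_vector_derivative X ** M t) (at t)" and "M 0 = mat 1"
  shows "mexp (t *\<^sub>R X) = M t"
proof -
  have "mexp (t *\<^sub>R X) ** (mexp (- t *\<^sub>R X) ** M t) = mexp (t *\<^sub>R X)"
    using mexp_unique_aux[OF assms] by simp
  then show ?thesis
    by (simp add: matrix_mul_assoc mexp_minus_right[simplified])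
qed

text \<open>As a function of s, exp((s+t)X) exp(-tX) satisfies the differential equation of exp(sX)
  with the same value at 0.\<close>

lemma mexp_add: "mexp ((s + t) *\<^sub>R X) = mexp (s *\<^sub>R X) ** mexp (t *\<^sub>R X)"
proof -
  have 1: "((\<lambda>s. mexp ((s + t) *\<^sub>R X)) has_vector_derivative X ** mexp ((s + t) *\<^sub>R X)) (at s)" for s
    using vector_diff_chain_at[of "\<lambda>s. s + t" 1 s "\<lambda>u. mexp (u *\<^sub>R X)", OF _ mexp_has_vector_derivative]
    by (simp add: o_def has_vector_derivative_add_const)
  have 2: "((\<lambda>s. mexp ((s + t) *\<^sub>R X) ** mexp (- t *\<^sub>R X)) has_vector_derivative
      X ** (mexp ((s + t) *\<^sub>R X) ** mexp (- t *\<^sub>R X))) (at s)" for s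
    using has_vector_derivative_matrix_mult[OF 1 has_vector_derivative_const[of "mexp (- t *\<^sub>R X)"], of s]
    unfolding matrix_mul_assoc matrix_zero_right add_0_left .
  have 3: "mexp (s *\<^sub>R X) = mexp ((s + t) *\<^sub>R X) ** mexp (- t *\<^sub>R X)" for s
    by (rule mexp_unique[where M = "\<lambda>s. mexp ((s + t) *\<^sub>R X) ** mexp (- t *\<^sub>R X)", OF 2])
      (simp only: add_0_left mexp_minus_right)
  have "mexp (s *\<^sub>R X) ** mexp (t *\<^sub>R X) = mexp ((s + t) *\<^sub>R X) ** (mexp (- t *\<^sub>R X) ** mexp (t *\<^sub>R X))"
    unfolding 3[of s] matrix_mul_assoc ..
  then show ?thesis
    by (simp only: mexp_minus_left matrix_mul_rid)
qed

lemma mexp_conj: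
  assumes "h ** g = mat 1" "g ** h = mat 1"
  shows "mexp (t *\<^sub>R (g ** X ** h)) = g ** mexp (t *\<^sub>R X) ** h"
proof (rule mexp_unique)
  fix t
  have "g ** X ** h ** (g ** mexp (t *\<^sub>R X) ** h) = g ** X ** (h ** g) ** mexp (t *\<^sub>R X) ** h"
    by (simp add: matrix_mul_assoc)
  also have "\<dots> = g ** (X ** mexp (t *\<^sub>R X)) ** h"
    by (simp add: assms matrix_mul_assoc)
  finally have *: "g ** X ** h ** (g ** mexp (t *\<^sub>R X) ** h) = g ** (X ** mexp (t *\<^sub>R X)) ** h" .
  from has_vector_derivative_matrix_mult[OF has_vector_derivative_matrix_mult[OF
        has_vector_derivative_const[of g] mexp_has_vector_derivative[of X t]]
      has_vector_derivative_const[of h]]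
  show "((\<lambda>t. g ** mexp (t *\<^sub>R X) ** h) has_vector_derivative
      g ** X ** h ** (g ** mexp (t *\<^sub>R X) ** h)) (at t)"
    unfolding * by simp
qed (simp add: assms)

section \<open>The group SU(3)\<close>

lemma SU3_mult: "g \<in> SU3 \<Longrightarrow> h \<in> SU3 \<Longrightarrow> g ** h \<in> SU3"
  by (auto simp: SU3_def det_mul matrix_mul_assoc)
    (metis matrix_mul_assoc matrix_mul_rid)

lemma SU3_one [simp]: "mat 1 \<in> SU3"
  by (simp add: SU3_def)

lemma SU3_dagger_left: "g \<in> SU3 \<Longrightarrow> dagger g ** g = mat 1"
  and SU3_dagger_right: "g \<in> SU3 \<Longrightarrow> g ** dagger g = mat 1"
  by (auto simp: SU3_def matrix_left_right_inverse)

lemma SU3_dagger: "g \<in> SU3 \<Longrightarrow> dagger g \<in> SU3"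
proof -
  assume g: "g \<in> SU3"
  have "det (dagger g) * det g = 1"
    using SU3_dagger_left[OF g] by (metis det_I det_mul)
  with g SU3_dagger_right[OF g] show ?thesis
    by (simp add: SU3_def)
qed

lemma matrix_inv_unique:
  fixes A :: "complex ^ 'n ^ 'n"
  assumes "A ** B = mat 1"
  shows "matrix_inv A = B"
proof -
  have BA: "B ** A = mat 1" using assms by (simp add: matrix_left_right_inverse)
  then have "matrix_inv A ** A = mat 1"
    using assms unfolding matrix_inv_def by (metis (mono_tags, lifting) someI_ex)
  then show ?thesis
    by (metis assms matrix_mul_assoc matrix_mul_lid matrix_mul_rid)
qed

lemma matrix_inv_SU3: "g \<in> SU3 \<Longrightarrow> matrix_inv g = dagger g"
  by (rule matrix_inv_unique) (rule SU3_dagger_right)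

section \<open>The Lie algebra su(3) and generators of the group\<close>

definition su3 :: "(complex ^ 3 ^ 3) set" where
  "su3 = {X. dagger X = - X \<and> trace X = 0}"

text \<open>Jacobi's formula, det' = tr(X) det, verified on the expanded 3x3 determinant with the
  last diagonal entry of X eliminated by tracelessness.\<close>

lemma det_mexp:
  assumes "trace X = 0"
  shows "det (mexp (t *\<^sub>R X)) = 1"
proof -
  let ?M = "\<lambda>t. mexp (t *\<^sub>R X)"
  have X33: "X $ 3 $ 3 = - X $ 1 $ 1 - X $ 2 $ 2"
    using assms unfolding trace_def sum_3 by (simp add: algebra_simps add_eq_0_iff)
  have e: "((\<lambda>t. ?M t $ i $ j) has_vector_derivative
      (X $ i $ 1 * ?M t $ 1 $ j + X $ i $ 2 * ?M t $ 2 $ j + X $ i $ 3 * ?M t $ 3 $ j)) (at t)" for i j t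
    using has_vector_derivative_nth[OF has_vector_derivative_nth
        [OF mexp_has_vector_derivative[of X t], of i], of j]
    by (simp add: matrix_matrix_mult_def sum_3)
  have "((\<lambda>t. det (?M t)) has_vector_derivative 0) (at t)" for t
    unfolding det_3
    by (rule has_vector_derivative_eq_rhs, (rule has_vector_derivative_add has_vector_derivative_diff
          has_vector_derivative_mult e)+) (simp add: X33 algebra_simps)
  then have "det (?M t) = det (?M 0)"
    by (rule vector_derivative_zero_const)
  then show ?thesis by simp
qed

lemma mexp_dagger: "dagger (mexp X) = mexp (dagger X)"
proof -
  have *: "dagger (mpow X n) = mpow (dagger X) n" for n
    by (induction n) (simp_all add: mpow_Suc mpow_commute[symmetric])
  have "(\<lambda>n. dagger ((1 / fact n) *\<^sub>R mpow X n)) sums dagger (mexp X)"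
    by (rule bounded_linear.sums[OF bounded_linear_dagger mexp_sums])
  with mexp_sums[of "dagger X"] show ?thesis
    by (simp add: * sums_iff)
qed

lemma mexp_SU3:
  assumes "X \<in> su3"
  shows "mexp (t *\<^sub>R X) \<in> SU3"
proof -
  have "dagger (mexp (t *\<^sub>R X)) = mexp (- t *\<^sub>R X)"
    using assms by (simp add: mexp_dagger su3_def)
  then show ?thesis
    using assms det_mexp[of X t] mexp_minus_left[of t X] by (simp add: SU3_def su3_def)
qed

text \<open>\<open>unit_mat i j = skew_gen i j + \<i> *\<^sub>C sym_gen i j\<close> is the
  decomposition into skew-Hermitian parts on which \<open>sl3_act\<close> is based.\<close>

definition skew_gen :: "3 \<Rightarrow> 3 \<Rightarrow> complex ^ 3 ^ 3" where
  "skew_gen i j = (1/2) *\<^sub>C (unit_mat i j - unit_mat j i)"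

definition sym_gen :: "3 \<Rightarrow> 3 \<Rightarrow> complex ^ 3 ^ 3" where
  "sym_gen i j = (- \<i>/2) *\<^sub>C (unit_mat i j + unit_mat j i)"

text \<open>Only the two simple roots occur, matching the operators T and U of the Gelfand-Tsetlin
  relations.\<close>

definition su3_gens :: "(complex ^ 3 ^ 3) set" where
  "su3_gens = {skew_gen 1 2, sym_gen 1 2, skew_gen 2 3, sym_gen 2 3}"

definition block12 :: "complex \<Rightarrow> complex \<Rightarrow> complex ^ 3 ^ 3" where
  "block12 \<alpha> \<beta> = vector [vector [\<alpha>, \<beta>, 0], vector [- cnj \<beta>, cnj \<alpha>, 0], vector [0, 0, 1]]"

definition block23 :: "complex \<Rightarrow> complex \<Rightarrow> complex ^ 3 ^ 3" where
  "block23 \<alpha> \<beta> = vector [vector [1, 0, 0], vector [0, \<alpha>, \<beta>], vector [0, - cnj \<beta>, cnj \<alpha>]]"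

lemma unit_mat_nth [simp]: "unit_mat i j $ k $ l = (if k = i \<and> l = j then 1 else 0)"
  by (simp add: unit_mat_def)

lemma dagger_unit_mat [simp]: "dagger (unit_mat i j) = unit_mat j i"
  by (auto simp: vec_eq_iff)

lemma trace_unit_mat: "trace (unit_mat i j) = (if i = j then 1 else 0)"
proof (cases "i = j")
  case False
  then have "(if ia = i \<and> ia = j then 1 else 0) = (0 :: complex)" for ia by auto
  with False show ?thesis by (simp add: trace_def)
qed (simp add: trace_def)

lemma unit_mat_mult: "unit_mat i j ** unit_mat k l = (if j = k then unit_mat i l else 0)"
proof -
  have "(unit_mat i j ** unit_mat k l) $ r $ s = (if j = k then unit_mat i l else 0) $ r $ s" for r s
    by (cases "j = k") (auto simp: matrix_matrix_mult_def if_distrib[of "\<lambda>x. x * _"] cong: if_cong)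
  then show ?thesis by (simp add: vec_eq_iff)
qed

lemma trace_minus: "trace (- A) = - trace A" for A :: "complex ^ 'n ^ 'n"
  by (simp add: trace_def sum_negf)

lemma skew_gen_su3: "skew_gen i j \<in> su3"
  and sym_gen_su3: "i \<noteq> j \<Longrightarrow> sym_gen i j \<in> su3"
  by (auto simp: su3_def skew_gen_def sym_gen_def trace_scaleC trace_sub trace_add trace_minus trace_unit_mat
      complex_vector.scale_right_diff_distrib complex_vector.scale_right_distrib)

lemma su3_gens_su3: "X \<in> su3_gens \<Longrightarrow> X \<in> su3"
  using sym_gen_su3[of 1 2] sym_gen_su3[of 2 3] skew_gen_su3 by (auto simp: su3_gens_def)

lemmas matrix3_eq = vec_eq_iff forall_3 matrix_matrix_mult_def sum_3

lemma has_vector_derivative_matrix3: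
  fixes F :: "real \<Rightarrow> complex ^ 3 ^ 3"
  assumes "\<And>i j. ((\<lambda>t. F t $ i $ j) has_vector_derivative D $ i $ j) (at t)"
  shows "(F has_vector_derivative D) (at t)"
  by (intro has_vector_derivative_componentwise assms)

lemma has_vector_derivative_of_real_cos:
  "((\<lambda>t. of_real (cos (t / 2)) :: complex) has_vector_derivative - of_real (sin (t / 2)) / 2) (at t)"
  and has_vector_derivative_of_real_sin:
  "((\<lambda>t. of_real (sin (t / 2)) :: complex) has_vector_derivative of_real (cos (t / 2)) / 2) (at t)"
proof -
  have "((\<lambda>t. cos (t / 2)) has_real_derivative - sin (t / 2) / 2) (at t)"
    "((\<lambda>t. sin (t / 2)) has_real_derivative cos (t / 2) / 2) (at t)"
    by (auto intro!: derivative_eq_intros)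
  from this[THEN has_vector_derivative_of_real[where 'a=complex]]
  show "((\<lambda>t. of_real (cos (t / 2)) :: complex) has_vector_derivative - of_real (sin (t / 2)) / 2) (at t)"
    "((\<lambda>t. of_real (sin (t / 2)) :: complex) has_vector_derivative of_real (cos (t / 2)) / 2) (at t)"
    by simp_all
qed

text \<open>Both sides solve the same differential equation with value 1 at t = 0; the factor 1/2 in
  the generators turns t into the half angle.\<close>

lemma mexp_skew_gen_12: "mexp (t *\<^sub>R skew_gen 1 2) = block12 (of_real (cos (t / 2))) (of_real (sin (t / 2)))"
  and mexp_sym_gen_12: "mexp (t *\<^sub>R sym_gen 1 2) = block12 (of_real (cos (t / 2))) (- \<i> * of_real (sin (t / 2)))"
  and mexp_skew_gen_23: "mexp (t *\<^sub>R skew_gen 2 3) = block23 (of_real (cos (t / 2))) (of_real (sin (t / 2)))"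
  and mexp_sym_gen_23: "mexp (t *\<^sub>R sym_gen 2 3) = block23 (of_real (cos (t / 2))) (- \<i> * of_real (sin (t / 2)))"
proof -
  note d = has_vector_derivative_of_real_cos has_vector_derivative_of_real_sin
    has_vector_derivative_minus[OF has_vector_derivative_of_real_sin]
    has_vector_derivative_mult_right[OF has_vector_derivative_of_real_sin]
    has_vector_derivative_minus[OF has_vector_derivative_mult_right[OF has_vector_derivative_of_real_sin]]
    has_vector_derivative_const
  have ex: "P i j" if "P 1 1" "P 1 2" "P 1 3" "P 2 1" "P 2 2" "P 2 3" "P 3 1" "P 3 2" "P 3 3" for P :: "3 \<Rightarrow> 3 \<Rightarrow> bool" and i j
    using that exhaust_3[of i] exhaust_3[of j] by auto
  note defs = block12_def block23_def skew_gen_def sym_gen_def matrix_matrix_mult_def sum_3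
  show "mexp (t *\<^sub>R skew_gen 1 2) = block12 (of_real (cos (t / 2))) (of_real (sin (t / 2)))"
    by (rule mexp_unique, rule has_vector_derivative_matrix3, rule ex)
      (auto simp: defs vec_eq_iff forall_3 mat_def intro!: has_vector_derivative_eq_rhs[OF d(1)]
        has_vector_derivative_eq_rhs[OF d(2)] has_vector_derivative_eq_rhs[OF d(3)])
  show "mexp (t *\<^sub>R sym_gen 1 2) = block12 (of_real (cos (t / 2))) (- \<i> * of_real (sin (t / 2)))"
    by (rule mexp_unique, rule has_vector_derivative_matrix3, rule ex)
      (auto simp: defs vec_eq_iff forall_3 mat_def intro!: has_vector_derivative_eq_rhs[OF d(1)]
        has_vector_derivative_eq_rhs[OF d(4)] has_vector_derivative_eq_rhs[OF d(5)])
  show "mexp (t *\<^sub>R skew_gen 2 3) = block23 (of_real (cos (t / 2))) (of_real (sin (t / 2)))"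
    by (rule mexp_unique, rule has_vector_derivative_matrix3, rule ex)
      (auto simp: defs vec_eq_iff forall_3 mat_def intro!: has_vector_derivative_eq_rhs[OF d(1)]
        has_vector_derivative_eq_rhs[OF d(2)] has_vector_derivative_eq_rhs[OF d(3)])
  show "mexp (t *\<^sub>R sym_gen 2 3) = block23 (of_real (cos (t / 2))) (- \<i> * of_real (sin (t / 2)))"
    by (rule mexp_unique, rule has_vector_derivative_matrix3, rule ex)
      (auto simp: defs vec_eq_iff forall_3 mat_def intro!: has_vector_derivative_eq_rhs[OF d(1)]
        has_vector_derivative_eq_rhs[OF d(4)] has_vector_derivative_eq_rhs[OF d(5)])
qed

lemma block12_mult:
  "block12 \<alpha> \<beta> ** block12 \<gamma> \<delta> = block12 (\<alpha> * \<gamma> - \<beta> * cnj \<delta>) (\<alpha> * \<delta> + \<beta> * cnj \<gamma>)"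
  and block23_mult:
  "block23 \<alpha> \<beta> ** block23 \<gamma> \<delta> = block23 (\<alpha> * \<gamma> - \<beta> * cnj \<delta>) (\<alpha> * \<delta> + \<beta> * cnj \<gamma>)"
  by (simp_all add: matrix3_eq block12_def block23_def algebra_simps)

text \<open>Euler angles: with \<open>R(\<theta>)\<close> the rotations and \<open>S(\<phi>)\<close> the second one-parameter group,
  \<open>R(\<pi>/4) S(\<phi>) R(-\<pi>/4) = diag(e\<^sup>-\<^sup>i\<^sup>\<phi>, e\<^sup>i\<^sup>\<phi>)\<close>.\<close>

lemma SU2_euler:
  fixes K :: "complex \<Rightarrow> complex \<Rightarrow> complex ^ 3 ^ 3"
  assumes mult: "\<And>\<alpha> \<beta> \<gamma> \<delta>. K \<alpha> \<beta> ** K \<gamma> \<delta> = K (\<alpha> * \<gamma> - \<beta> * cnj \<delta>) (\<alpha> * \<delta> + \<beta> * cnj \<gamma>)"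
    and R: "\<And>\<theta>. P (K (of_real (cos \<theta>)) (of_real (sin \<theta>)))"
    and S: "\<And>\<theta>. P (K (of_real (cos \<theta>)) (- \<i> * of_real (sin \<theta>)))"
    and PP: "\<And>\<alpha> \<beta> \<gamma> \<delta>. cmod \<alpha> ^ 2 + cmod \<beta> ^ 2 = 1 \<Longrightarrow> cmod \<gamma> ^ 2 + cmod \<delta> ^ 2 = 1 \<Longrightarrow>
       P (K \<alpha> \<beta>) \<Longrightarrow> P (K \<gamma> \<delta>) \<Longrightarrow> P (K \<alpha> \<beta> ** K \<gamma> \<delta>)"
    and n: "cmod \<alpha> ^ 2 + cmod \<beta> ^ 2 = 1"
  shows "P (K \<alpha> \<beta>)"
proof -
  have D: "P (K (cis \<psi>) 0)" for \<psi>
  proof -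
    let ?r = "of_real (sqrt 2 / 2) :: complex"
    have r: "?r * ?r = 1/2" by (simp flip: of_real_mult)
    have 1: "P (K ?r ?r)" using R[of "pi/4"] by (simp add: cos_45 sin_45)
    have 2: "P (K ?r (- ?r))" using R[of "- pi/4"] by (simp add: cos_45 sin_45)
    have n1: "cmod ?r ^ 2 + cmod ?r ^ 2 = 1"
      by (simp add: norm_of_real power2_eq_square del: of_real_divide of_real_numeral)
    have n2: "cmod (of_real (cos \<psi>)) ^ 2 + cmod (\<i> * of_real (sin \<psi>)) ^ 2 = 1"
      by (simp add: norm_mult)
    have 3: "P (K (of_real (cos \<psi>)) (\<i> * of_real (sin \<psi>)))"
      using S[of "- \<psi>"] by simp
    let ?a = "?r * (of_real (cos \<psi>)) - ?r * cnj (\<i> * of_real (sin \<psi>))"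
    let ?b = "?r * (\<i> * of_real (sin \<psi>)) + ?r * cnj (of_real (cos \<psi>))"
    have ab: "?a = ?r * cis \<psi>" "?b = ?r * cis \<psi>"
      by (simp_all add: cis_conv_exp exp_Euler algebra_simps cos_of_real sin_of_real)
    have "P (K ?a ?b)"
      using PP[OF n1 n2 1 3] unfolding mult .
    then have 4: "P (K (?r * cis \<psi>) (?r * cis \<psi>))" unfolding ab .
    have "P (K (?r * cis \<psi>) (?r * cis \<psi>) ** K ?r (- ?r))"
      using n1 by (intro PP 4 2) (simp_all add: norm_mult)
    moreover have "K (?r * cis \<psi>) (?r * cis \<psi>) ** K ?r (- ?r) = K (cis \<psi>) 0"
    proof -
      have "?r * cis \<psi> * ?r - ?r * cis \<psi> * cnj (- ?r) = (?r * ?r + ?r * ?r) * cis \<psi>"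
        "?r * cis \<psi> * (- ?r) + ?r * cis \<psi> * cnj ?r = 0"
        unfolding complex_cnj_minus complex_cnj_complex_of_real by algebra+
      then show ?thesis unfolding mult r by simp
    qed
    ultimately show ?thesis by simp
  qed
  obtain \<theta> where \<theta>: "cmod \<alpha> = cos \<theta>" "cmod \<beta> = sin \<theta>"
    using sincos_total_2pi[of "cmod \<alpha>" "cmod \<beta>"] n by auto
  \<comment> \<open>Half sum and half difference of the two phases: diagonal factors with phase
    \<psi> on the left and \<eta> on the right multiply the cosine by the phase \<psi> + \<eta> and
    the sine by \<psi> - \<eta>.\<close>
  define \<psi> \<eta> where "\<psi> = (Arg \<alpha> + Arg \<beta>) / 2" and "\<eta> = (Arg \<alpha> - Arg \<beta>) / 2"
  have a: "\<alpha> = of_real (cos \<theta>) * cis (\<psi> + \<eta>)" and b: "\<beta> = of_real (sin \<theta>) * cis (\<psi> - \<eta>)"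
    using rcis_cmod_Arg[of \<alpha>] rcis_cmod_Arg[of \<beta>] \<theta> by (simp_all add: \<psi>_def \<eta>_def rcis_def field_simps)
  have n3: "cmod (of_real (cos \<theta>)) ^ 2 + cmod (of_real (sin \<theta>)) ^ 2 = 1" by simp
  have n4: "cmod (cis \<psi>) ^ 2 + cmod 0 ^ 2 = 1" for \<psi> by simp
  have "P (K (cis \<psi>) 0 ** K (of_real (cos \<theta>)) (of_real (sin \<theta>)))"
    by (rule PP[OF n4 n3 D R])
  then have "P (K (of_real (cos \<theta>) * cis \<psi>) (of_real (sin \<theta>) * cis \<psi>))"
    unfolding mult by (simp add: mult.commute)
  then have "P (K (of_real (cos \<theta>) * cis \<psi>) (of_real (sin \<theta>) * cis \<psi>) ** K (cis \<eta>) 0)"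
    by (intro PP D) (simp_all add: norm_mult)
  then show ?thesis
    unfolding mult a b by (simp add: cis_cnj cis_mult mult.assoc)
qed

lemma dagger_block23: "dagger (block23 \<alpha> \<beta>) = block23 (cnj \<alpha>) (- \<beta>)"
  and dagger_block12: "dagger (block12 \<alpha> \<beta>) = block12 (cnj \<alpha>) (- \<beta>)"
  by (simp_all add: matrix3_eq block12_def block23_def)

lemma block_SU3:
  assumes "cmod \<alpha> ^ 2 + cmod \<beta> ^ 2 = 1"
  shows "block12 \<alpha> \<beta> \<in> SU3" "block23 \<alpha> \<beta> \<in> SU3"
proof -
  have "\<alpha> * cnj \<alpha> + \<beta> * cnj \<beta> = 1"
    using assms by (metis complex_norm_square of_real_1 of_real_add)
  then have *: "cnj \<alpha> * \<alpha> - (- \<beta>) * cnj \<beta> = 1" "\<alpha> * cnj \<alpha> = 1 - \<beta> * cnj \<beta>"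
    by (simp_all add: mult.commute algebra_simps)
  have 0: "cnj \<alpha> * \<beta> + (- \<beta>) * cnj \<alpha> = 0"
    by simp
  have 1: "block12 1 0 = mat 1" "block23 1 0 = mat 1"
    by (simp_all add: matrix3_eq block12_def block23_def mat_def)
  show "block12 \<alpha> \<beta> \<in> SU3" "block23 \<alpha> \<beta> \<in> SU3"
    unfolding SU3_def mem_Collect_eq dagger_block12 dagger_block23 block12_mult block23_mult *(1) 0 1
    by (simp_all add: det_3 block12_def block23_def *(2))
qed

text \<open>A Givens elimination in the first column writes an element of \<open>SU(3)\<close> as a product of three
  elements of the two embedded copies of \<open>SU(2)\<close>.\<close>

lemma SU3_induct [consumes 1, case_names exp mult]:
  assumes g: "g \<in> SU3"
    and E: "\<And>X t. X \<in> su3_gens \<Longrightarrow> P (mexp (t *\<^sub>R X))"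
    and PP: "\<And>g h. g \<in> SU3 \<Longrightarrow> h \<in> SU3 \<Longrightarrow> P g \<Longrightarrow> P h \<Longrightarrow> P (g ** h)"
  shows "P g"
proof -
  have P12: "P (block12 \<alpha> \<beta>)" if "cmod \<alpha> ^ 2 + cmod \<beta> ^ 2 = 1" for \<alpha> \<beta>
    using block12_mult _ _ _ that
  proof (rule SU2_euler[where P = P and K = block12])
    show "P (block12 (of_real (cos \<theta>)) (of_real (sin \<theta>)))" for \<theta>
      using E[of "skew_gen 1 2" "2 * \<theta>"] by (simp add: su3_gens_def mexp_skew_gen_12)
    show "P (block12 (of_real (cos \<theta>)) (- \<i> * of_real (sin \<theta>)))" for \<theta>
      using E[of "sym_gen 1 2" "2 * \<theta>"] by (simp add: su3_gens_def mexp_sym_gen_12)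
  qed (intro PP block_SU3)
  have P23: "P (block23 \<alpha> \<beta>)" if "cmod \<alpha> ^ 2 + cmod \<beta> ^ 2 = 1" for \<alpha> \<beta>
    using block23_mult _ _ _ that
  proof (rule SU2_euler[where P = P and K = block23])
    show "P (block23 (of_real (cos \<theta>)) (of_real (sin \<theta>)))" for \<theta>
      using E[of "skew_gen 2 3" "2 * \<theta>"] by (simp add: su3_gens_def mexp_skew_gen_23)
    show "P (block23 (of_real (cos \<theta>)) (- \<i> * of_real (sin \<theta>)))" for \<theta>
      using E[of "sym_gen 2 3" "2 * \<theta>"] by (simp add: su3_gens_def mexp_sym_gen_23)
  qed (intro PP block_SU3)
  define x y z where "x = g $ 1 $ 1" and "y = g $ 2 $ 1" and "z = g $ 3 $ 1"
  have xyz: "cmod x ^ 2 + cmod y ^ 2 + cmod z ^ 2 = 1"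
  proof -
    have "(dagger g ** g) $ 1 $ 1 = 1" using SU3_dagger_left[OF g] by (simp add: mat_def)
    then have "of_real (cmod x ^ 2 + cmod y ^ 2 + cmod z ^ 2) = (1 :: complex)"
      unfolding of_real_add complex_norm_square
      by (simp add: matrix_matrix_mult_def sum_3 x_def y_def z_def mult.commute)
    then show ?thesis unfolding of_real_eq_1_iff .
  qed
  define r where "r = sqrt (cmod y ^ 2 + cmod z ^ 2)"
  have r2: "r ^ 2 = cmod y ^ 2 + cmod z ^ 2" by (simp add: r_def)
  \<comment> \<open>A block in rows 2 and 3 that turns the lower part (y, z) of the first column
    into (r, 0). For r = 0 the identity does.\<close>
  obtain \<alpha> \<beta> where ab: "cmod \<alpha> ^ 2 + cmod \<beta> ^ 2 = 1"
    and 1: "\<alpha> * y + \<beta> * z = of_real r" and 2: "- cnj \<beta> * y + cnj \<alpha> * z = 0"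
  proof (cases "r = 0")
    case True
    then have "y = 0" "z = 0" using r2 by (auto simp: sum_power2_eq_zero_iff)
    with True that[of 1 0] show ?thesis by simp
  next
    case False
    have "cmod (cnj y / of_real r) ^ 2 + cmod (cnj z / of_real r) ^ 2 = (cmod y ^ 2 + cmod z ^ 2) / r ^ 2"
      by (simp add: norm_divide power_divide add_divide_distrib)
    also have "\<dots> = 1" using False unfolding r2[symmetric] by simp
    finally have n: "cmod (cnj y / of_real r) ^ 2 + cmod (cnj z / of_real r) ^ 2 = 1" .
    have "cnj y * y + cnj z * z = of_real r * of_real r"
      using arg_cong[OF r2, of complex_of_real]
      by (simp only: of_real_add complex_norm_square) (simp add: power2_eq_square mult.commute)
    then have "cnj y / of_real r * y + cnj z / of_real r * z = of_real r"
      using False by (simp add: field_simps)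
    with n that[of "cnj y / of_real r" "cnj z / of_real r"] show ?thesis by simp
  qed
  have n': "cmod (cnj x) ^ 2 + cmod (of_real r) ^ 2 = 1" using r2 xyz by simp
  \<comment> \<open>After \<open>k\<close> the first column is (x, r, 0) with |x|^2 + r^2 = 1, and
    the block \<open>k'\<close> turns it into the first unit vector.\<close>
  define k k' m where "k = block23 \<alpha> \<beta>" and "k' = block12 (cnj x) (of_real r)" and "m = k' ** (k ** g)"
  have kS: "k \<in> SU3" "k' \<in> SU3" using block_SU3 ab n' by (auto simp: k_def k'_def)
  then have mS: "m \<in> SU3" unfolding m_def using g by (intro SU3_mult)
  have xr: "cnj x * x + of_real r * of_real r = 1"
    using arg_cong[OF n', of complex_of_real]
    by (simp only: of_real_add complex_norm_square) (simp add: mult.commute)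
  have "(k ** g) $ 1 $ 1 = x" "(k ** g) $ 2 $ 1 = of_real r" "(k ** g) $ 3 $ 1 = 0"
    using 1 2 by (simp_all add: k_def block23_def matrix_matrix_mult_def sum_3 x_def y_def z_def)
  then have m1: "m $ 1 $ 1 = 1" "m $ 2 $ 1 = 0" "m $ 3 $ 1 = 0"
    using xr unfolding m_def matrix_matrix_mult_def[of k']
    by (simp_all add: k'_def block12_def sum_3 mult.commute)
  have "of_real (cmod (m $ 1 $ 1) ^ 2 + cmod (m $ 1 $ 2) ^ 2 + cmod (m $ 1 $ 3) ^ 2) = (1 :: complex)"
    using arg_cong[OF SU3_dagger_right[OF mS], of "\<lambda>A. A $ 1 $ 1"]
    unfolding of_real_add complex_norm_square by (simp add: matrix_matrix_mult_def sum_3 mat_def)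
  then have "cmod (m $ 1 $ 2) ^ 2 + cmod (m $ 1 $ 3) ^ 2 = 0"
    unfolding of_real_eq_1_iff by (simp add: m1)
  then have m2: "m $ 1 $ 2 = 0" "m $ 1 $ 3 = 0"
    by (auto simp: sum_power2_eq_zero_iff)
  \<comment> \<open>The first row and column of m are those of the identity. Unitarity and
    determinant 1 of the remaining 2x2 block force \<open>d = cnj a\<close> and
    \<open>c = - cnj b\<close>, so it lies in SU(2).\<close>
  define a b c d where "a = m $ 2 $ 2" and "b = m $ 2 $ 3" and "c = m $ 3 $ 2" and "d = m $ 3 $ 3"
  have det: "a * d - b * c = 1"
    using mS m1 m2 unfolding SU3_def by (simp add: det_3 a_def b_def c_def d_def)
  have row: "a * cnj a + b * cnj b = 1" "a * cnj c + b * cnj d = 0"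
    using arg_cong[OF SU3_dagger_right[OF mS], of "\<lambda>A. A $ 2 $ 2"]
      arg_cong[OF SU3_dagger_right[OF mS], of "\<lambda>A. A $ 2 $ 3"] m1
    by (simp_all add: matrix_matrix_mult_def sum_3 mat_def a_def b_def c_def d_def)
  have row': "cnj a * c + cnj b * d = 0"
    using arg_cong[OF row(2), of cnj] by simp
  have "d = (a * cnj a + b * cnj b) * d" using row by simp
  also have "\<dots> = cnj a * (a * d - b * c) + b * (cnj a * c + cnj b * d)" by (simp add: algebra_simps)
  finally have d: "d = cnj a" using det row' by simp
  have "c = (a * cnj a + b * cnj b) * c" using row by simp
  also have "\<dots> = a * (cnj a * c + cnj b * d) - cnj b * (a * d - b * c)" by (simp add: algebra_simps)
  finally have c: "c = - cnj b" using det row' by simp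
  have "m = block23 a b"
    using m1 m2 c d by (simp add: matrix3_eq block23_def a_def b_def c_def d_def)
  moreover have "cmod a ^ 2 + cmod b ^ 2 = 1"
    using row(1) unfolding complex_norm_square[symmetric] of_real_add[symmetric] of_real_eq_1_iff .
  ultimately have Pm: "P m" using P23 by simp
  have "g = dagger k ** (dagger k' ** m)"
    using SU3_dagger_left[OF kS(1)] SU3_dagger_left[OF kS(2)]
    by (simp add: m_def matrix_mul_assoc)
  moreover have "P (dagger k)" "P (dagger k')"
    unfolding k_def k'_def dagger_block12 dagger_block23 using ab n' by (auto intro!: P12 P23)
  ultimately show ?thesis
    using Pm kS mS by (auto intro!: PP SU3_mult SU3_dagger)
qed

section \<open>Finite-dimensional subspaces\<close>

lemma has_vector_derivative_tendsto_quotient: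
  assumes "(f has_vector_derivative D) (at x)"
  shows "((\<lambda>h. (f (x + h) - f x) /\<^sub>R h) \<longlongrightarrow> D) (at 0)"
proof (rule LIM_zero_cancel, rule tendsto_norm_zero_cancel, rule Lim_transform_eventually)
  show "((\<lambda>h. norm (f (x + h) - f x - h *\<^sub>R D) / norm h) \<longlongrightarrow> 0) (at 0)"
    using assms unfolding has_vector_derivative_def has_derivative_at by simp
  have "norm (f (x + h) - f x - h *\<^sub>R D) / norm h = norm ((f (x + h) - f x) /\<^sub>R h - D)" if "h \<noteq> 0" for h
  proof -
    have "(f (x + h) - f x) /\<^sub>R h - D = (f (x + h) - f x - h *\<^sub>R D) /\<^sub>R h"
      using that by (simp add: scaleR_diff_right)
    then show ?thesis by (simp add: divide_inverse mult.commute)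
  qed
  then show "\<forall>\<^sub>F h in at 0. norm (f (x + h) - f x - h *\<^sub>R D) / norm h = norm ((f (x + h) - f x) /\<^sub>R h - D)"
    by (auto simp: eventually_at intro: exI[of _ 1])
qed

lemma bounded_bilinear_scaleC: "bounded_bilinear (scaleC :: complex \<Rightarrow> 'a \<Rightarrow> 'a::complex_normed_vector)"
proof
  fix r :: real and c :: complex and x :: 'a
  show "(r *\<^sub>R c) *\<^sub>C x = r *\<^sub>R c *\<^sub>C x"
    by (simp add: scaleR_conv_of_real[of r c] scaleC_of_real[symmetric])
  show "c *\<^sub>C r *\<^sub>R x = r *\<^sub>R c *\<^sub>C x"
    by (simp add: scaleC_of_real[symmetric] mult.commute)
  show "\<exists>K. \<forall>a (b::'a). norm (a *\<^sub>C b) \<le> norm a * norm b * K"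
    by (rule exI[of _ 1]) (simp add: norm_scaleC)
qed (simp_all add: scaleC_add_right scaleC_add_left)

lemmas tendsto_scaleC = bounded_bilinear.tendsto[OF bounded_bilinear_scaleC]

definition lin_indep :: "('i \<Rightarrow> 'v::complex_normed_vector) \<Rightarrow> 'i set \<Rightarrow> bool" where
  "lin_indep f L \<longleftrightarrow> (\<forall>c. (\<Sum>l\<in>L. c l *\<^sub>C f l) = 0 \<longrightarrow> (\<forall>l\<in>L. c l = 0))"

text \<open>Continuity of the coordinates with a quantitative constant; it is what makes the span of
  a finite family complete, hence closed.\<close>

definition coeff_bound :: "('i \<Rightarrow> 'v::complex_normed_vector) \<Rightarrow> 'i set \<Rightarrow> real \<Rightarrow> bool" where
  "coeff_bound f L K \<longleftrightarrow> (\<forall>c. \<forall>l\<in>L. cmod (c l) \<le> K * norm (\<Sum>l\<in>L. c l *\<^sub>C f l))"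

text \<open>The bound turns a convergent sequence of combinations into Cauchy sequences of
  coefficients, whose limits are the coefficients of the limit.\<close>

lemma coeff_limit:
  assumes "finite L" "coeff_bound f L K" and lim: "(\<lambda>n. \<Sum>l\<in>L. c n l *\<^sub>C f l) \<longlonglongrightarrow> x"
  shows "\<exists>d. x = (\<Sum>l\<in>L. d l *\<^sub>C f l)"
proof -
  have "\<exists>d. (\<lambda>n. c n l) \<longlonglongrightarrow> d" if l: "l \<in> L" for l
  proof -
    have b: "cmod (c m l - c n l) \<le> K * norm ((\<Sum>l\<in>L. c m l *\<^sub>C f l) - (\<Sum>l\<in>L. c n l *\<^sub>C f l))" for m n
      using assms(2) l unfolding coeff_bound_def
      by (auto simp: complex_vector.scale_left_diff_distrib sum_subtractf dest!: spec[of _ "\<lambda>l. c m l - c n l"])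
    have C: "Cauchy (\<lambda>n. \<Sum>l\<in>L. c n l *\<^sub>C f l)"
      using lim by (rule LIMSEQ_imp_Cauchy)
    have "Cauchy (\<lambda>n. c n l)"
    proof (rule metric_CauchyI)
      fix \<epsilon> :: real assume "\<epsilon> > 0"
      then have "\<epsilon> / (\<bar>K\<bar> + 1) > 0" by simp
      from metric_CauchyD[OF C this] obtain N where
        N: "\<And>m n. m \<ge> N \<Longrightarrow> n \<ge> N \<Longrightarrow>
          norm ((\<Sum>l\<in>L. c m l *\<^sub>C f l) - (\<Sum>l\<in>L. c n l *\<^sub>C f l)) < \<epsilon> / (\<bar>K\<bar> + 1)"
        by (auto simp: dist_norm)
      have "dist (c m l) (c n l) < \<epsilon>" if "m \<ge> N" "n \<ge> N" for m n
      proof -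
        let ?y = "norm ((\<Sum>l\<in>L. c m l *\<^sub>C f l) - (\<Sum>l\<in>L. c n l *\<^sub>C f l))"
        have "dist (c m l) (c n l) \<le> K * ?y" using b by (simp add: dist_norm)
        also have "\<dots> \<le> (\<bar>K\<bar> + 1) * ?y" by (intro mult_right_mono) auto
        also have "\<dots> < \<epsilon>" using N[OF that] by (simp add: pos_less_divide_eq mult.commute)
        finally show ?thesis .
      qed
      then show "\<exists>M. \<forall>m\<ge>M. \<forall>n\<ge>M. dist (c m l) (c n l) < \<epsilon>" by blast
    qed
    then show ?thesis
      using Cauchy_convergent convergent_def by blast
  qed
  then obtain d where d: "\<And>l. l \<in> L \<Longrightarrow> (\<lambda>n. c n l) \<longlonglongrightarrow> d l" by metis
  have "(\<lambda>n. \<Sum>l\<in>L. c n l *\<^sub>C f l) \<longlonglongrightarrow> (\<Sum>l\<in>L. d l *\<^sub>C f l)"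
    by (intro tendsto_sum tendsto_scaleC d tendsto_const)
  with lim show ?thesis using LIMSEQ_unique by blast
qed

text \<open>Induction on the family: by \<open>coeff_limit\<close> the span of the smaller family is
  closed, so the new vector f b has a positive distance \<delta> from it, which bounds its
  coefficient by 1/\<delta> times the norm of the combination.\<close>

lemma coeff_bound_exists:
  assumes "finite L" "lin_indep f L"
  shows "\<exists>K>0. coeff_bound f L K"
  using assms
proof (induction L)
  case empty
  then show ?case by (auto simp: coeff_bound_def intro: exI[of _ 1])
next
  case (insert b L)
  have ind: "lin_indep f L"
    unfolding lin_indep_def
  proof (intro allI impI ballI)
    fix c l assume z: "(\<Sum>l\<in>L. c l *\<^sub>C f l) = 0" and l: "l \<in> L"
    define c' where "c' = c(b := 0)"
    have "(\<Sum>l\<in>L. c' l *\<^sub>C f l) = (\<Sum>l\<in>L. c l *\<^sub>C f l)"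
      using insert.hyps by (intro sum.cong) (auto simp: c'_def)
    then have "(\<Sum>l\<in>insert b L. c' l *\<^sub>C f l) = 0"
      using insert.hyps z by (simp add: c'_def)
    then have "c' l = 0" using insert.prems l unfolding lin_indep_def by blast
    then show "c l = 0" using insert.hyps l by (cases "l = b") (auto simp: c'_def)
  qed
  then obtain K where K: "K > 0" "coeff_bound f L K" using insert by blast
  have "\<exists>\<delta>>0. \<forall>c. norm (f b - (\<Sum>l\<in>L. c l *\<^sub>C f l)) \<ge> \<delta>"
  proof (rule ccontr)
    assume "\<not> ?thesis"
    then have "\<exists>c. norm (f b - (\<Sum>l\<in>L. c l *\<^sub>C f l)) < inverse (real (Suc n))" for n
      by (metis not_le inverse_positive_iff_positive of_nat_0_less_iff zero_less_Suc)
    then obtain c where c: "\<And>n. norm (f b - (\<Sum>l\<in>L. c n l *\<^sub>C f l)) < inverse (real (Suc n))" by metis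
    have "(\<lambda>n. \<Sum>l\<in>L. c n l *\<^sub>C f l) \<longlonglongrightarrow> f b"
      by (rule LIM_zero_cancel, rule Lim_null_comparison[OF _ LIMSEQ_inverse_real_of_nat])
        (use c in \<open>auto simp: norm_minus_commute less_imp_le intro!: always_eventually\<close>)
    from coeff_limit[OF insert.hyps(1) K(2) this] obtain d where d: "f b = (\<Sum>l\<in>L. d l *\<^sub>C f l)" by blast
    define c' where "c' = (\<lambda>l. - d l)(b := 1)"
    have "(\<Sum>l\<in>L. c' l *\<^sub>C f l) = - (\<Sum>l\<in>L. d l *\<^sub>C f l)"
      unfolding sum_negf[symmetric] using insert.hyps by (intro sum.cong) (auto simp: c'_def)
    then have "(\<Sum>l\<in>insert b L. c' l *\<^sub>C f l) = 0"
      using insert.hyps d by (simp add: c'_def)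
    then have "c' b = 0" using insert.prems unfolding lin_indep_def by blast
    then show False by (simp add: c'_def)
  qed
  then obtain \<delta> where \<delta>: "\<delta> > 0" "\<And>c. norm (f b - (\<Sum>l\<in>L. c l *\<^sub>C f l)) \<ge> \<delta>" by blast
  \<comment> \<open>1/\<delta> serves the coefficient of b. The other summand serves the remaining
    ones: K is applied to y - c(b) f(b), of norm at most (1 + |f b|/\<delta>)|y|.\<close>
  define K' where "K' = 1/\<delta> + K * (1 + norm (f b) / \<delta>)"
  have K': "1 / \<delta> \<le> K'" "K * (1 + norm (f b) / \<delta>) \<le> K'"
    using K \<delta> by (auto simp: K'_def)
  have "K' > 0" using K \<delta> unfolding K'_def by (intro add_pos_nonneg) auto
  moreover have "coeff_bound f (insert b L) K'"
    unfolding coeff_bound_def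
  proof (intro allI ballI)
    fix c l assume l: "l \<in> insert b L"
    let ?y = "\<Sum>l\<in>insert b L. c l *\<^sub>C f l"
    have y: "?y = c b *\<^sub>C f b + (\<Sum>l\<in>L. c l *\<^sub>C f l)" using insert.hyps by simp
    have cb: "cmod (c b) \<le> 1/\<delta> * norm ?y"
    proof (cases "c b = 0")
      case False
      have "?y = c b *\<^sub>C (f b - (\<Sum>l\<in>L. (- c l / c b) *\<^sub>C f l))"
        using False unfolding y
        by (simp add: complex_vector.scale_right_distrib complex_vector.scale_sum_right sum_negf)
      then have "norm ?y = cmod (c b) * norm (f b - (\<Sum>l\<in>L. (- c l / c b) *\<^sub>C f l))"
        by (simp only: norm_scaleC)
      then have "norm ?y \<ge> cmod (c b) * \<delta>"
        using \<delta>(2)[of "\<lambda>l. - c l / c b"] by (simp only: mult_left_mono[OF _ norm_ge_zero])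
      with \<delta> show ?thesis by (simp add: field_simps)
    qed (use \<delta> in simp)
    show "cmod (c l) \<le> K' * norm ?y"
    proof (cases "l = b")
      case True
      have "1 / \<delta> * norm ?y \<le> K' * norm ?y" by (intro mult_right_mono K') simp
      with cb True show ?thesis by simp
    next
      case False
      with l have "cmod (c l) \<le> K * norm (\<Sum>l\<in>L. c l *\<^sub>C f l)" using K unfolding coeff_bound_def by blast
      also have "(\<Sum>l\<in>L. c l *\<^sub>C f l) = ?y - c b *\<^sub>C f b" using y by simp
      also have "norm (?y - c b *\<^sub>C f b) \<le> norm ?y + cmod (c b) * norm (f b)"
        by (metis norm_scaleC norm_triangle_ineq4)
      also have "\<dots> \<le> norm ?y + (1/\<delta> * norm ?y) * norm (f b)"
        by (intro add_left_mono mult_right_mono cb) simp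
      also have "\<dots> = (1 + norm (f b) / \<delta>) * norm ?y" by (simp add: algebra_simps)
      finally have "cmod (c l) \<le> K * (1 + norm (f b) / \<delta>) * norm ?y" using K by (simp add: mult.assoc)
      also have "\<dots> \<le> K' * norm ?y" by (intro mult_right_mono K') simp
      finally show ?thesis .
    qed
  qed
  ultimately show ?case by blast
qed

lemma closed_finite_dim_subspace:
  fixes S :: "'v::complex_normed_vector set"
  assumes S: "complex_vector.subspace S" and fin: "finite A" "S \<subseteq> complex_vector.span A"
    and lim: "\<And>n. x n \<in> S" "x \<longlonglongrightarrow> y"
  shows "y \<in> S"
proof -
  obtain B where B: "B \<subseteq> S" "complex_vector.independent B" "S \<subseteq> complex_vector.span B"
    using complex_vector.maximal_independent_subset[of S] by metis
  have finB: "finite B"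
    using complex_vector.independent_span_bound[OF fin(1) B(2)] B fin by blast
  have ind: "lin_indep id B"
    using B(2) finB unfolding lin_indep_def complex_vector.independent_explicit_finite_subsets by auto
  obtain K where K: "coeff_bound id B K" using coeff_bound_exists[OF finB ind] by blast
  have "\<exists>c. x n = (\<Sum>l\<in>B. c l *\<^sub>C id l)" for n
    using lim(1)[of n] B(3) complex_vector.span_finite[OF finB] by auto
  then obtain c where c: "\<And>n. x n = (\<Sum>l\<in>B. c n l *\<^sub>C id l)" by metis
  have "x = (\<lambda>n. \<Sum>l\<in>B. c n l *\<^sub>C id l)" using c by auto
  then obtain d where "y = (\<Sum>l\<in>B. d l *\<^sub>C id l)"
    using coeff_limit[OF finB K, of c y] lim(2) by metis
  then show ?thesis
    using B(1) S by (auto intro!: complex_vector.subspace_sum complex_vector.subspace_scale)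
qed

section \<open>Unitary representations in an orthonormal basis\<close>

lemma has_vector_derivative_reflect:
  assumes "(f has_vector_derivative D) (at (- t))"
  shows "((\<lambda>s. f (- s)) has_vector_derivative - D) (at t)"
proof -
  have "((\<lambda>s. - s) has_vector_derivative - 1) (at t)"
    by (intro has_vector_derivative_minus has_vector_derivative_id)
  from vector_diff_chain_at[OF this assms] show ?thesis by (simp add: o_def)
qed

lemma has_vector_derivative_shift_arg:
  assumes "(f has_vector_derivative D) (at (t + u))"
  shows "((\<lambda>s. f (t + s)) has_vector_derivative D) (at u)" "((\<lambda>s. f (s + u)) has_vector_derivative D) (at t)"
proof -
  have 1: "((\<lambda>s. t + s) has_vector_derivative 1) (at u)" "((\<lambda>s. s + u) has_vector_derivative 1) (at t)"
    by (auto intro!: has_vector_derivative_eq_rhs[OF has_vector_derivative_add]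
        has_vector_derivative_const has_vector_derivative_id)
  from vector_diff_chain_at[OF 1(1) assms] vector_diff_chain_at[OF 1(2) assms]
  show "((\<lambda>s. f (t + s)) has_vector_derivative D) (at u)" "((\<lambda>s. f (s + u)) has_vector_derivative D) (at t)"
    by (simp_all add: o_def)
qed

text \<open>The norm of \<open>'v\<close> governs continuity and derivatives, the form
  \<open>ip R\<close> governs unitarity, and \<open>unitary_rep\<close> states no relation between
  them. Coordinates in an orthonormal basis mediate between the two.\<close>

locale onb_rep =
  fixes R :: "'v::complex_normed_vector rep" and L :: "'i set" and e :: "'i \<Rightarrow> 'v"
  assumes unitary: "unitary_rep R" and finL: "finite L"
    and e_carr: "\<And>l. l \<in> L \<Longrightarrow> e l \<in> carr R"
    and e_orth: "\<And>l l'. l \<in> L \<Longrightarrow> l' \<in> L \<Longrightarrow> ip R (e l) (e l') = (if l = l' then 1 else 0)"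
    and e_span: "complex_vector.span (e ` L) = carr R"
begin

definition mc :: "'i \<Rightarrow> 'i \<Rightarrow> complex ^ 3 ^ 3 \<Rightarrow> complex" where
  "mc k l g = ip R (e k) (act R g (e l))"

lemma subspace_carr: "complex_vector.subspace (carr R)"
  using unitary by (simp add: unitary_rep_def)

lemmas carr_add = complex_vector.subspace_add[OF subspace_carr]
  and carr_scale = complex_vector.subspace_scale[OF subspace_carr]
  and carr_sum = complex_vector.subspace_sum[OF subspace_carr]
  and carr_0 = complex_vector.subspace_0[OF subspace_carr]
  and carr_diff = complex_vector.subspace_diff[OF subspace_carr]

lemma inner_product: "inner_product_on (carr R) (ip R)"
  using unitary by (simp add: unitary_rep_def)

lemma ip_cnj: "x \<in> carr R \<Longrightarrow> y \<in> carr R \<Longrightarrow> ip R y x = cnj (ip R x y)"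
  using inner_product unfolding inner_product_on_def by meson

lemma ip_add_right: "x \<in> carr R \<Longrightarrow> y \<in> carr R \<Longrightarrow> z \<in> carr R \<Longrightarrow> ip R x (y + z) = ip R x y + ip R x z"
  using inner_product unfolding inner_product_on_def by meson

lemma ip_scale_right: "x \<in> carr R \<Longrightarrow> y \<in> carr R \<Longrightarrow> ip R x (c *\<^sub>C y) = c * ip R x y"
  using inner_product unfolding inner_product_on_def by meson

lemma ip_zero_right: "x \<in> carr R \<Longrightarrow> ip R x 0 = 0"
  using ip_scale_right[of x 0 0] carr_0 by simp

lemma ip_sum_right:
  "x \<in> carr R \<Longrightarrow> (\<And>i. i \<in> I \<Longrightarrow> f i \<in> carr R) \<Longrightarrow> ip R x (\<Sum>i\<in>I. f i) = (\<Sum>i\<in>I. ip R x (f i))"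
  by (induction I rule: infinite_finite_induct) (auto simp: ip_zero_right ip_add_right carr_sum)

lemma act_carr: "g \<in> SU3 \<Longrightarrow> x \<in> carr R \<Longrightarrow> act R g x \<in> carr R"
  using unitary unfolding unitary_rep_def by meson

lemma act_add: "g \<in> SU3 \<Longrightarrow> x \<in> carr R \<Longrightarrow> y \<in> carr R \<Longrightarrow> act R g (x + y) = act R g x + act R g y"
  using unitary unfolding unitary_rep_def by meson

lemma act_scale: "g \<in> SU3 \<Longrightarrow> x \<in> carr R \<Longrightarrow> act R g (c *\<^sub>C x) = c *\<^sub>C act R g x"
  using unitary unfolding unitary_rep_def by meson

lemma act_one: "x \<in> carr R \<Longrightarrow> act R (mat 1) x = x"
  using unitary unfolding unitary_rep_def by meson

lemma act_mult: "g \<in> SU3 \<Longrightarrow> h \<in> SU3 \<Longrightarrow> x \<in> carr R \<Longrightarrow> act R (g ** h) x = act R g (act R h x)"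
  using unitary unfolding unitary_rep_def by meson

lemma act_ip: "g \<in> SU3 \<Longrightarrow> x \<in> carr R \<Longrightarrow> y \<in> carr R \<Longrightarrow> ip R (act R g x) (act R g y) = ip R x y"
  using unitary unfolding unitary_rep_def by meson

lemma act_cont: "x \<in> carr R \<Longrightarrow> continuous_on SU3 (\<lambda>g. act R g x)"
  using unitary unfolding unitary_rep_def by meson

lemma act_zero: "g \<in> SU3 \<Longrightarrow> act R g 0 = 0"
  using act_scale[of g 0 0] carr_0 by simp

lemma act_sum:
  "g \<in> SU3 \<Longrightarrow> (\<And>i. i \<in> I \<Longrightarrow> f i \<in> carr R) \<Longrightarrow> act R g (\<Sum>i\<in>I. f i) = (\<Sum>i\<in>I. act R g (f i))"
  by (induction I rule: infinite_finite_induct) (auto simp: act_zero act_add carr_sum)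

lemma combo_carr: "(\<Sum>l\<in>L. c l *\<^sub>C e l) \<in> carr R"
  by (intro carr_sum carr_scale e_carr)

lemma ip_combo: "k \<in> L \<Longrightarrow> ip R (e k) (\<Sum>l\<in>L. c l *\<^sub>C e l) = c k"
  using finL by (simp add: ip_sum_right carr_scale e_carr ip_scale_right e_orth if_distrib[of "\<lambda>x. _ * x"]
      sum.delta' cong: if_cong)

lemma e_inj: "inj_on e L"
  using e_orth by (metis inj_onI one_neq_zero)

lemma expand:
  assumes "x \<in> carr R"
  shows "x = (\<Sum>l\<in>L. ip R (e l) x *\<^sub>C e l)"
proof -
  obtain u where "x = (\<Sum>v\<in>e ` L. u v *\<^sub>C v)"
    using assms complex_vector.span_finite[of "e ` L"] finL unfolding e_span by auto
  then have x: "x = (\<Sum>l\<in>L. u (e l) *\<^sub>C e l)"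
    by (simp add: sum.reindex[OF e_inj])
  show ?thesis
    by (subst (1) x, rule sum.cong) (simp_all add: x ip_combo)
qed

lemma eqI: "x \<in> carr R \<Longrightarrow> y \<in> carr R \<Longrightarrow> (\<And>l. l \<in> L \<Longrightarrow> ip R (e l) x = ip R (e l) y) \<Longrightarrow> x = y"
  using expand[of x] expand[of y] by (metis (mono_tags, lifting) sum.cong)

lemma lin_indep_e: "lin_indep e L"
  unfolding lin_indep_def using ip_combo ip_zero_right e_carr by metis

lemma coord_bound: "\<exists>K>0. \<forall>x\<in>carr R. \<forall>l\<in>L. cmod (ip R (e l) x) \<le> K * norm x"
proof -
  obtain K where "K > 0" and K: "coeff_bound e L K" using coeff_bound_exists[OF finL lin_indep_e] by blast
  have "cmod (ip R (e l) x) \<le> K * norm x" if "x \<in> carr R" "l \<in> L" for x l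
    using K that(2) expand[OF that(1)] unfolding coeff_bound_def by metis
  with \<open>K > 0\<close> show ?thesis by blast
qed

lemma ip_diff_right: "x \<in> carr R \<Longrightarrow> y \<in> carr R \<Longrightarrow> z \<in> carr R \<Longrightarrow> ip R x (y - z) = ip R x y - ip R x z"
  using ip_add_right[of x "y - z" z] carr_diff by simp

lemma coord_continuous_on:
  fixes S :: "'b::metric_space set"
  assumes "continuous_on S f" "\<And>t. t \<in> S \<Longrightarrow> f t \<in> carr R" "l \<in> L"
  shows "continuous_on S (\<lambda>t. ip R (e l) (f t))"
proof -
  obtain K where K: "K > 0" "\<And>x. x \<in> carr R \<Longrightarrow> cmod (ip R (e l) x) \<le> K * norm x"
    using coord_bound assms(3) by blast
  show ?thesis
    unfolding continuous_on_iff
  proof (intro ballI allI impI)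
    fix t :: 'b and \<epsilon> :: real assume t: "t \<in> S" and "\<epsilon> > 0"
    then have "\<epsilon> / K > 0" using K(1) by simp
    then obtain \<delta> where \<delta>: "\<delta> > 0" "\<And>s. s \<in> S \<Longrightarrow> dist s t < \<delta> \<Longrightarrow> dist (f s) (f t) < \<epsilon> / K"
      using assms(1)[unfolded continuous_on_iff, rule_format, OF t] by blast
    have "dist (ip R (e l) (f s)) (ip R (e l) (f t)) < \<epsilon>" if s: "s \<in> S" "dist s t < \<delta>" for s
    proof -
      have "dist (ip R (e l) (f s)) (ip R (e l) (f t)) = cmod (ip R (e l) (f s - f t))"
        using assms s t by (simp add: dist_norm ip_diff_right e_carr)
      also have "\<dots> \<le> K * dist (f s) (f t)"
        using K(2) assms(2) s t by (simp add: dist_norm carr_diff)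
      also have "\<dots> < \<epsilon>" using \<delta>(2)[OF s] K(1) by (simp add: field_simps)
      finally show ?thesis .
    qed
    with \<delta>(1) show "\<exists>\<delta>>0. \<forall>s\<in>S. dist s t < \<delta> \<longrightarrow> dist (ip R (e l) (f s)) (ip R (e l) (f t)) < \<epsilon>"
      by blast
  qed
qed

lemma act_e: "g \<in> SU3 \<Longrightarrow> l \<in> L \<Longrightarrow> act R g (e l) = (\<Sum>k\<in>L. mc k l g *\<^sub>C e k)"
  unfolding mc_def by (rule expand) (simp add: act_carr e_carr)

lemma mc_continuous: "k \<in> L \<Longrightarrow> l \<in> L \<Longrightarrow> continuous_on SU3 (mc k l)"
  unfolding mc_def[abs_def] by (intro coord_continuous_on act_cont act_carr e_carr)

lemma ip_act: "g \<in> SU3 \<Longrightarrow> x \<in> carr R \<Longrightarrow> k \<in> L \<Longrightarrow>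
    ip R (e k) (act R g x) = (\<Sum>l\<in>L. mc k l g * ip R (e l) x)"
  by (subst expand[of x], assumption)
    (simp add: act_sum ip_sum_right carr_scale e_carr act_scale act_carr ip_scale_right mc_def mult.commute)

lemma mc_mult:
  "g \<in> SU3 \<Longrightarrow> h \<in> SU3 \<Longrightarrow> k \<in> L \<Longrightarrow> l \<in> L \<Longrightarrow> mc k l (g ** h) = (\<Sum>j\<in>L. mc k j g * mc j l h)"
  using ip_act[of g "act R h (e l)" k] by (simp add: mc_def act_mult act_carr e_carr)

lemma mc_one: "k \<in> L \<Longrightarrow> l \<in> L \<Longrightarrow> mc k l (mat 1) = (if k = l then 1 else 0)"
  by (simp add: mc_def act_one e_carr e_orth)

lemma mc_cnj: "g \<in> SU3 \<Longrightarrow> k \<in> L \<Longrightarrow> l \<in> L \<Longrightarrow> cnj (mc k l g) = mc l k (dagger g)"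
proof -
  assume g: "g \<in> SU3" and kl: "k \<in> L" "l \<in> L"
  have "ip R (act R g (e l)) (e k) = ip R (act R g (e l)) (act R g (act R (dagger g) (e k)))"
    using g kl act_mult[of g "dagger g" "e k"] SU3_dagger_right[OF g]
    by (simp add: SU3_dagger act_one e_carr)
  also have "\<dots> = mc l k (dagger g)"
    using g kl by (simp add: mc_def act_ip e_carr act_carr SU3_dagger)
  finally show ?thesis
    using ip_cnj[of "e k" "act R g (e l)"] g kl by (simp add: mc_def e_carr act_carr)
qed

subsection \<open>One-parameter subgroups\<close>

definition pm :: "complex ^ 3 ^ 3 \<Rightarrow> 'i \<Rightarrow> 'i \<Rightarrow> real \<Rightarrow> complex" where
  "pm X k l t = mc k l (mexp (t *\<^sub>R X))"

context
  fixes X assumes X: "X \<in> su3"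
begin

lemma pm_add: "k \<in> L \<Longrightarrow> l \<in> L \<Longrightarrow> pm X k l (s + t) = (\<Sum>j\<in>L. pm X k j s * pm X j l t)"
  unfolding pm_def mexp_add by (intro mc_mult mexp_SU3 X)

lemma pm_0: "k \<in> L \<Longrightarrow> l \<in> L \<Longrightarrow> pm X k l 0 = (if k = l then 1 else 0)"
  by (simp add: pm_def mc_one)

lemma pm_continuous: "k \<in> L \<Longrightarrow> l \<in> L \<Longrightarrow> continuous_on S (pm X k l)"
proof -
  assume kl: "k \<in> L" "l \<in> L"
  have "continuous_on S (\<lambda>t. mexp (t *\<^sub>R X))"
    by (rule continuous_at_imp_continuous_on)
      (auto intro: has_vector_derivative_continuous[OF mexp_has_vector_derivative])
  then show ?thesis
    unfolding pm_def[abs_def]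
    by (rule continuous_on_compose2[OF mc_continuous[OF kl]]) (auto intro: mexp_SU3 X)
qed

text \<open>Averages of an orbit over short intervals are differentiable along the orbit. They form a
  dense, hence full, subspace.\<close>

lemma pm_differentiable_at_0:
  assumes k: "k \<in> L" and l: "l \<in> L"
  shows "\<exists>a. (pm X k l has_vector_derivative a) (at 0)"
proof -
  \<comment> \<open>Antiderivatives of the matrix coefficients; the interval leaves room for t + s
    with |t| < 1 and 0 <= s < 1.\<close>
  have "\<exists>F. \<forall>t\<in>{-2..2}. (F has_vector_derivative pm X k l t) (at t within {-2..2})"
    if "k \<in> L" "l \<in> L" for k l
    using antiderivative_continuous[OF pm_continuous[OF that]] by metis
  then obtain F where F: "\<And>k l t. k \<in> L \<Longrightarrow> l \<in> L \<Longrightarrow> t \<in> {-2..2} \<Longrightarrow>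
      (F k l has_vector_derivative pm X k l t) (at t within {-2..2})"
    by metis
  have F': "(F k l has_vector_derivative pm X k l t) (at t)" if "k \<in> L" "l \<in> L" "t \<in> {-2<..<2}" for k l t
    using F[OF that(1,2), of t] that(3) at_within_Icc_at[of "-2" t 2] by simp
  \<comment> \<open>The group law integrated: the matrix at t times the integral over [0, s] is the
    integral over [t, t + s]. The latter is visibly differentiable in t.\<close>
  have key: "(\<Sum>j\<in>L. pm X k j t * (F j l s - F j l 0)) = F k l (t + s) - F k l t"
    if kl: "k \<in> L" "l \<in> L" and t: "t \<in> {-1<..<1}" and s: "s \<in> {0..<1}" for k l s t
  proof -
    let ?h = "\<lambda>s. (\<Sum>j\<in>L. pm X k j t * F j l s) - F k l (t + s)"
    have "(?h has_vector_derivative 0) (at u within {0..<1})" if u: "u \<in> {0..<1}" for u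
    proof -
      have "((\<lambda>s. F k l (t + s)) has_vector_derivative 1 *\<^sub>R pm X k l (t + u)) (at u)"
        using kl t u by (auto intro!: has_vector_derivative_shift_arg F')
      moreover have "((\<lambda>s. \<Sum>j\<in>L. pm X k j t * F j l s) has_vector_derivative (\<Sum>j\<in>L. pm X k j t * pm X j l u)) (at u)"
        using kl u by (intro has_vector_derivative_sum has_vector_derivative_mult_right F') auto
      ultimately have "(?h has_vector_derivative (\<Sum>j\<in>L. pm X k j t * pm X j l u) - 1 *\<^sub>R pm X k l (t + u)) (at u)"
        by (intro has_vector_derivative_diff)
      then show ?thesis
        using has_vector_derivative_at_within kl by (simp add: pm_add)
    qed
    then have "\<exists>c. \<forall>u\<in>{0..<1}. ?h u = c"
      by - (rule has_derivative_zero_constant, auto simp: has_vector_derivative_def)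
    then obtain c where "\<And>u. u \<in> {0..<1} \<Longrightarrow> ?h u = c" by blast
    from this[of s] this[of 0] have "?h s = ?h 0" using s by simp
    then show ?thesis by (simp add: algebra_simps sum_subtractf)
  qed
  \<comment> \<open>The vectors whose orbit under the one-parameter group has coordinates
    differentiable at 0.\<close>
  define S where "S = {x \<in> carr R. \<forall>k\<in>L. \<exists>a. ((\<lambda>t. \<Sum>l\<in>L. pm X k l t * ip R (e l) x) has_vector_derivative a) (at 0)}"
  have "complex_vector.subspace S"
  proof (intro complex_vector.subspaceI)
    show "0 \<in> S" by (auto simp: S_def carr_0 ip_zero_right e_carr intro!: exI[of _ 0] has_vector_derivative_const)
    fix x y assume xy: "x \<in> S" "y \<in> S"
    have "\<exists>a. ((\<lambda>t. \<Sum>l\<in>L. pm X k l t * ip R (e l) (x + y)) has_vector_derivative a) (at 0)" if "k \<in> L" for k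
    proof -
      from xy that obtain a b where
        "((\<lambda>t. \<Sum>l\<in>L. pm X k l t * ip R (e l) x) has_vector_derivative a) (at 0)"
        "((\<lambda>t. \<Sum>l\<in>L. pm X k l t * ip R (e l) y) has_vector_derivative b) (at 0)"
        unfolding S_def by blast
      from has_vector_derivative_add[OF this]
      have "((\<lambda>t. \<Sum>l\<in>L. pm X k l t * ip R (e l) (x + y)) has_vector_derivative a + b) (at 0)"
        using xy by (simp add: S_def ip_add_right e_carr sum.distrib[symmetric] distrib_left)
      then show ?thesis by blast
    qed
    then show "x + y \<in> S" using xy by (auto simp: S_def carr_add)
  next
    fix c x assume x: "x \<in> S"
    have "\<exists>a. ((\<lambda>t. \<Sum>l\<in>L. pm X k l t * ip R (e l) (c *\<^sub>C x)) has_vector_derivative a) (at 0)" if "k \<in> L" for k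
    proof -
      from x that obtain a where
        "((\<lambda>t. \<Sum>l\<in>L. pm X k l t * ip R (e l) x) has_vector_derivative a) (at 0)"
        unfolding S_def by blast
      from has_vector_derivative_mult_right[OF this, of c]
      have "((\<lambda>t. \<Sum>l\<in>L. pm X k l t * ip R (e l) (c *\<^sub>C x)) has_vector_derivative c * a) (at 0)"
        using x by (simp add: S_def ip_scale_right e_carr sum_distrib_left mult_ac)
      then show ?thesis by blast
    qed
    then show "c *\<^sub>C x \<in> S" using x by (auto simp: S_def carr_scale)
  qed
  moreover have "finite (e ` L)" "S \<subseteq> complex_vector.span (e ` L)"
    using finL by (auto simp: S_def e_span)
  moreover
  define \<epsilon> where "\<epsilon> = (\<lambda>n. inverse (real (Suc (Suc n))))"
  \<comment> \<open>The average of the orbit of \<open>e l\<close> over the interval from 0 to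
    \<open>\<epsilon> n\<close>, written in coordinates. As the interval shrinks it tends to
    \<open>e l\<close>.\<close>
  define x where "x = (\<lambda>n. \<Sum>j\<in>L. ((F j l (\<epsilon> n) - F j l 0) / of_real (\<epsilon> n)) *\<^sub>C e j)"
  have \<epsilon>: "\<epsilon> n > 0" "\<epsilon> n < 1" for n by (auto simp: \<epsilon>_def divide_simps)
  have "x n \<in> S" for n
  proof -
    have "((\<lambda>t. \<Sum>j\<in>L. pm X k j t * ip R (e j) (x n)) has_vector_derivative
        (pm X k l (\<epsilon> n) - pm X k l 0) / of_real (\<epsilon> n)) (at 0)" if k: "k \<in> L" for k
    proof -
      have "((\<lambda>t. F k l (t + \<epsilon> n)) has_vector_derivative 1 *\<^sub>R pm X k l (0 + \<epsilon> n)) (at 0)"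
        using k l \<epsilon>[of n] F'[of k l "0 + \<epsilon> n"] by (auto intro!: has_vector_derivative_shift_arg)
      then have "((\<lambda>t. F k l (t + \<epsilon> n) - F k l t) has_vector_derivative (pm X k l (\<epsilon> n) - pm X k l 0)) (at 0)"
        using k l by (auto intro!: has_vector_derivative_diff F')
      then have d: "((\<lambda>t. (F k l (t + \<epsilon> n) - F k l t) / of_real (\<epsilon> n)) has_vector_derivative
          (pm X k l (\<epsilon> n) - pm X k l 0) / of_real (\<epsilon> n)) (at 0)"
        by (rule has_vector_derivative_divide)
      have "(F k l (t + \<epsilon> n) - F k l t) / of_real (\<epsilon> n) = (\<Sum>j\<in>L. pm X k j t * ip R (e j) (x n))"
        if "t \<in> {-1<..<1}" for t
        using key[OF k l that, of "\<epsilon> n"] \<epsilon>[of n] by (simp add: x_def ip_combo sum_divide_distrib[symmetric])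
      then show ?thesis
        by (intro has_vector_derivative_transform_within_open[OF d, of "{-1<..<1}"]) auto
    qed
    then show ?thesis unfolding S_def using combo_carr by (auto simp: x_def)
  qed
  moreover have "x \<longlonglongrightarrow> e l"
  proof -
    have "(\<lambda>n. (F j l (\<epsilon> n) - F j l 0) / of_real (\<epsilon> n)) \<longlonglongrightarrow> pm X j l 0" if "j \<in> L" for j
    proof -
      have "((\<lambda>h. (F j l (0 + h) - F j l 0) /\<^sub>R h) \<longlongrightarrow> pm X j l 0) (at 0)"
        using that l by (intro has_vector_derivative_tendsto_quotient F') auto
      moreover have "filterlim \<epsilon> (at 0) sequentially"
        unfolding filterlim_at using \<epsilon> LIMSEQ_inverse_real_of_nat[THEN LIMSEQ_Suc]
        by (auto simp: \<epsilon>_def)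
      ultimately have "(\<lambda>n. (F j l (0 + \<epsilon> n) - F j l 0) /\<^sub>R \<epsilon> n) \<longlonglongrightarrow> pm X j l 0"
        by (rule filterlim_compose)
      then show ?thesis by (simp add: scaleR_conv_of_real divide_inverse mult.commute)
    qed
    then have "x \<longlonglongrightarrow> (\<Sum>j\<in>L. pm X j l 0 *\<^sub>C e j)"
      unfolding x_def by (intro tendsto_sum tendsto_scaleC tendsto_const)
    also have "(\<Sum>j\<in>L. pm X j l 0 *\<^sub>C e j) = (\<Sum>j\<in>L. if j = l then e j else 0)"
      using l by (intro sum.cong) (auto simp: pm_0)
    finally show ?thesis using l finL by simp
  qed
  ultimately have "e l \<in> S"
    using closed_finite_dim_subspace[of S "e ` L" x "e l"] by blast
  then obtain a where "((\<lambda>t. \<Sum>j\<in>L. pm X k j t * ip R (e j) (e l)) has_vector_derivative a) (at 0)"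
    using k unfolding S_def by blast
  moreover have "(\<Sum>j\<in>L. pm X k j t * ip R (e j) (e l)) = pm X k l t" for t
    using l finL by (simp add: e_orth if_distrib[of "\<lambda>x. _ * x"] cong: if_cong)
  ultimately show ?thesis by auto
qed

end

section \<open>Generators of one-parameter groups as skew-Hermitian matrices\<close>

definition gen :: "complex ^ 3 ^ 3 \<Rightarrow> 'i \<Rightarrow> 'i \<Rightarrow> complex" where
  "gen X k l = vector_derivative (\<lambda>t. mc k l (mexp (t *\<^sub>R X))) (at 0)"

lemma mc_deriv_0:
  "X \<in> su3 \<Longrightarrow> k \<in> L \<Longrightarrow> l \<in> L \<Longrightarrow>
    ((\<lambda>t. mc k l (mexp (t *\<^sub>R X))) has_vector_derivative gen X k l) (at 0)"
  using pm_differentiable_at_0[of X k l] unfolding gen_def pm_def[abs_def]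
  by (metis vector_derivative_at)

text \<open>The group law carries the derivative at 0 to an arbitrary t, with the generator on the
  right here and on the left in \<open>mc_deriv_left\<close>.\<close>

lemma mc_deriv_right:
  assumes X: "X \<in> su3" and kl: "k \<in> L" "l \<in> L"
  shows "((\<lambda>t. mc k l (mexp (t *\<^sub>R X))) has_vector_derivative
    (\<Sum>j\<in>L. mc k j (mexp (t *\<^sub>R X)) * gen X j l)) (at t)"
proof -
  let ?f = "\<lambda>s. mc k l (mexp ((t + s) *\<^sub>R X))"
  have "(?f has_vector_derivative (\<Sum>j\<in>L. mc k j (mexp (t *\<^sub>R X)) * gen X j l)) (at (t + - t))"
    unfolding mexp_add using X kl
    by (simp add: mc_mult mexp_SU3) (intro has_vector_derivative_sum has_vector_derivative_mult_right mc_deriv_0)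
  from has_vector_derivative_shift_arg(1)[of ?f _ "- t" t] this
  show ?thesis by simp
qed

lemma mc_deriv_left:
  assumes X: "X \<in> su3" and kl: "k \<in> L" "l \<in> L"
  shows "((\<lambda>t. mc k l (mexp (t *\<^sub>R X))) has_vector_derivative
    (\<Sum>j\<in>L. gen X k j * mc j l (mexp (t *\<^sub>R X)))) (at t)"
proof -
  let ?f = "\<lambda>s. mc k l (mexp ((s + t) *\<^sub>R X))"
  have "(?f has_vector_derivative (\<Sum>j\<in>L. gen X k j * mc j l (mexp (t *\<^sub>R X)))) (at (- t + t))"
    unfolding mexp_add using X kl
    by (simp add: mc_mult mexp_SU3) (intro has_vector_derivative_sum has_vector_derivative_mult_left mc_deriv_0)
  from has_vector_derivative_shift_arg(2)[of ?f _ t "- t"] this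
  show ?thesis by simp
qed

lemma gen_skew:
  assumes X: "X \<in> su3" and kl: "k \<in> L" "l \<in> L"
  shows "cnj (gen X k l) = - gen X l k"
proof -
  have "((\<lambda>t. cnj (mc k l (mexp (t *\<^sub>R X)))) has_vector_derivative cnj (gen X k l)) (at 0)"
    by (rule bounded_linear.has_vector_derivative[OF bounded_linear_cnj mc_deriv_0[OF X kl]])
  moreover have "cnj (mc k l (mexp (t *\<^sub>R X))) = mc l k (mexp (- t *\<^sub>R X))" for t
    using X kl by (simp add: mc_cnj mexp_SU3 mexp_dagger) (simp add: su3_def)
  moreover have "((\<lambda>t. mc l k (mexp (- t *\<^sub>R X))) has_vector_derivative - gen X l k) (at 0)"
    using has_vector_derivative_reflect[of "\<lambda>t. mc l k (mexp (t *\<^sub>R X))" _ 0] mc_deriv_0[OF X kl(2,1)] by simp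
  ultimately show ?thesis
    using vector_derivative_unique_at by fastforce
qed

lemma gen_minus:
  assumes X: "X \<in> su3" and kl: "k \<in> L" "l \<in> L"
  shows "gen (- X) k l = - gen X k l"
proof -
  have "((\<lambda>t. mc k l (mexp (- t *\<^sub>R X))) has_vector_derivative - gen X k l) (at 0)"
    using has_vector_derivative_reflect[of "\<lambda>t. mc k l (mexp (t *\<^sub>R X))" _ 0] mc_deriv_0[OF X kl] by simp
  then show ?thesis
    by (simp add: gen_def vector_derivative_at)
qed

lemma act_has_vector_derivative:
  assumes X: "X \<in> su3" and x: "x \<in> carr R"
  shows "((\<lambda>t. act R (mexp (t *\<^sub>R X)) x) has_vector_derivative
    (\<Sum>k\<in>L. (\<Sum>l\<in>L. gen X k l * ip R (e l) x) *\<^sub>C e k)) (at 0)"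
proof -
  have "act R (mexp (t *\<^sub>R X)) x = (\<Sum>k\<in>L. (\<Sum>l\<in>L. mc k l (mexp (t *\<^sub>R X)) * ip R (e l) x) *\<^sub>C e k)" for t
    using X x by (subst expand) (auto intro!: act_carr mexp_SU3 sum.cong simp: ip_act mexp_SU3)
  moreover have "((\<lambda>t. \<Sum>k\<in>L. (\<Sum>l\<in>L. mc k l (mexp (t *\<^sub>R X)) * ip R (e l) x) *\<^sub>C e k) has_vector_derivative
      (\<Sum>k\<in>L. (\<Sum>l\<in>L. gen X k l * ip R (e l) x) *\<^sub>C e k)) (at 0)"
    using X by (intro has_vector_derivative_sum
        bounded_linear.has_vector_derivative[OF bounded_bilinear.bounded_linear_left[OF bounded_bilinear_scaleC]]
        has_vector_derivative_mult_left mc_deriv_0)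
  ultimately show ?thesis by simp
qed

lemma su3_act_eq:
  "X \<in> su3 \<Longrightarrow> x \<in> carr R \<Longrightarrow> su3_act R X x = (\<Sum>k\<in>L. (\<Sum>l\<in>L. gen X k l * ip R (e l) x) *\<^sub>C e k)"
  unfolding su3_act_def by (rule vector_derivative_at[OF act_has_vector_derivative])

lemma su3_act_carr: "X \<in> su3 \<Longrightarrow> x \<in> carr R \<Longrightarrow> su3_act R X x \<in> carr R"
  by (simp add: su3_act_eq combo_carr)

lemma ip_su3_act_e: "X \<in> su3 \<Longrightarrow> k \<in> L \<Longrightarrow> l \<in> L \<Longrightarrow> ip R (e k) (su3_act R X (e l)) = gen X k l"
  using finL by (simp add: su3_act_eq e_carr ip_combo e_orth if_distrib[of "\<lambda>x. _ * x"] cong: if_cong)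

lemma su3_act_0: "x \<in> carr R \<Longrightarrow> su3_act R 0 x = 0"
  unfolding su3_act_def by (simp add: act_one)

text \<open>Each coordinate of exp(-ct) times the orbit of v at time t has derivative zero, hence
  keeps its value at t = 0.\<close>

lemma act_eigen:
  assumes X: "X \<in> su3" and v: "v \<in> carr R" and ev: "su3_act R X v = c *\<^sub>C v"
  shows "act R (mexp (t *\<^sub>R X)) v = exp (c * of_real t) *\<^sub>C v"
proof (rule eqI)
  fix k assume k: "k \<in> L"
  let ?y = "\<lambda>t. \<Sum>l\<in>L. mc k l (mexp (t *\<^sub>R X)) * ip R (e l) v"
  have c: "(\<Sum>l\<in>L. gen X j l * ip R (e l) v) = c * ip R (e j) v" if "j \<in> L" for j
    using arg_cong[OF ev, of "ip R (e j)"] that X v by (simp add: su3_act_eq ip_combo ip_scale_right e_carr)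
  have "(?y has_vector_derivative c * ?y t) (at t)" for t
  proof -
    have "(?y has_vector_derivative
        (\<Sum>l\<in>L. (\<Sum>j\<in>L. mc k j (mexp (t *\<^sub>R X)) * gen X j l) * ip R (e l) v)) (at t)"
      using X k by (intro has_vector_derivative_sum has_vector_derivative_mult_left mc_deriv_right)
    also have "(\<Sum>l\<in>L. (\<Sum>j\<in>L. mc k j (mexp (t *\<^sub>R X)) * gen X j l) * ip R (e l) v)
        = (\<Sum>j\<in>L. mc k j (mexp (t *\<^sub>R X)) * (\<Sum>l\<in>L. gen X j l * ip R (e l) v))"
      unfolding sum_distrib_right sum_distrib_left mult.assoc by (rule sum.swap)
    also have "\<dots> = (\<Sum>j\<in>L. mc k j (mexp (t *\<^sub>R X)) * (c * ip R (e j) v))"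
      by (intro sum.cong) (simp_all only: c)
    also have "\<dots> = c * ?y t"
      by (simp add: sum_distrib_left mult_ac)
    finally show ?thesis .
  qed
  moreover have "((\<lambda>t. exp (- c * of_real t)) has_vector_derivative - c * exp (- c * of_real t)) (at t)" for t
    by (rule has_vector_derivative_real_field) (auto intro!: derivative_eq_intros)
  ultimately have "((\<lambda>t. exp (- c * of_real t) * ?y t) has_vector_derivative
      exp (- c * of_real t) * (c * ?y t) + - c * exp (- c * of_real t) * ?y t) (at t)" for t
    by (intro has_vector_derivative_mult)
  then have "((\<lambda>t. exp (- c * of_real t) * ?y t) has_vector_derivative 0) (at t)" for t
    by (simp add: algebra_simps)
  then have "exp (- c * of_real t) * ?y t = exp (- c * of_real 0) * ?y 0"
    by (rule vector_derivative_zero_const)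
  also have "?y 0 = ip R (e k) v"
    using ip_act[of "mat 1" v k] v k by (simp add: act_one)
  finally have "exp (- c * of_real t) * ?y t = ip R (e k) v" by simp
  moreover have "exp (c * of_real t) * exp (- c * of_real t) = 1"
    by (simp flip: exp_add)
  then have "?y t = exp (c * of_real t) * (exp (- c * of_real t) * ?y t)"
    unfolding mult.assoc[symmetric] by (simp only: mult_1_left)
  ultimately have "?y t = exp (c * of_real t) * ip R (e k) v"
    by (simp only:)
  then show "ip R (e k) (act R (mexp (t *\<^sub>R X)) v) = ip R (e k) (exp (c * of_real t) *\<^sub>C v)"
    using X v k by (simp add: ip_act mexp_SU3 ip_scale_right e_carr)
qed (use assms in \<open>auto intro: act_carr mexp_SU3 carr_scale\<close>)

lemma sl3_act_off_diagonal:
  "sl3_act R (unit_mat i j) x = su3_act R (skew_gen i j) x + \<i> *\<^sub>C su3_act R (sym_gen i j) x"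
  by (simp add: sl3_act_def skew_gen_def sym_gen_def)

definition root_mat :: "3 \<Rightarrow> 3 \<Rightarrow> 'i \<Rightarrow> 'i \<Rightarrow> complex" where
  "root_mat i j k l = ip R (e k) (sl3_act R (unit_mat i j) (e l))"

lemma sl3_act_carr: "i \<noteq> j \<Longrightarrow> x \<in> carr R \<Longrightarrow> sl3_act R (unit_mat i j) x \<in> carr R"
  unfolding sl3_act_off_diagonal by (intro carr_add carr_scale su3_act_carr skew_gen_su3 sym_gen_su3)

lemma root_mat_eq:
  "i \<noteq> j \<Longrightarrow> k \<in> L \<Longrightarrow> l \<in> L \<Longrightarrow> root_mat i j k l = gen (skew_gen i j) k l + \<i> * gen (sym_gen i j) k l"
  by (simp add: root_mat_def sl3_act_off_diagonal ip_add_right carr_scale su3_act_carr skew_gen_su3 sym_gen_su3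
      e_carr ip_scale_right ip_su3_act_e)

text \<open>The root matrix is A + iB with A and B skew-Hermitian, so A is its skew-Hermitian part
  and iB its Hermitian part. One lowering matrix therefore contains both generators.\<close>

lemma gen_root_mat:
  assumes "i \<noteq> j" "k \<in> L" "l \<in> L"
  shows "gen (skew_gen i j) k l = (root_mat i j k l - cnj (root_mat i j l k)) / 2"
    and "gen (sym_gen i j) k l = (root_mat i j k l + cnj (root_mat i j l k)) / (2 * \<i>)"
  using assms by (simp_all add: root_mat_eq gen_skew skew_gen_su3 sym_gen_su3)

end

lemma skew_gen_swap: "skew_gen j i = - skew_gen i j"
  and sym_gen_swap: "sym_gen j i = sym_gen i j"
  by (simp_all add: skew_gen_def sym_gen_def add.commute flip: complex_vector.scale_minus_right)

text \<open>The lowering operators determine the generators, because the raising operators are their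
  adjoints, and the generators determine the matrix coefficients.\<close>

lemma mc_eq_if_lowering_eq:
  assumes "onb_rep R L e" "onb_rep R' L e'"
    and T: "\<And>k l. k \<in> L \<Longrightarrow> l \<in> L \<Longrightarrow> onb_rep.root_mat R e 2 1 k l = onb_rep.root_mat R' e' 2 1 k l"
    and U: "\<And>k l. k \<in> L \<Longrightarrow> l \<in> L \<Longrightarrow> onb_rep.root_mat R e 3 2 k l = onb_rep.root_mat R' e' 3 2 k l"
    and g: "g \<in> SU3" and kl: "k \<in> L" "l \<in> L"
  shows "onb_rep.mc R e k l g = onb_rep.mc R' e' k l g"
proof -
  interpret A: onb_rep R L e by fact
  interpret B: onb_rep R' L e' by fact
  have gen: "A.gen X k l = B.gen X k l" if X: "X \<in> su3_gens" and kl: "k \<in> L" "l \<in> L" for X k l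
  proof -
    have n: "(2::3) \<noteq> 1" "(3::3) \<noteq> 2" by simp_all
    have "A.gen (skew_gen 2 1) k l = B.gen (skew_gen 2 1) k l" "A.gen (sym_gen 2 1) k l = B.gen (sym_gen 2 1) k l"
      "A.gen (skew_gen 3 2) k l = B.gen (skew_gen 3 2) k l" "A.gen (sym_gen 3 2) k l = B.gen (sym_gen 3 2) k l"
      unfolding A.gen_root_mat[OF n(1) kl] B.gen_root_mat[OF n(1) kl] A.gen_root_mat[OF n(2) kl]
        B.gen_root_mat[OF n(2) kl] using kl by (simp_all add: T U)
    then show ?thesis
      using X kl skew_gen_swap[of 1 2] skew_gen_swap[of 2 3] sym_gen_swap[of 1 2] sym_gen_swap[of 2 3]
        A.gen_minus[of "skew_gen 2 1"] A.gen_minus[of "skew_gen 3 2"]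
        B.gen_minus[of "skew_gen 2 1"] B.gen_minus[of "skew_gen 3 2"]
      by (auto simp: su3_gens_def skew_gen_su3)
  qed
  from g have "\<forall>k\<in>L. \<forall>l\<in>L. A.mc k l g = B.mc k l g"
  proof (induction rule: SU3_induct)
    case (exp X t)
    then have X: "X \<in> su3" by (rule su3_gens_su3)
    have neg: "((\<lambda>t. B.mc k j (mexp (- t *\<^sub>R X))) has_vector_derivative
        - (\<Sum>i\<in>L. B.mc k i (mexp (- t *\<^sub>R X)) * B.gen X i j)) (at t)" if "k \<in> L" "j \<in> L" for k j t
    proof -
      have "((\<lambda>t. B.mc k j (mexp (t *\<^sub>R X))) has_vector_derivative
          (\<Sum>i\<in>L. B.mc k i (mexp (- t *\<^sub>R X)) * B.gen X i j)) (at (- t))"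
        by (rule B.mc_deriv_right[OF X that])
      from has_vector_derivative_reflect[OF this] show ?thesis .
    qed
    \<comment> \<open>B(exp(-tX)) A(exp(tX)) has derivative zero because the generators of the two
      representations agree. Multiplying by B(exp(tX)) then gives A = B along the group.\<close>
    have inv: "(\<Sum>j\<in>L. B.mc k j (mexp (- t *\<^sub>R X)) * A.mc j l (mexp (t *\<^sub>R X))) = (if k = l then 1 else 0)"
      if kl: "k \<in> L" "l \<in> L" for k l t
    proof -
      let ?F = "\<lambda>t. \<Sum>j\<in>L. B.mc k j (mexp (- t *\<^sub>R X)) * A.mc j l (mexp (t *\<^sub>R X))"
      have "(?F has_vector_derivative 0) (at t)" for t
      proof -
        let ?m = "mexp (- t *\<^sub>R X)" and ?p = "mexp (t *\<^sub>R X)"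
        have "(?F has_vector_derivative (\<Sum>j\<in>L. B.mc k j ?m * (\<Sum>i\<in>L. A.gen X j i * A.mc i l ?p)
            + - (\<Sum>i\<in>L. B.mc k i ?m * B.gen X i j) * A.mc j l ?p)) (at t)"
          using kl by (intro has_vector_derivative_sum has_vector_derivative_mult neg A.mc_deriv_left X)
        moreover have "(\<Sum>j\<in>L. B.mc k j ?m * (\<Sum>i\<in>L. A.gen X j i * A.mc i l ?p)
            + - (\<Sum>i\<in>L. B.mc k i ?m * B.gen X i j) * A.mc j l ?p)
          = (\<Sum>j\<in>L. B.mc k j ?m * (\<Sum>i\<in>L. B.gen X j i * A.mc i l ?p))
           - (\<Sum>j\<in>L. (\<Sum>i\<in>L. B.mc k i ?m * B.gen X i j) * A.mc j l ?p)"
          unfolding sum.distrib minus_mult_left[symmetric] sum_negf by (simp add: gen[OF exp])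
        moreover have "(\<Sum>j\<in>L. B.mc k j ?m * (\<Sum>i\<in>L. B.gen X j i * A.mc i l ?p))
           = (\<Sum>j\<in>L. (\<Sum>i\<in>L. B.mc k i ?m * B.gen X i j) * A.mc j l ?p)"
          unfolding sum_distrib_left sum_distrib_right mult.assoc by (rule sum.swap)
        ultimately show ?thesis by simp
      qed
      then have "?F t = ?F 0" by (rule vector_derivative_zero_const)
      also have "?F 0 = (\<Sum>j\<in>L. if j = k then (if k = l then 1 else 0) else 0)"
        using kl by (intro sum.cong) (auto simp: A.mc_one B.mc_one)
      finally show ?thesis using kl A.finL by simp
    qed
    show ?case
    proof (intro ballI)
      fix k l assume kl: "k \<in> L" "l \<in> L"
      let ?p = "mexp (t *\<^sub>R X)" and ?m = "mexp (- t *\<^sub>R X)"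
      have "B.mc k l ?p = (\<Sum>i\<in>L. B.mc k i ?p * (if i = l then 1 else 0))"
        using kl A.finL by (simp add: if_distrib[of "\<lambda>x. _ * x"] cong: if_cong)
      also have "\<dots> = (\<Sum>i\<in>L. B.mc k i ?p * (\<Sum>j\<in>L. B.mc i j ?m * A.mc j l ?p))"
        using kl by (intro sum.cong) (simp_all only: inv)
      also have "\<dots> = (\<Sum>j\<in>L. (\<Sum>i\<in>L. B.mc k i ?p * B.mc i j ?m) * A.mc j l ?p)"
        unfolding sum_distrib_left sum_distrib_right mult.assoc by (rule sum.swap)
      also have "\<dots> = (\<Sum>j\<in>L. B.mc k j (?p ** ?m) * A.mc j l ?p)"
        using kl X mexp_SU3[OF X, of t] mexp_SU3[OF X, of "- t"] by (intro sum.cong) (simp_all add: B.mc_mult)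
      also have "\<dots> = (\<Sum>j\<in>L. if j = k then A.mc k l ?p else 0)"
        using kl unfolding mexp_minus_right by (intro sum.cong) (auto simp: B.mc_one)
      finally show "A.mc k l ?p = B.mc k l ?p" using kl A.finL by simp
    qed
  next
    case (mult g h)
    then show ?case by (auto simp: A.mc_mult B.mc_mult intro!: sum.cong)
  qed
  with kl show ?thesis by blast
qed

section \<open>The differential of a unitary matrix representation\<close>

definition vip :: "complex ^ 'n \<Rightarrow> complex ^ 'n \<Rightarrow> complex" where
  "vip x y = (\<Sum>i\<in>UNIV. cnj (x $ i) * y $ i)"

lemma vip_add_right: "vip x (y + z) = vip x y + vip x z"
  and vip_scale_right: "vip x (c *\<^sub>C y) = c * vip x y"
  and vip_diff_right: "vip x (y - z) = vip x y - vip x z"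
  and vip_zero_right [simp]: "vip x 0 = 0"
  and vip_add_left: "vip (x + y) z = vip x z + vip y z"
  and vip_scale_left: "vip (c *\<^sub>C x) z = cnj c * vip x z"
  and vip_zero_left [simp]: "vip 0 x = 0"
  by (simp_all add: vip_def algebra_simps sum.distrib sum_distrib_left sum_subtractf)

lemma vip_dagger: "vip x (A *v y) = vip (dagger A *v x) y"
proof -
  have "vip x (A *v y) = (\<Sum>i\<in>UNIV. \<Sum>j\<in>UNIV. cnj (x $ i) * (A $ i $ j * y $ j))"
    by (simp add: vip_def matrix_vector_mult_def sum_distrib_left)
  also have "\<dots> = (\<Sum>j\<in>UNIV. \<Sum>i\<in>UNIV. cnj (x $ i) * (A $ i $ j * y $ j))"
    by (rule sum.swap)
  also have "\<dots> = vip (dagger A *v x) y"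
    by (simp add: vip_def matrix_vector_mult_def sum_distrib_left mult_ac)
  finally show ?thesis .
qed

lemma inner_complex_eq: "inner (x::complex) y = Re (cnj x * y)"
  by (simp add: inner_complex_def)

lemma inner_vip: "inner x y = Re (vip x y)"
  by (simp add: vip_def inner_vec_def inner_complex_eq)

text \<open>The Euclidean structure of the matrix type is the real part of the Hilbert-Schmidt
  product. Hence \<open>norm\<close> is invariant under unitary factors, and real orthogonality can
  be used for operators.\<close>

lemma inner_trace: "inner A B = Re (trace (dagger A ** B))" for A B :: "complex ^ 'n ^ 'n"
proof -
  have "trace (dagger A ** B) = (\<Sum>i\<in>UNIV. \<Sum>j\<in>UNIV. cnj (A $ j $ i) * B $ j $ i)"
    by (simp add: trace_def matrix_matrix_mult_def)
  also have "\<dots> = (\<Sum>j\<in>UNIV. \<Sum>i\<in>UNIV. cnj (A $ j $ i) * B $ j $ i)"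
    by (rule sum.swap)
  finally show ?thesis by (simp add: inner_vec_def inner_complex_eq)
qed

lemma vip_self_eq_0: "vip x x = 0 \<longleftrightarrow> x = 0"
  by (metis inner_eq_zero_iff inner_vip vip_zero_left zero_complex.sel(1))

lemma matrix_vector_scaleC: "A *v (c *\<^sub>C x) = c *\<^sub>C (A *v x)" "(c *\<^sub>C A) *v x = c *\<^sub>C (A *v x)"
  for A :: "complex ^ 'n ^ 'm"
  by (simp_all add: vec_eq_iff matrix_vector_mult_def sum_distrib_left mult_ac)

lemma matrix_vector_minus: "(- A) *v x = - (A *v x)" for A :: "complex ^ 'n ^ 'm"
  by (simp add: vec_eq_iff matrix_vector_mult_def sum_negf)

lemma matrix_vector_left_distrib: "(A + B) *v x = A *v x + B *v x"
  "(A - B) *v x = A *v x - B *v x" for A :: "complex ^ 'n ^ 'm"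
  by (simp_all add: vec_eq_iff matrix_vector_mult_def algebra_simps sum.distrib sum_subtractf)

lemma norm_unitary_mult:
  fixes u A :: "complex ^ 'n ^ 'n"
  assumes "dagger u ** u = mat 1"
  shows "norm (u ** A) = norm A"
proof -
  have "dagger (u ** A) ** (u ** A) = dagger A ** (dagger u ** u) ** A"
    by (simp add: matrix_mul_assoc)
  then show ?thesis
    by (simp add: norm_eq_sqrt_inner inner_trace assms)
qed

definition mat_pow :: "complex ^ 'n ^ 'n \<Rightarrow> nat \<Rightarrow> complex ^ 'n ^ 'n" where
  "mat_pow u n = ((\<lambda>A. u ** A) ^^ n) (mat 1)"

lemma mat_pow_0 [simp]: "mat_pow u 0 = mat 1"
  and mat_pow_Suc [simp]: "mat_pow u (Suc n) = u ** mat_pow u n"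
  by (simp_all add: mat_pow_def)

text \<open>Telescoping, as multiplication by u is isometric on matrices.\<close>

lemma norm_mat_pow_minus_one:
  assumes "dagger u ** u = mat 1"
  shows "norm (mat_pow u n - mat 1) \<le> real n * norm (u - mat 1)"
proof (induction n)
  case (Suc n)
  have "mat_pow u (Suc n) - mat 1 = u ** (mat_pow u n - mat 1) + (u - mat 1)"
    by (simp add: matrix_diff_right)
  then have "norm (mat_pow u (Suc n) - mat 1) \<le> norm (u ** (mat_pow u n - mat 1)) + norm (u - mat 1)"
    by (simp only: norm_triangle_ineq)
  also have "\<dots> = norm (mat_pow u n - mat 1) + norm (u - mat 1)"
    by (simp only: norm_unitary_mult[OF assms])
  finally show ?case using Suc by (simp add: algebra_simps)
qed simp

lemma mat_pow_minus_one_sum: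
  "mat_pow u n - mat 1 = real n *\<^sub>R (u - mat 1) + (\<Sum>j<n. (u - mat 1) ** (mat_pow u j - mat 1))"
  by (induction n) (simp_all add: matrix_diff_right matrix_diff_left algebra_simps)

locale unitary_mat =
  fixes \<rho> :: "complex ^ 3 ^ 3 \<Rightarrow> complex ^ 'n ^ 'n"
  assumes unitary_vec_rep: "unitary_rep (vec_rep \<rho>)"
begin

lemma vec_rep_simps [simp]: "carr (vec_rep \<rho>) = UNIV" "ip (vec_rep \<rho>) = vip" "act (vec_rep \<rho>) = (\<lambda>g x. \<rho> g *v x)"
  by (auto simp: vec_rep_def vip_def fun_eq_iff)

lemma vip_axis: "vip (axis k 1) x = x $ k"
proof -
  have "cnj (axis k 1 $ i) * x $ i = (if i = k then x $ i else 0)" for i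
    by (simp add: axis_def)
  then show ?thesis by (simp add: vip_def)
qed

text \<open>In the standard basis the matrix coefficients are the entries of \<rho>, so what holds
  for abstract unitary representations applies to the matrices themselves.\<close>

sublocale V: onb_rep "vec_rep \<rho>" UNIV "\<lambda>i. axis i 1"
proof
  show "complex_vector.span (range (\<lambda>i. axis i 1)) = carr (vec_rep \<rho>)"
  proof -
    have "x = (\<Sum>i\<in>UNIV. (x $ i) *\<^sub>C axis i 1)" for x :: "complex ^ 'n"
      by (simp add: vec_eq_iff axis_def if_distrib[of "\<lambda>z. _ * z"] cong: if_cong)
    then show ?thesis
      by (metis (no_types, lifting) UNIV_eq_I complex_vector.span_base complex_vector.span_scale
          complex_vector.span_sum rangeI vec_rep_simps(1))
  qed
qed (simp_all add: unitary_vec_rep vip_axis, auto simp: axis_def)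

lemma mc_eq: "V.mc i j g = \<rho> g $ i $ j"
  unfolding V.mc_def vec_rep_simps vip_axis
  by (simp add: matrix_vector_mult_def axis_def if_distrib[of "\<lambda>x. _ * x"] cong: if_cong)

lemma rho_mult: "g \<in> SU3 \<Longrightarrow> h \<in> SU3 \<Longrightarrow> \<rho> (g ** h) = \<rho> g ** \<rho> h"
  using V.act_mult by (simp add: matrix_eq matrix_vector_mul_assoc)

lemma rho_one: "\<rho> (mat 1) = mat 1"
  using V.act_one by (simp add: matrix_eq)

lemma rho_dagger: "g \<in> SU3 \<Longrightarrow> \<rho> (dagger g) = dagger (\<rho> g)"
  using V.mc_cnj by (simp add: vec_eq_iff mc_eq)

lemma rho_unitary: "g \<in> SU3 \<Longrightarrow> dagger (\<rho> g) ** \<rho> g = mat 1" "g \<in> SU3 \<Longrightarrow> \<rho> g ** dagger (\<rho> g) = mat 1"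
  by (metis SU3_dagger SU3_dagger_left SU3_dagger_right rho_dagger rho_mult rho_one)+

lemma op_act_eq: "g \<in> SU3 \<Longrightarrow> op_act \<rho> g A = \<rho> g ** A ** dagger (\<rho> g)"
  unfolding op_act_def using matrix_inv_unique[OF rho_unitary(2)] by simp

lemma rho_continuous: "continuous_on SU3 \<rho>"
proof -
  have "continuous_on SU3 (\<lambda>g. \<chi> i j. \<rho> g $ i $ j)"
    using V.mc_continuous by (intro continuous_on_vec_lambda) (simp add: mc_eq[abs_def])
  then show ?thesis by simp
qed

lemma norm_rho: "g \<in> SU3 \<Longrightarrow> norm (\<rho> g) = norm (mat 1 :: complex ^ 'n ^ 'n)"
  using norm_unitary_mult[OF rho_unitary(1), of g "mat 1"] by simp

text \<open>Powers \<open>g\<^sup>j\<close> of an element at distance \<open>d\<close> from \<open>1\<close> stay in a fixed neighbourhood for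
  \<open>j \<le> m \<approx> \<delta>/d\<close>, hence so do the powers of \<open>u = \<rho> g\<close>; then
  \<open>u\<^sup>m - 1 = m(u - 1) + \<Sum>(u - 1)(u\<^sup>j - 1)\<close> bounds \<open>m|u - 1|\<close>.\<close>

lemma rho_lipschitz_at_one: "\<exists>C. \<forall>g\<in>SU3. norm (\<rho> g - mat 1) \<le> C * norm (g - mat 1)"
proof -
  obtain K where K: "K > 0" "\<And>(A :: complex ^ 'n ^ 'n) (B :: complex ^ 'n ^ 'n). norm (A ** B) \<le> norm A * norm B * K"
    using bounded_bilinear.pos_bounded[OF bounded_bilinear_matrix_mult] by blast
  \<comment> \<open>With this threshold each summand (u - 1)(u^j - 1) has norm at most |u - 1|/2, so
    the whole sum is absorbed by half of m|u - 1|.\<close>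
  have "1 / (2 * K) > 0" using K by simp
  then obtain \<delta> where \<delta>: "\<delta> > 0" "\<And>g. g \<in> SU3 \<Longrightarrow> norm (g - mat 1) < \<delta> \<Longrightarrow> norm (\<rho> g - mat 1) < 1 / (2 * K)"
    using rho_continuous[unfolded continuous_on_iff, rule_format, OF SU3_one] unfolding dist_norm rho_one by blast
  let ?C = "2 * norm (mat 1 :: complex ^ 'n ^ 'n) / \<delta> + 2 / (K * \<delta>)"
  have "norm (\<rho> g - mat 1) \<le> ?C * norm (g - mat 1)" if g: "g \<in> SU3" for g
  proof (cases "norm (g - mat 1) < \<delta>")
    case False
    have "norm (\<rho> g - mat 1) \<le> 2 * norm (mat 1 :: complex ^ 'n ^ 'n)"
      using norm_triangle_ineq4[of "\<rho> g" "mat 1"] norm_rho[OF g] by simp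
    also have "\<dots> = 2 * norm (mat 1 :: complex ^ 'n ^ 'n) / \<delta> * \<delta>" using \<delta> by simp
    also have "\<dots> \<le> 2 * norm (mat 1 :: complex ^ 'n ^ 'n) / \<delta> * norm (g - mat 1)"
      using False \<delta> by (intro mult_left_mono) auto
    also have "\<dots> \<le> ?C * norm (g - mat 1)"
      using K \<delta> by (intro mult_right_mono) auto
    finally show ?thesis .
  next
    case d: True
    show ?thesis
    proof (cases "g = mat 1")
      case True
      then show ?thesis by (simp add: rho_one)
    next
      case False
      define d where "d = norm (g - mat 1)"
      have d0: "d > 0" "d < \<delta>" using False d by (auto simp: d_def)
      \<comment> \<open>The largest integer with m d < \<delta>. It is at least 1 since d <
        \<delta>, and therefore \<delta> <= 2 m d.\<close>
      define m where "m = nat (\<lceil>\<delta> / d\<rceil> - 1)"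
      have c: "\<lceil>\<delta> / d\<rceil> > 1" using d0 by (simp add: one_less_ceiling)
      then have m: "real m = real_of_int \<lceil>\<delta> / d\<rceil> - 1" by (simp add: m_def)
      have "real_of_int \<lceil>\<delta> / d\<rceil> \<ge> 2" using c by linarith
      then have m1: "m \<ge> 1" using m by linarith
      have "real m < \<delta> / d" unfolding m by linarith
      then have md: "real m * d < \<delta>" using d0 by (simp add: field_simps)
      have "\<delta> / d \<le> real m + 1" unfolding m by linarith
      also have "\<dots> \<le> 2 * real m" using m1 by simp
      finally have md': "\<delta> \<le> 2 * real m * d" using d0 by (simp add: field_simps)
      let ?u = "\<rho> g"
      have pow: "mat_pow g j \<in> SU3 \<and> \<rho> (mat_pow g j) = mat_pow ?u j" for j
        by (induction j) (auto simp: rho_one rho_mult g SU3_mult)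
      have small: "norm (mat_pow ?u j - mat 1) \<le> 1 / (2 * K)" if "j \<le> m" for j
      proof -
        have "norm (mat_pow g j - mat 1) \<le> real j * d"
          unfolding d_def using SU3_dagger_left[OF g] by (rule norm_mat_pow_minus_one)
        also have "\<dots> \<le> real m * d" using that d0 by (intro mult_right_mono) auto
        finally have "norm (mat_pow g j - mat 1) < \<delta>" using md by simp
        with \<delta>(2)[of "mat_pow g j"] pow[of j] show ?thesis by auto
      qed
      have "real m *\<^sub>R (?u - mat 1) = (mat_pow ?u m - mat 1) - (\<Sum>j<m. (?u - mat 1) ** (mat_pow ?u j - mat 1))"
        by (simp add: mat_pow_minus_one_sum[of ?u m])
      then have "norm (real m *\<^sub>R (?u - mat 1)) \<le>
          norm (mat_pow ?u m - mat 1) + norm (\<Sum>j<m. (?u - mat 1) ** (mat_pow ?u j - mat 1))"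
        by (simp only: norm_triangle_ineq4)
      also have "norm (\<Sum>j<m. (?u - mat 1) ** (mat_pow ?u j - mat 1)) \<le> (\<Sum>j<m. norm (?u - mat 1) / 2)"
      proof (rule order_trans[OF norm_sum], rule sum_mono)
        fix j assume "j \<in> {..<m}"
        then have "norm ((?u - mat 1) ** (mat_pow ?u j - mat 1)) \<le> norm (?u - mat 1) * (1 / (2 * K)) * K"
          using K(1) small[of j]
          by (intro order_trans[OF K(2)] mult_right_mono mult_left_mono) auto
        then show "norm ((?u - mat 1) ** (mat_pow ?u j - mat 1)) \<le> norm (?u - mat 1) / 2"
          using K(1) by simp
      qed
      finally have "real m * norm (?u - mat 1) \<le> 1 / (2 * K) + real m * norm (?u - mat 1) / 2"
        using small[of m] by simp
      then have "real m * norm (?u - mat 1) \<le> 1 / K" using K(1) by (simp add: field_simps)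
      then have "norm (?u - mat 1) \<le> 1 / (K * real m)"
        using m1 K(1) by (simp add: field_simps)
      also have "\<dots> \<le> 2 / (K * \<delta>) * d"
        using md' m1 K(1) \<delta>(1) by (simp add: field_simps)
      also have "\<dots> \<le> ?C * d"
        using \<delta> d0 by (intro mult_right_mono) auto
      finally show ?thesis by (simp add: d_def)
    qed
  qed
  then show ?thesis by blast
qed

section \<open>The differential of \<rho> and its complexification\<close>

definition drho :: "complex ^ 3 ^ 3 \<Rightarrow> complex ^ 'n ^ 'n" where
  "drho X = (\<chi> i j. V.gen X i j)"

lemma drho_deriv:
  assumes "X \<in> su3"
  shows "((\<lambda>t. \<rho> (mexp (t *\<^sub>R X))) has_vector_derivative drho X) (at 0)"
  using V.mc_deriv_0[OF assms] unfolding drho_def mc_eq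
  by (intro has_vector_derivative_componentwise) simp

lemma drho_deriv_at:
  assumes "X \<in> su3"
  shows "((\<lambda>t. \<rho> (mexp (t *\<^sub>R X))) has_vector_derivative drho X ** \<rho> (mexp (t *\<^sub>R X))) (at t)"
  using V.mc_deriv_left[OF assms] unfolding drho_def mc_eq
  by (intro has_vector_derivative_componentwise) (simp add: matrix_matrix_mult_def)

lemma drho_unique:
  assumes "X \<in> su3" "((\<lambda>t. \<rho> (mexp (t *\<^sub>R X))) has_vector_derivative A) (at 0)"
  shows "drho X = A"
  using drho_deriv[OF assms(1)] assms(2) by (rule vector_derivative_unique_at)

lemma dagger_drho: "X \<in> su3 \<Longrightarrow> dagger (drho X) = - drho X"
  using V.gen_skew by (simp add: vec_eq_iff drho_def)

text \<open>The Lipschitz bound stands in for differentiability of \<rho> on the group: a curve with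
  zero velocity at the identity is mapped to a curve with zero velocity.\<close>

lemma rho_curve_deriv_0:
  assumes d: "\<And>t. d t \<in> SU3" "d 0 = mat 1" "(d has_vector_derivative 0) (at 0)"
  shows "((\<lambda>t. \<rho> (d t)) has_vector_derivative 0) (at 0)"
proof -
  obtain C where C: "\<And>g. g \<in> SU3 \<Longrightarrow> norm (\<rho> g - mat 1) \<le> C * norm (g - mat 1)"
    using rho_lipschitz_at_one by blast
  have "((\<lambda>h. norm (d (0 + h) - d 0 - h *\<^sub>R 0) / norm h) \<longlongrightarrow> 0) (at 0)"
    using d(3) unfolding has_vector_derivative_def has_derivative_at by blast
  then have l: "((\<lambda>h. C * (norm (d h - mat 1) / norm h)) \<longlongrightarrow> 0) (at 0)"
    using d(2) by (intro tendsto_mult_right_zero) simp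
  have "((\<lambda>h. norm (\<rho> (d (0 + h)) - \<rho> (d 0) - h *\<^sub>R 0) / norm h) \<longlongrightarrow> 0) (at 0)"
  proof (rule Lim_null_comparison[OF _ l], rule always_eventually, rule allI)
    fix h :: real
    have "norm (\<rho> (d h) - mat 1) / norm h \<le> C * norm (d h - mat 1) / norm h"
      by (intro divide_right_mono C d) simp
    then show "norm (norm (\<rho> (d (0 + h)) - \<rho> (d 0) - h *\<^sub>R 0) / norm h) \<le> C * (norm (d h - mat 1) / norm h)"
      by (simp add: d(2) rho_one)
  qed
  then show ?thesis
    unfolding has_vector_derivative_def has_derivative_at by simp
qed

lemma su3_add: "X \<in> su3 \<Longrightarrow> Y \<in> su3 \<Longrightarrow> X + Y \<in> su3"
  and su3_scaleR: "X \<in> su3 \<Longrightarrow> r *\<^sub>R X \<in> su3"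
  by (auto simp: su3_def trace_def sum.distrib scaleR_sum_right[symmetric])

text \<open>The curve exp(-t(X+Y)) exp(tX) exp(tY) has zero velocity at t = 0, so \<rho>(exp(tX))
  \<rho>(exp(tY)) and \<rho>(exp(t(X+Y))) have the same derivative there.\<close>

lemma drho_add:
  assumes X: "X \<in> su3" and Y: "Y \<in> su3"
  shows "drho (X + Y) = drho X + drho Y"
proof -
  let ?h = "\<lambda>t. mexp (t *\<^sub>R (X + Y))" and ?h' = "\<lambda>t. mexp (- t *\<^sub>R (X + Y))"
  let ?\<gamma> = "\<lambda>t. mexp (t *\<^sub>R X) ** mexp (t *\<^sub>R Y)"
  have XY: "X + Y \<in> su3" using X Y by (rule su3_add)
  have S: "?h t \<in> SU3" "?h' t \<in> SU3" "?\<gamma> t \<in> SU3" for t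
    using mexp_SU3[OF XY, of t] mexp_SU3[OF XY, of "- t"] by (auto intro!: SU3_mult mexp_SU3 X Y)
  have "(?\<gamma> has_vector_derivative X + Y) (at 0)"
    using has_vector_derivative_matrix_mult[OF mexp_has_vector_derivative[of X 0] mexp_has_vector_derivative[of Y 0]]
    by (simp add: add.commute)
  from has_vector_derivative_matrix_mult[OF mexp_minus_has_vector_derivative[of "X + Y" 0] this]
  have "((\<lambda>t. ?h' t ** ?\<gamma> t) has_vector_derivative 0) (at 0)" by simp
  then have "((\<lambda>t. \<rho> (?h' t ** ?\<gamma> t)) has_vector_derivative 0) (at 0)"
    using S by (intro rho_curve_deriv_0) (auto intro: SU3_mult)
  from has_vector_derivative_matrix_mult[OF drho_deriv[OF XY] this]
  have "((\<lambda>t. \<rho> (?h t) ** \<rho> (?h' t ** ?\<gamma> t)) has_vector_derivative drho (X + Y)) (at 0)"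
    by (simp add: rho_one)
  moreover have "\<rho> (?h t) ** \<rho> (?h' t ** ?\<gamma> t) = \<rho> (mexp (t *\<^sub>R X)) ** \<rho> (mexp (t *\<^sub>R Y))" for t
  proof -
    have "?h t ** (?h' t ** ?\<gamma> t) = ?\<gamma> t"
      unfolding matrix_mul_assoc mexp_minus_right matrix_mul_lid ..
    then show ?thesis
      using S X Y by (metis SU3_mult mexp_SU3 rho_mult)
  qed
  ultimately have "((\<lambda>t. \<rho> (mexp (t *\<^sub>R X)) ** \<rho> (mexp (t *\<^sub>R Y))) has_vector_derivative drho (X + Y)) (at 0)"
    by simp
  moreover have "((\<lambda>t. \<rho> (mexp (t *\<^sub>R X)) ** \<rho> (mexp (t *\<^sub>R Y))) has_vector_derivative drho X + drho Y) (at 0)"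
    using has_vector_derivative_matrix_mult[OF drho_deriv[OF X] drho_deriv[OF Y]] by (simp add: rho_one add.commute)
  ultimately show ?thesis by (rule vector_derivative_unique_at)
qed

lemma drho_scaleR:
  assumes X: "X \<in> su3"
  shows "drho (r *\<^sub>R X) = r *\<^sub>R drho X"
proof (rule drho_unique)
  have "((\<lambda>t. t * r) has_vector_derivative r) (at 0)"
    unfolding has_real_derivative_iff_has_vector_derivative[symmetric] by (auto intro!: derivative_eq_intros)
  from vector_diff_chain_at[OF this, of "\<lambda>t. \<rho> (mexp (t *\<^sub>R X))" "drho X"]
  show "((\<lambda>t. \<rho> (mexp (t *\<^sub>R r *\<^sub>R X))) has_vector_derivative r *\<^sub>R drho X) (at 0)"
    using drho_deriv[OF X] by (simp add: o_def)
qed (use X in \<open>rule su3_scaleR\<close>)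

lemma su3_conj: "g \<in> SU3 \<Longrightarrow> X \<in> su3 \<Longrightarrow> g ** X ** dagger g \<in> su3"
  using trace_mul_sym[of "g ** X" "dagger g"] SU3_dagger_left[of g]
  by (auto simp: su3_def matrix_mul_assoc)

lemma drho_conj:
  assumes g: "g \<in> SU3" and X: "X \<in> su3"
  shows "drho (g ** X ** dagger g) = \<rho> g ** drho X ** dagger (\<rho> g)"
proof (rule drho_unique)
  show "g ** X ** dagger g \<in> su3" using g X by (rule su3_conj)
  have "\<rho> (mexp (t *\<^sub>R (g ** X ** dagger g))) = \<rho> g ** \<rho> (mexp (t *\<^sub>R X)) ** dagger (\<rho> g)" for t
    using g mexp_SU3[OF X] by (simp add: mexp_conj SU3_dagger_left SU3_dagger_right rho_mult SU3_mult SU3_dagger rho_dagger)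
  then show "((\<lambda>t. \<rho> (mexp (t *\<^sub>R (g ** X ** dagger g)))) has_vector_derivative \<rho> g ** drho X ** dagger (\<rho> g)) (at 0)"
    using has_vector_derivative_matrix_mult[OF has_vector_derivative_matrix_mult[OF
          has_vector_derivative_const[of "\<rho> g"] drho_deriv[OF X]] has_vector_derivative_const[of "dagger (\<rho> g)"]]
    by simp
qed

definition sk :: "complex ^ 3 ^ 3 \<Rightarrow> complex ^ 3 ^ 3" where
  "sk X = (1/2) *\<^sub>C (X - dagger X)"

definition he :: "complex ^ 3 ^ 3 \<Rightarrow> complex ^ 3 ^ 3" where
  "he X = (- \<i>/2) *\<^sub>C (X + dagger X)"

text \<open>The complex-linear extension of \<open>drho\<close> to traceless matrices, along the
  decomposition used in \<open>sl3_act\<close>.\<close>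

definition Drho :: "complex ^ 3 ^ 3 \<Rightarrow> complex ^ 'n ^ 'n" where
  "Drho X = drho (sk X) + \<i> *\<^sub>C drho (he X)"

lemma sk_su3: "trace X = 0 \<Longrightarrow> sk X \<in> su3" and he_su3: "trace X = 0 \<Longrightarrow> he X \<in> su3"
  by (auto simp: su3_def sk_def he_def trace_scaleC trace_sub trace_add trace_minus trace_dagger vec_eq_iff algebra_simps)

lemma sk_he: "X = sk X + \<i> *\<^sub>C he X"
  by (simp add: sk_def he_def vec_eq_iff field_simps)

lemma Drho_add: "trace X = 0 \<Longrightarrow> trace Y = 0 \<Longrightarrow> Drho (X + Y) = Drho X + Drho Y"
proof -
  assume t: "trace X = 0" "trace Y = 0"
  have "sk (X + Y) = sk X + sk Y" "he (X + Y) = he X + he Y"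
    by (simp_all add: sk_def he_def vec_eq_iff field_simps)
  then show ?thesis
    using t by (simp add: Drho_def drho_add sk_su3 he_su3 scaleC_add_right)
qed

lemma Drho_scaleC: "trace X = 0 \<Longrightarrow> Drho (c *\<^sub>C X) = c *\<^sub>C Drho X"
proof -
  assume t: "trace X = 0"
  have "sk (c *\<^sub>C X) = Re c *\<^sub>R sk X + (- Im c) *\<^sub>R he X" "he (c *\<^sub>C X) = Re c *\<^sub>R he X + Im c *\<^sub>R sk X"
    by (simp_all add: sk_def he_def vec_eq_iff complex_eq_iff field_simps)
  then have "Drho (c *\<^sub>C X) = (Re c *\<^sub>R drho (sk X) + (- Im c) *\<^sub>R drho (he X))
      + \<i> *\<^sub>C (Re c *\<^sub>R drho (he X) + Im c *\<^sub>R drho (sk X))"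
    using t by (simp add: Drho_def drho_add drho_scaleR sk_su3 he_su3 su3_scaleR del: scaleR_minus_left)
  also have "\<dots> = c *\<^sub>C Drho X"
    by (simp add: Drho_def vec_eq_iff complex_eq_iff algebra_simps)
  finally show ?thesis .
qed

lemma drho_0: "drho 0 = 0"
  using drho_scaleR[of 0 0] by (simp add: su3_def trace_def)

lemma Drho_su3: "X \<in> su3 \<Longrightarrow> Drho X = drho X"
proof -
  assume "X \<in> su3"
  then have "sk X = X" "he X = 0" by (simp_all add: su3_def sk_def he_def vec_eq_iff)
  then show ?thesis by (simp add: Drho_def drho_0)
qed

lemma dagger_Drho: "trace X = 0 \<Longrightarrow> dagger (Drho X) = Drho (dagger X)"
proof -
  assume t: "trace X = 0"
  have "sk (dagger X) = - sk X" "he (dagger X) = he X"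
    by (simp_all add: sk_def he_def vec_eq_iff field_simps)
  then show ?thesis
    using t drho_scaleR[of "sk X" "- 1"] by (simp add: Drho_def dagger_drho sk_su3 he_su3)
qed

lemma trace_conj: "g \<in> SU3 \<Longrightarrow> trace (g ** X ** dagger g) = trace X"
  using trace_mul_sym[of "g ** X" "dagger g"] SU3_dagger_left[of g]
  by (simp add: matrix_mul_assoc)

lemma Drho_conj:
  assumes g: "g \<in> SU3" and X: "trace X = 0"
  shows "Drho (g ** X ** dagger g) = \<rho> g ** Drho X ** dagger (\<rho> g)"
proof -
  have "sk (g ** X ** dagger g) = g ** sk X ** dagger g" "he (g ** X ** dagger g) = g ** he X ** dagger g"
    by (simp_all add: sk_def he_def matrix_diff_right matrix_diff_left matrix_add_ldistrib
        matrix_add_distrib_right matrix_mul_assoc)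
  then show ?thesis
    using assms by (simp add: Drho_def drho_conj sk_su3 he_su3 matrix_add_ldistrib matrix_add_distrib_right)
qed

text \<open>Both sides are the derivative at t = 0 of the image under \<open>Drho\<close> of X
  conjugated by exp(tY), computed inside and outside the differential.\<close>

lemma Drho_commutator_su3:
  assumes Y: "Y \<in> su3" and X: "trace X = 0"
  shows "Drho (Y ** X - X ** Y) = drho Y ** Drho X - Drho X ** drho Y"
proof -
  \<comment> \<open>Removing the trace makes the map linear, hence bounded, on all matrices, so that
    it may be differentiated along the curve of conjugates.\<close>
  define P where "P = (\<lambda>Z. Drho (Z - (trace Z / 3) *\<^sub>C mat 1))"
  have tr: "trace (Z - (trace Z / 3) *\<^sub>C mat 1) = 0" for Z :: "complex ^ 3 ^ 3"
    by (simp add: trace_sub trace_scaleC trace_I)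
  have "linear P"
  proof (rule linearI)
    fix Z Z' :: "complex ^ 3 ^ 3" and r :: real
    have "Z + Z' - (trace (Z + Z') / 3) *\<^sub>C mat 1 = (Z - (trace Z / 3) *\<^sub>C mat 1) + (Z' - (trace Z' / 3) *\<^sub>C mat 1)"
      by (simp add: trace_add add_divide_distrib scaleC_add_left)
    then show "P (Z + Z') = P Z + P Z'"
      using Drho_add[OF tr[of Z] tr[of Z']] unfolding P_def by (simp only:)
    have "r *\<^sub>R Z - (trace (r *\<^sub>R Z) / 3) *\<^sub>C mat 1 = of_real r *\<^sub>C (Z - (trace Z / 3) *\<^sub>C mat 1)"
      unfolding scaleC_of_real[symmetric] trace_scaleC complex_vector.scale_right_diff_distrib scaleC_scaleC
      by simp
    then show "P (r *\<^sub>R Z) = r *\<^sub>R P Z"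
      using Drho_scaleC[OF tr[of Z], of "of_real r"] unfolding P_def by (simp only: scaleC_of_real)
  qed
  then have P: "bounded_linear P" by (simp add: linear_conv_bounded_linear)
  have P_eq: "P Z = Drho Z" if "trace Z = 0" for Z using that by (simp add: P_def)
  let ?Z = "\<lambda>t. mexp (t *\<^sub>R Y) ** X ** mexp (- t *\<^sub>R Y)"
  have dg: "mexp (- t *\<^sub>R Y) = dagger (mexp (t *\<^sub>R Y))" for t
    using Y by (simp add: mexp_dagger su3_def)
  have "(?Z has_vector_derivative Y ** X - X ** Y) (at 0)"
    using has_vector_derivative_matrix_mult[OF has_vector_derivative_matrix_mult[OF
          mexp_has_vector_derivative[of Y 0] has_vector_derivative_const[of X]] mexp_minus_has_vector_derivative[of Y 0]]
    by simp
  from bounded_linear.has_vector_derivative[OF P this]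
  have "((\<lambda>t. P (?Z t)) has_vector_derivative P (Y ** X - X ** Y)) (at 0)" .
  moreover have "P (?Z t) = \<rho> (mexp (t *\<^sub>R Y)) ** Drho X ** \<rho> (mexp (- t *\<^sub>R Y))" for t
    unfolding dg using X mexp_SU3[OF Y, of t] by (simp add: P_eq trace_conj Drho_conj rho_dagger)
  moreover have "((\<lambda>t. \<rho> (mexp (- t *\<^sub>R Y))) has_vector_derivative - drho Y) (at 0)"
    using drho_deriv[OF Y] has_vector_derivative_reflect[of "\<lambda>t. \<rho> (mexp (t *\<^sub>R Y))" "drho Y" 0] by simp
  from has_vector_derivative_matrix_mult[OF has_vector_derivative_matrix_mult[OF
        drho_deriv[OF Y] has_vector_derivative_const[of "Drho X"]] this]
  have "((\<lambda>t. \<rho> (mexp (t *\<^sub>R Y)) ** Drho X ** \<rho> (mexp (- t *\<^sub>R Y))) has_vector_derivative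
      drho Y ** Drho X - Drho X ** drho Y) (at 0)"
    by (simp add: rho_one)
  ultimately have "P (Y ** X - X ** Y) = drho Y ** Drho X - Drho X ** drho Y"
    by (metis (no_types, lifting) vector_derivative_unique_at ext)
  moreover have "trace (Y ** X - X ** Y) = 0"
    using trace_mul_sym[of X Y] by (simp add: trace_sub)
  ultimately show ?thesis by (simp add: P_eq)
qed

lemma Drho_commutator:
  assumes Y: "trace Y = 0" and X: "trace X = 0"
  shows "Drho (Y ** X - X ** Y) = Drho Y ** Drho X - Drho X ** Drho Y"
proof -
  have tr: "trace (Z ** X - X ** Z) = 0" for Z
    using trace_mul_sym[of X Z] by (simp add: trace_sub)
  have "Y ** X - X ** Y = (sk Y ** X - X ** sk Y) + \<i> *\<^sub>C (he Y ** X - X ** he Y)"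
    by (subst (1 2) sk_he[of Y])
      (simp add: matrix_add_ldistrib matrix_add_distrib_right complex_vector.scale_right_diff_distrib)
  then have "Drho (Y ** X - X ** Y) = Drho (sk Y ** X - X ** sk Y) + \<i> *\<^sub>C Drho (he Y ** X - X ** he Y)"
    by (simp add: Drho_add Drho_scaleC tr trace_scaleC)
  also have "\<dots> = Drho Y ** Drho X - Drho X ** Drho Y"
    using assms unfolding Drho_def[of Y]
    by (simp add: Drho_commutator_su3 sk_su3 he_su3 matrix_add_ldistrib matrix_add_distrib_right
        complex_vector.scale_right_diff_distrib)
  finally show ?thesis .
qed

lemma su3_act_vec: "X \<in> su3 \<Longrightarrow> su3_act (vec_rep \<rho>) X x = drho X *v x"
proof -
  assume X: "X \<in> su3"
  have "((\<lambda>t. \<rho> (mexp (t *\<^sub>R X)) *v x) has_vector_derivative drho X *v x) (at 0)"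
    using has_vector_derivative_matrix_vector_mult[OF drho_deriv[OF X] has_vector_derivative_const[of x]]
    by simp
  then show ?thesis by (simp add: su3_act_def vector_derivative_at)
qed

lemma sl3_act_vec: "trace X = 0 \<Longrightarrow> sl3_act (vec_rep \<rho>) X x = Drho X *v x"
  unfolding sl3_act_def sk_def[symmetric] he_def[symmetric]
  by (simp add: su3_act_vec sk_su3 he_su3 Drho_def
      matrix_vector_left_distrib matrix_vector_scaleC)

lemma op_act_has_vector_derivative:
  assumes X: "X \<in> su3"
  shows "((\<lambda>t. op_act \<rho> (mexp (t *\<^sub>R X)) A) has_vector_derivative drho X ** A - A ** drho X) (at 0)"
proof -
  have "dagger (\<rho> (mexp (t *\<^sub>R X))) = \<rho> (mexp (- t *\<^sub>R X))" for t
    using X mexp_SU3[OF X, of t] rho_dagger[of "mexp (t *\<^sub>R X)"] by (simp add: mexp_dagger su3_def)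
  then have eq: "op_act \<rho> (mexp (t *\<^sub>R X)) A = \<rho> (mexp (t *\<^sub>R X)) ** A ** \<rho> (mexp (- t *\<^sub>R X))" for t
    using mexp_SU3[OF X, of t] by (simp add: op_act_eq)
  have "((\<lambda>t. \<rho> (mexp (- t *\<^sub>R X))) has_vector_derivative - drho X) (at 0)"
    using drho_deriv[OF X] has_vector_derivative_reflect[of "\<lambda>t. \<rho> (mexp (t *\<^sub>R X))" "drho X" 0] by simp
  from has_vector_derivative_matrix_mult[OF has_vector_derivative_matrix_mult[OF
        drho_deriv[OF X] has_vector_derivative_const[of A]] this]
  show ?thesis unfolding eq by (simp add: rho_one)
qed

text \<open>Stated in terms of the action alone, so that it covers the operator space and each of
  its subrepresentations.\<close>

lemma su3_act_op:
  "X \<in> su3 \<Longrightarrow> act R = op_act \<rho> \<Longrightarrow> su3_act R X A = drho X ** A - A ** drho X"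
  using op_act_has_vector_derivative by (simp add: su3_act_def vector_derivative_at)

lemma sl3_act_op:
  "trace X = 0 \<Longrightarrow> act R = op_act \<rho> \<Longrightarrow> sl3_act R X A = Drho X ** A - A ** Drho X"
  unfolding sl3_act_def sk_def[symmetric] he_def[symmetric]
  by (simp add: su3_act_op sk_su3 he_su3 Drho_def
      matrix_add_ldistrib matrix_add_distrib_right complex_vector.scale_right_diff_distrib)

end

section \<open>Highest weight vectors\<close>

inductive_set lowered :: "complex ^ 'n ^ 'n \<Rightarrow> complex ^ 'n ^ 'n \<Rightarrow> complex ^ 'n \<Rightarrow> (complex ^ 'n) set"
  for A B v where
  base: "v \<in> lowered A B v"
| step1: "x \<in> lowered A B v \<Longrightarrow> A *v x \<in> lowered A B v"
| step2: "x \<in> lowered A B v \<Longrightarrow> B *v x \<in> lowered A B v"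

lemma linear_span_preserved:
  fixes A :: "complex ^ 'n ^ 'n"
  assumes "\<And>x. x \<in> S \<Longrightarrow> A *v x \<in> complex_vector.span S'" "x \<in> complex_vector.span S"
  shows "A *v x \<in> complex_vector.span S'"
  using assms(2)
proof (induction rule: complex_vector.span_induct_alt)
  case (step c x y)
  then show ?case
    using assms(1) by (auto simp: matrix_vector_right_distrib matrix_vector_scaleC
        intro!: complex_vector.span_add complex_vector.span_scale)
qed (simp add: complex_vector.span_zero)

lemma complex_subspace_real_subspace:
  "complex_vector.subspace N \<Longrightarrow> subspace N" for N :: "'a::complex_normed_vector set"
  unfolding complex_vector.subspace_def subspace_def by (metis scaleC_of_real)

lemma real_orthogonal_projection:
  fixes N :: "'a::euclidean_space set"
  assumes "subspace N"
  shows "\<exists>P. bounded_linear P \<and> (\<forall>x. P x \<in> N) \<and> (\<forall>x. \<forall>y\<in>N. inner (x - P x) y = 0)"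
proof -
  obtain B where B: "B \<subseteq> N" "pairwise orthogonal B" "\<And>x. x \<in> B \<Longrightarrow> norm x = 1" "independent B" "span B = N"
    using orthonormal_basis_subspace[OF assms] by metis
  have fin: "finite B" using B(4) by (rule independent_imp_finite)
  define P where "P = (\<lambda>x. \<Sum>b\<in>B. inner x b *\<^sub>R b)"
  have "bounded_linear P"
    unfolding P_def by (intro bounded_linear_intros)
  moreover have "P x \<in> N" for x
    unfolding P_def using B(1) assms by (intro subspace_sum subspace_scale) auto
  moreover have "inner (x - P x) y = 0" if y: "y \<in> N" for x y
  proof -
    have b: "inner (x - P x) b = 0" if "b \<in> B" for b
    proof -
      have "inner (P x) b = (\<Sum>c\<in>B. if c = b then inner x b else 0)"
        unfolding P_def inner_sum_left
      proof (rule sum.cong)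
        fix c assume "c \<in> B"
        then show "inner (inner x c *\<^sub>R c) b = (if c = b then inner x b else 0)"
          using B(2,3) that by (auto simp: pairwise_def orthogonal_def power2_norm_eq_inner[symmetric])
      qed simp
      then show ?thesis using fin that by (simp add: inner_diff_left)
    qed
    have "y \<in> span B" using y B(5) by simp
    then show ?thesis
      by (induction rule: span_induct_alt) (simp_all add: b inner_add_right)
  qed
  ultimately show ?thesis by blast
qed

context unitary_mat
begin

text \<open>For a skew-Hermitian matrix the form \<open>vip x (drho X *v x)\<close> is purely
  imaginary, and \<open>inner\<close> is its real part.\<close>

lemma drho_inner_skew: "X \<in> su3 \<Longrightarrow> inner x (drho X *v x) = 0"
proof -
  assume X: "X \<in> su3"
  have "vip x (drho X *v x) = - cnj (vip x (drho X *v x))"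
    using X by (subst vip_dagger) (simp add: dagger_drho matrix_vector_minus vip_def sum_negf mult.commute)
  then have "Re (vip x (drho X *v x)) = - Re (vip x (drho X *v x))"
    by (metis complex_cnj(1) uminus_complex.sel(1) cnj.sel(1))
  then show ?thesis by (simp add: inner_vip)
qed

text \<open>Let u(t) be the orbit and w = u - Pu its component orthogonal to N. The squared norm of
  w is constant: splitting u = w + Pu, the part from w vanishes by skewness and the part from Pu
  stays in N, which is orthogonal to w. It starts at 0.\<close>

lemma invariant_subspace_exp:
  assumes N: "complex_vector.subspace N" and X: "X \<in> su3"
    and inv: "\<And>x. x \<in> N \<Longrightarrow> drho X *v x \<in> N" and x: "x \<in> N"
  shows "\<rho> (mexp (t *\<^sub>R X)) *v x \<in> N"
proof -
  obtain P where P: "bounded_linear P" "\<And>x. P x \<in> N" "\<And>x y. y \<in> N \<Longrightarrow> inner (x - P x) y = 0"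
    using real_orthogonal_projection[OF complex_subspace_real_subspace[OF N]] by blast
  let ?u = "\<lambda>t. \<rho> (mexp (t *\<^sub>R X)) *v x"
  have u: "(?u has_vector_derivative drho X *v ?u t) (at t)" for t
    using has_vector_derivative_matrix_vector_mult[OF drho_deriv_at[OF X, of t] has_vector_derivative_const[of x]]
    by (simp add: matrix_vector_mul_assoc)
  let ?w = "\<lambda>t. ?u t - P (?u t)"
  have w: "(?w has_vector_derivative drho X *v ?u t - P (drho X *v ?u t)) (at t)" for t
    by (intro has_vector_derivative_diff u bounded_linear.has_vector_derivative[OF P(1)])
  have "((\<lambda>t. inner (?w t) (?w t)) has_vector_derivative 0) (at t)" for t
  proof -
    let ?a = "drho X *v ?u t - P (drho X *v ?u t)"
    have "((\<lambda>t. inner (?w t) (?w t)) has_vector_derivative inner (?w t) ?a + inner ?a (?w t)) (at t)"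
      by (intro bounded_bilinear.has_vector_derivative[OF bounded_bilinear_inner] w)
    moreover have "inner (?w t) ?a = 0"
    proof -
      have eq: "drho X *v ?u t = drho X *v ?w t + drho X *v P (?u t)"
        by (simp add: matrix_vector_right_distrib[symmetric])
      have "inner (?w t) (drho X *v ?w t + drho X *v P (?u t)) = 0"
        using drho_inner_skew[OF X] P(3)[OF inv[OF P(2)]] by (simp only: inner_add_right add_0_left)
      then show ?thesis
        using P(3)[OF P(2)] unfolding eq[symmetric] by (simp add: inner_diff_right)
    qed
    ultimately show ?thesis by (simp add: inner_commute)
  qed
  then have "inner (?w t) (?w t) = inner (?w 0) (?w 0)"
    by (rule vector_derivative_zero_const)
  also have "\<dots> = 0"
    using P(3)[of "x - P x" x] complex_vector.subspace_diff[OF N x P(2)] by (simp add: rho_one)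
  finally have "?u t = P (?u t)" by simp
  then show ?thesis using P(2) by metis
qed

lemma Drho_gens:
  assumes N: "complex_vector.subspace N"
    and inv: "\<And>i j x. (i, j) \<in> {(1, 2), (2, 1), (2, 3), (3, 2)} \<Longrightarrow> x \<in> N \<Longrightarrow> Drho (unit_mat i j) *v x \<in> N"
    and X: "X \<in> su3_gens" and x: "x \<in> N"
  shows "drho X *v x \<in> N"
proof -
  have lin: "Drho (c *\<^sub>C (unit_mat i j + d *\<^sub>C unit_mat j i)) *v x \<in> N"
    if "(i, j) \<in> {(1, 2), (2, 3)}" for i j c d
  proof -
    have ij: "i \<noteq> j" "(i, j) \<in> {(1, 2), (2, 1), (2, 3), (3, 2)}" "(j, i) \<in> {(1, 2), (2, 1), (2, 3), (3, 2)}"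
      using that by auto
    have "Drho (c *\<^sub>C (unit_mat i j + d *\<^sub>C unit_mat j i)) = c *\<^sub>C (Drho (unit_mat i j) + d *\<^sub>C Drho (unit_mat j i))"
      using ij(1) by (simp add: Drho_scaleC Drho_add trace_unit_mat trace_add trace_scaleC)
    then show ?thesis
      using inv[OF ij(2) x] inv[OF ij(3) x] N
      by (simp add: matrix_vector_scaleC matrix_vector_left_distrib complex_vector.subspace_add complex_vector.subspace_scale)
  qed
  have m: "unit_mat i j + (- 1) *\<^sub>C unit_mat j i = unit_mat i j - unit_mat j i" for i j by simp
  have "Drho X *v x \<in> N"
    using X lin[of 1 2 "1/2" "- 1"] lin[of 2 3 "1/2" "- 1"] lin[of 1 2 "- \<i>/2" 1] lin[of 2 3 "- \<i>/2" 1]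
    unfolding su3_gens_def skew_gen_def sym_gen_def m by auto
  then show ?thesis using su3_gens_su3[OF X] by (simp add: Drho_su3)
qed

end

locale hw_mat = unitary_mat \<rho> for \<rho> :: "complex ^ 3 ^ 3 \<Rightarrow> complex ^ 'n ^ 'n" +
  fixes p q :: nat and v :: "complex ^ 'n"
  assumes irred: "irreducible_rep (vec_rep \<rho>)" and hw: "highest_weight_vector (p, q) (vec_rep \<rho>) v"
begin

lemma v_nz: "v \<noteq> 0"
  and raise_v: "Drho (unit_mat 1 2) *v v = 0" "Drho (unit_mat 2 3) *v v = 0"
  using hw by (simp_all add: highest_weight_vector_def T_plus_def U_plus_def sl3_act_vec trace_unit_mat)

lemma weight_v:
  "Drho (unit_mat 1 1 - unit_mat 2 2) *v v = of_nat p *\<^sub>C v"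
  "Drho (unit_mat 2 2 - unit_mat 3 3) *v v = of_nat q *\<^sub>C v"
proof -
  have t: "trace (unit_mat 1 1 - unit_mat 2 2) = 0" "trace (unit_mat 2 2 - unit_mat 3 3) = 0"
    by (simp_all add: trace_sub trace_unit_mat)
  then have "(1/2) *\<^sub>C (Drho (unit_mat 1 1 - unit_mat 2 2) *v v) = (of_nat p / 2) *\<^sub>C v"
    "(1/2) *\<^sub>C (Drho (unit_mat 2 2 - unit_mat 3 3) *v v) = (of_nat q / 2) *\<^sub>C v"
    using hw by (simp_all only: highest_weight_vector_def T_three_def U_three_def prod.case sl3_act_vec
        trace_scaleC mult_zero_right Drho_scaleC matrix_vector_scaleC)
  from arg_cong[OF this(1), of "scaleC 2"] arg_cong[OF this(2), of "scaleC 2"]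
  show "Drho (unit_mat 1 1 - unit_mat 2 2) *v v = of_nat p *\<^sub>C v"
    "Drho (unit_mat 2 2 - unit_mat 3 3) *v v = of_nat q *\<^sub>C v"
    by simp_all
qed

abbreviation "lows \<equiv> lowered (Drho (unit_mat 2 1)) (Drho (unit_mat 3 2)) v"

lemma commutator_apply:
  assumes "trace Y = 0" "trace X = 0"
  shows "Drho Y *v (Drho X *v x) = Drho X *v (Drho Y *v x) + Drho (Y ** X - X ** Y) *v x"
  using Drho_commutator[OF assms]
  by (simp add: matrix_vector_left_distrib matrix_vector_mul_assoc)

lemma weight_lower:
  assumes "trace Y = 0" "trace X = 0" "Y ** X - X ** Y = k *\<^sub>C X" "Drho Y *v x = c *\<^sub>C x"
  shows "Drho Y *v (Drho X *v x) = (c + k) *\<^sub>C (Drho X *v x)"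
  using commutator_apply[OF assms(1,2), of x] assms
  by (simp add: Drho_scaleC matrix_vector_scaleC complex_vector.scale_left_distrib)

text \<open>Each lowering operator shifts the eigenvalues of the two coroots by entries of the
  negated Cartan matrix, -2 for its own coroot and 1 for the other.\<close>

lemma lows_weight:
  assumes "x \<in> lows"
  shows "(\<exists>c. Drho (unit_mat 1 1 - unit_mat 2 2) *v x = c *\<^sub>C x) \<and>
         (\<exists>c. Drho (unit_mat 2 2 - unit_mat 3 3) *v x = c *\<^sub>C x)"
  using assms
proof induction
  case base
  show ?case using weight_v by blast
next
  case (step1 x)
  then obtain c d where cd: "Drho (unit_mat 1 1 - unit_mat 2 2) *v x = c *\<^sub>C x"
    "Drho (unit_mat 2 2 - unit_mat 3 3) *v x = d *\<^sub>C x" by blast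
  have 1: "(unit_mat 1 1 - unit_mat 2 2) ** unit_mat 2 1 - unit_mat 2 1 ** (unit_mat 1 1 - unit_mat 2 2)
      = (- 2) *\<^sub>C unit_mat 2 1"
    by (simp add: matrix_diff_left matrix_diff_right unit_mat_mult vec_eq_iff)
  have 2: "(unit_mat 2 2 - unit_mat 3 3) ** unit_mat 2 1 - unit_mat 2 1 ** (unit_mat 2 2 - unit_mat 3 3)
      = 1 *\<^sub>C unit_mat 2 1"
    by (simp add: matrix_diff_left matrix_diff_right unit_mat_mult)
  have "Drho (unit_mat 1 1 - unit_mat 2 2) *v (Drho (unit_mat 2 1) *v x) = (c + - 2) *\<^sub>C (Drho (unit_mat 2 1) *v x)"
    "Drho (unit_mat 2 2 - unit_mat 3 3) *v (Drho (unit_mat 2 1) *v x) = (d + 1) *\<^sub>C (Drho (unit_mat 2 1) *v x)"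
    using weight_lower[OF _ _ 1 cd(1)] weight_lower[OF _ _ 2 cd(2)] by (simp_all add: trace_sub trace_unit_mat)
  then show ?case by blast
next
  case (step2 x)
  then obtain c d where cd: "Drho (unit_mat 1 1 - unit_mat 2 2) *v x = c *\<^sub>C x"
    "Drho (unit_mat 2 2 - unit_mat 3 3) *v x = d *\<^sub>C x" by blast
  have 1: "(unit_mat 1 1 - unit_mat 2 2) ** unit_mat 3 2 - unit_mat 3 2 ** (unit_mat 1 1 - unit_mat 2 2)
      = 1 *\<^sub>C unit_mat 3 2"
    by (simp add: matrix_diff_left matrix_diff_right unit_mat_mult)
  have 2: "(unit_mat 2 2 - unit_mat 3 3) ** unit_mat 3 2 - unit_mat 3 2 ** (unit_mat 2 2 - unit_mat 3 3)
      = (- 2) *\<^sub>C unit_mat 3 2"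
    by (simp add: matrix_diff_left matrix_diff_right unit_mat_mult vec_eq_iff)
  have "Drho (unit_mat 1 1 - unit_mat 2 2) *v (Drho (unit_mat 3 2) *v x) = (c + 1) *\<^sub>C (Drho (unit_mat 3 2) *v x)"
    "Drho (unit_mat 2 2 - unit_mat 3 3) *v (Drho (unit_mat 3 2) *v x) = (d + - 2) *\<^sub>C (Drho (unit_mat 3 2) *v x)"
    using weight_lower[OF _ _ 1 cd(1)] weight_lower[OF _ _ 2 cd(2)] by (simp_all add: trace_sub trace_unit_mat)
  then show ?case by blast
qed

lemma lower_span_lows:
  "x \<in> complex_vector.span lows \<Longrightarrow> Drho (unit_mat 2 1) *v x \<in> complex_vector.span lows"
  "x \<in> complex_vector.span lows \<Longrightarrow> Drho (unit_mat 3 2) *v x \<in> complex_vector.span lows"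
  by (rule linear_span_preserved[of lows]; auto intro: complex_vector.span_base lowered.intros)+

text \<open>A raising operator commutes with the lowering operator of the other simple root, and its
  commutator with its own one is a coroot, which acts on a monomial by a scalar. Induction moves it
  through to v, where it gives 0.\<close>

lemma raise_lows:
  assumes "x \<in> lows"
  shows "Drho (unit_mat 1 2) *v x \<in> complex_vector.span lows \<and> Drho (unit_mat 2 3) *v x \<in> complex_vector.span lows"
  using assms
proof induction
  case base
  show ?case by (simp add: raise_v complex_vector.span_zero)
next
  case (step1 x)
  obtain c where c: "Drho (unit_mat 1 1 - unit_mat 2 2) *v x = c *\<^sub>C x"
    using lows_weight[OF step1.hyps] by blast
  have "Drho (unit_mat 1 2) *v (Drho (unit_mat 2 1) *v x) = Drho (unit_mat 2 1) *v (Drho (unit_mat 1 2) *v x) + c *\<^sub>C x"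
    by (subst commutator_apply) (simp_all add: trace_unit_mat unit_mat_mult c)
  moreover have "Drho (unit_mat 2 3) *v (Drho (unit_mat 2 1) *v x) = Drho (unit_mat 2 1) *v (Drho (unit_mat 2 3) *v x)"
    by (subst commutator_apply) (simp_all add: trace_unit_mat unit_mat_mult Drho_su3[of 0] su3_def drho_0 trace_0[unfolded mat_0])
  ultimately show ?case
    using step1 by (auto intro!: complex_vector.span_add complex_vector.span_scale lower_span_lows intro: complex_vector.span_base)
next
  case (step2 x)
  obtain c where c: "Drho (unit_mat 2 2 - unit_mat 3 3) *v x = c *\<^sub>C x"
    using lows_weight[OF step2.hyps] by blast
  have "Drho (unit_mat 2 3) *v (Drho (unit_mat 3 2) *v x) = Drho (unit_mat 3 2) *v (Drho (unit_mat 2 3) *v x) + c *\<^sub>C x"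
    by (subst commutator_apply) (simp_all add: trace_unit_mat unit_mat_mult c)
  moreover have "Drho (unit_mat 1 2) *v (Drho (unit_mat 3 2) *v x) = Drho (unit_mat 3 2) *v (Drho (unit_mat 1 2) *v x)"
    by (subst commutator_apply) (simp_all add: trace_unit_mat unit_mat_mult Drho_su3[of 0] su3_def drho_0 trace_0[unfolded mat_0])
  ultimately show ?case
    using step2 by (auto intro!: complex_vector.span_add complex_vector.span_scale lower_span_lows intro: complex_vector.span_base)
qed

text \<open>The span is stable under raising and lowering operators, hence under the exponentials of
  the generators and under the whole group. It contains v, so irreducibility leaves no
  choice.\<close>

lemma span_lows: "complex_vector.span lows = UNIV"
proof -
  let ?N = "complex_vector.span lows"
  have inv: "Drho (unit_mat i j) *v x \<in> ?N" if "(i, j) \<in> {(1, 2), (2, 1), (2, 3), (3, 2)}" "x \<in> ?N" for i j x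
    using that raise_lows lower_span_lows linear_span_preserved[of lows "Drho (unit_mat 1 2)" lows x]
      linear_span_preserved[of lows "Drho (unit_mat 2 3)" lows x]
    by auto
  have "\<forall>x\<in>?N. \<rho> g *v x \<in> ?N" if "g \<in> SU3" for g
    using that
  proof (induction rule: SU3_induct)
    case (exp X t)
    then show ?case
      using invariant_subspace_exp[OF complex_vector.subspace_span su3_gens_su3[OF exp]
          Drho_gens[OF complex_vector.subspace_span inv exp]]
      by blast
  next
    case (mult g h)
    then show ?case by (simp add: rho_mult matrix_vector_mul_assoc[symmetric])
  qed
  moreover have "v \<in> ?N" by (intro complex_vector.span_base lowered.base)
  ultimately show ?thesis
    using irred v_nz unfolding irreducible_rep_def
    by (metis (no_types, lifting) complex_vector.subspace_span singletonD subset_UNIV vec_rep_simps(1) vec_rep_simps(3))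
qed

text \<open>The annihilator of the orbit of the highest weight
  state is stable under commutators, and \<open>\<langle>F\<^sub>1 v, A F\<^sub>2 v\<rangle>\<close> for products \<open>F\<^sub>1\<close>, \<open>F\<^sub>2\<close> of
  lowering operators reduces to \<open>\<langle>v, A' v\<rangle>\<close> with \<open>A'\<close> an iterated commutator.\<close>

lemma berezin_injective:
  assumes "\<And>g. g \<in> SU3 \<Longrightarrow> vip v (op_act \<rho> g A *v v) = 0"
  shows "A = 0"
proof -
  \<comment> \<open>The operators with vanishing Berezin symbol.\<close>
  define S where "S = {A. \<forall>g\<in>SU3. vip v (op_act \<rho> g A *v v) = 0}"
  have q: "vip v (A *v v) = 0" if "A \<in> S" for A
    using that SU3_one unfolding S_def by (auto simp: op_act_eq rho_one dest!: bspec[of _ _ "mat 1"])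
  have S_act: "op_act \<rho> g A \<in> S" if "A \<in> S" "g \<in> SU3" for A g
  proof -
    have "op_act \<rho> h (op_act \<rho> g A) = op_act \<rho> (h ** g) A" if "h \<in> SU3" for h
      using that \<open>g \<in> SU3\<close> by (simp add: op_act_eq rho_mult SU3_mult matrix_mul_assoc)
    with that show ?thesis by (auto simp: S_def SU3_mult)
  qed
  have comm_su3: "vip v ((drho X ** A - A ** drho X) *v v) = 0" if "A \<in> S" "X \<in> su3" for A X
  proof -
    have bl: "bounded_linear (\<lambda>A. vip v (A *v v))"
      by (intro linear_conv_bounded_linear[THEN iffD1] linearI)
        (simp_all add: matrix_vector_left_distrib vip_add_right scaleC_of_real[symmetric] matrix_vector_scaleC
          vip_scale_right scaleR_conv_of_real[of _ "vip v _"])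
    have "((\<lambda>t. vip v (op_act \<rho> (mexp (t *\<^sub>R X)) A *v v)) has_vector_derivative
        vip v ((drho X ** A - A ** drho X) *v v)) (at 0)"
      by (rule bounded_linear.has_vector_derivative[OF bl op_act_has_vector_derivative[OF that(2)]])
    moreover have "(\<lambda>t. vip v (op_act \<rho> (mexp (t *\<^sub>R X)) A *v v)) = (\<lambda>t. 0)"
      using that mexp_SU3 by (auto simp: S_def)
    ultimately show ?thesis
      using vector_derivative_unique_at[OF _ has_vector_derivative_const[of 0]] by metis
  qed
  \<comment> \<open>S is stable under the group, so differentiating the vanishing symbol along
    one-parameter groups shows that it is stable under commutators with su(3), and by linearity with
    its complexification.\<close>
  have comm: "Drho X ** A - A ** Drho X \<in> S" if A: "A \<in> S" and X: "trace X = 0" for A X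
    unfolding S_def
  proof (intro CollectI ballI)
    fix g assume g: "g \<in> SU3"
    let ?A = "op_act \<rho> g A" and ?X = "g ** X ** dagger g"
    have tX: "trace ?X = 0" using g X by (simp add: trace_conj)
    have "op_act \<rho> g (Drho X ** A - A ** Drho X) = Drho ?X ** ?A - ?A ** Drho ?X"
    proof -
      have "Drho ?X ** ?A = \<rho> g ** Drho X ** (dagger (\<rho> g) ** \<rho> g) ** A ** dagger (\<rho> g)"
        "?A ** Drho ?X = \<rho> g ** A ** (dagger (\<rho> g) ** \<rho> g) ** Drho X ** dagger (\<rho> g)"
        using g X by (simp_all add: op_act_eq Drho_conj matrix_mul_assoc)
      then show ?thesis
        using g by (simp add: op_act_eq rho_unitary matrix_diff_right matrix_diff_left matrix_mul_assoc)
    qed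
    also have "\<dots> = (drho (sk ?X) ** ?A - ?A ** drho (sk ?X)) + \<i> *\<^sub>C (drho (he ?X) ** ?A - ?A ** drho (he ?X))"
      by (simp add: Drho_def matrix_add_ldistrib matrix_add_distrib_right complex_vector.scale_right_diff_distrib)
    finally show "vip v (op_act \<rho> g (Drho X ** A - A ** Drho X) *v v) = 0"
      using comm_su3[OF S_act[OF A g] sk_su3[OF tX]] comm_su3[OF S_act[OF A g] he_su3[OF tX]]
      by (simp add: matrix_vector_left_distrib(1) matrix_vector_scaleC vip_add_right vip_scale_right)
  qed
  have adj: "vip x (Drho (unit_mat i j) *v y) = vip (Drho (unit_mat j i) *v x) y" if "i \<noteq> j" for i j x y
    using that by (simp add: vip_dagger dagger_Drho trace_unit_mat)
  have swap: "A *v (Drho X *v x) = Drho X *v (A *v x) - (Drho X ** A - A ** Drho X) *v x" for A X x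
    by (simp add: matrix_vector_left_distrib matrix_vector_mul_assoc)
  \<comment> \<open>Moving a lowering operator to the left of A costs a commutator, which is in S
    again. What has reached the left is adjoint to a raising operator and kills v.\<close>
  have 1: "\<forall>A\<in>S. vip v (A *v x) = 0" if "x \<in> lows" for x
    using that
  proof induction
    case base
    then show ?case using q by blast
  next
    case (step1 x)
    then show ?case
      using comm[of _ "unit_mat 2 1"] by (simp add: swap vip_diff_right adj raise_v trace_unit_mat)
  next
    case (step2 x)
    then show ?case
      using comm[of _ "unit_mat 3 2"] by (simp add: swap vip_diff_right adj raise_v trace_unit_mat)
  qed
  have 2: "vip v (A *v x) = 0" if "A \<in> S" for A x
  proof -
    have "x \<in> complex_vector.span lows" using span_lows by simp
    then show ?thesis
      by (induction rule: complex_vector.span_induct_alt)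
        (use 1 that in \<open>simp_all add: matrix_vector_right_distrib matrix_vector_scaleC vip_add_right vip_scale_right\<close>)
  qed
  \<comment> \<open>The same exchange on the left entry: the adjoint raising operator passes to the
    right of A, where the vector w is arbitrary.\<close>
  have 3: "\<forall>A\<in>S. \<forall>w. vip x (A *v w) = 0" if "x \<in> lows" for x
    using that
  proof induction
    case base
    then show ?case using 2 by blast
  next
    case (step1 x)
    have "vip (Drho (unit_mat 2 1) *v x) (A *v w) = 0" if A: "A \<in> S" for A w
    proof -
      have "Drho (unit_mat 1 2) *v (A *v w) = A *v (Drho (unit_mat 1 2) *v w)
          + (Drho (unit_mat 1 2) ** A - A ** Drho (unit_mat 1 2)) *v w"
        by (simp add: swap)
      then show ?thesis
        using step1.IH A comm[OF A, of "unit_mat 1 2"]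
        by (simp add: adj[symmetric] vip_add_right trace_unit_mat)
    qed
    then show ?case by blast
  next
    case (step2 x)
    have "vip (Drho (unit_mat 3 2) *v x) (A *v w) = 0" if A: "A \<in> S" for A w
    proof -
      have "Drho (unit_mat 2 3) *v (A *v w) = A *v (Drho (unit_mat 2 3) *v w)
          + (Drho (unit_mat 2 3) ** A - A ** Drho (unit_mat 2 3)) *v w"
        by (simp add: swap)
      then show ?thesis
        using step2.IH A comm[OF A, of "unit_mat 2 3"]
        by (simp add: adj[symmetric] vip_add_right trace_unit_mat)
    qed
    then show ?case by blast
  qed
  have A: "A \<in> S" using assms by (simp add: S_def)
  have "vip x (A *v w) = 0" for x w
  proof -
    have "x \<in> complex_vector.span lows" using span_lows by simp
    then show ?thesis
      by (induction rule: complex_vector.span_induct_alt)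
        (use 3 A in \<open>simp_all add: vip_add_left vip_scale_left\<close>)
  qed
  then have "A *v w = 0" for w using vip_self_eq_0 by blast
  then show ?thesis by (simp add: matrix_eq)
qed

end

section \<open>The maximal torus\<close>

lemma dagger_torus: "h \<in> torus \<Longrightarrow> dagger h \<in> torus"
  by (auto simp: torus_def SU3_dagger)

definition diag3 :: "complex \<Rightarrow> complex \<Rightarrow> complex \<Rightarrow> complex ^ 3 ^ 3" where
  "diag3 x y z = vector [vector [x, 0, 0], vector [0, y, 0], vector [0, 0, z]]"

lemma torus_SU3: "h \<in> torus \<Longrightarrow> h \<in> SU3"
  by (simp add: torus_def)

lemma torus_diag3: "h \<in> torus \<Longrightarrow> h = diag3 (h $ 1 $ 1) (h $ 2 $ 2) (h $ 3 $ 3)"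
  by (simp add: torus_def diag3_def vec_eq_iff forall_3)

lemma torus_entries:
  assumes "h \<in> torus"
  shows "h $ 1 $ 1 * h $ 2 $ 2 * h $ 3 $ 3 = 1" "cmod (h $ i $ i) = 1"
proof -
  have h: "h \<in> SU3" "\<And>i j. i \<noteq> j \<Longrightarrow> h $ i $ j = 0" using assms by (auto simp: torus_def)
  then show "h $ 1 $ 1 * h $ 2 $ 2 * h $ 3 $ 3 = 1"
    by (simp add: SU3_def det_3)
  have "(dagger h ** h) $ i $ i = 1" using SU3_dagger_left[OF h(1)] by (simp add: mat_def)
  moreover have "(dagger h ** h) $ i $ i = cnj (h $ i $ i) * h $ i $ i"
    using h(2) exhaust_3[of i] by (auto simp: matrix_matrix_mult_def sum_3)
  ultimately have "of_real (cmod (h $ i $ i) ^ 2) = (1 :: complex)"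
    by (simp only: complex_norm_square mult.commute)
  then show "cmod (h $ i $ i) = 1"
    unfolding of_real_eq_1_iff using norm_ge_zero[of "h $ i $ i"] by (simp add: power2_eq_1_iff)
qed

lemma diag3_torus:
  assumes "cmod x = 1" "cmod y = 1" "cmod z = 1" "x * y * z = 1"
  shows "diag3 x y z \<in> torus"
proof -
  have "cnj w * w = 1" if "cmod w = 1" for w
    using complex_norm_square[of w] that by (simp add: mult.commute)
  then show ?thesis
    using assms by (simp add: torus_def SU3_def det_3 diag3_def vec_eq_iff forall_3 matrix_matrix_mult_def sum_3 mat_def)
qed

lemma cnj_eq_inverse: "cmod z = 1 \<Longrightarrow> cnj z = inverse z"
  using complex_norm_square[of z] by (simp add: inverse_unique)

text \<open>The torus character of weight (n1, n2, n3). On the torus it depends only on n1 - n2 and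
  n2 - n3, because the diagonal entries have product 1.\<close>

definition chr :: "complex ^ 3 ^ 3 \<Rightarrow> int \<times> int \<times> int \<Rightarrow> complex" where
  "chr h = (\<lambda>(n1, n2, n3). h $ 1 $ 1 powi n1 * h $ 2 $ 2 powi n2 * h $ 3 $ 3 powi n3)"

lemma chr_norm: "h \<in> torus \<Longrightarrow> cmod (chr h n) = 1"
  by (cases n) (simp add: chr_def norm_mult norm_power_int torus_entries)

lemma chr_cnj_mult: "h \<in> torus \<Longrightarrow> cnj (chr h n) * chr h n = 1"
  using complex_norm_square[of "chr h n"] by (simp add: chr_norm mult.commute)

lemma chr_cis: "chr (diag3 (cis x) (cis y) (cis z)) (n1, n2, n3) = cis (n1 * x + n2 * y + n3 * z)"
  by (simp add: chr_def diag3_def cis_power_int cis_mult)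

lemma cis_torus: "x + y + z = 0 \<Longrightarrow> diag3 (cis x) (cis y) (cis z) \<in> torus"
  by (rule diag3_torus) (simp_all add: cis_mult)

text \<open>At x = \<pi>/(m - n) the two values would differ by the factor -1.\<close>

lemma cis_pi_ratio:
  fixes m n :: int
  assumes "\<And>x::real. cis (real_of_int m * x) = cis (real_of_int n * x)"
  shows "m = n"
proof (rule ccontr)
  assume "m \<noteq> n"
  define x where "x = pi / (m - n)"
  have "cis (m * x - n * x) = 1"
    using assms[of x] by (simp flip: cis_divide)
  moreover have "m * x - n * x = (real_of_int m - real_of_int n) * x"
    by (simp add: left_diff_distrib)
  then have "m * x - n * x = pi"
    using \<open>m \<noteq> n\<close> by (simp add: x_def)
  ultimately show False by simp
qed

text \<open>The differences are read off on the circles diag(e^{ix}, e^{-ix}, 1) and diag(1, e^{ix},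
  e^{-ix}).\<close>

lemma chr_eq:
  assumes "\<And>h. h \<in> torus \<Longrightarrow> chr h (n1, n2, n3) = chr h (m1, m2, m3)"
  shows "n1 - n2 = m1 - m2" "n2 - n3 = m2 - m3"
proof -
  have "cis (real_of_int (n1 - n2) * x) = cis (real_of_int (m1 - m2) * x)" for x
    using assms[OF cis_torus[of x "- x" 0]] unfolding chr_cis of_int_diff left_diff_distrib by simp
  then show "n1 - n2 = m1 - m2" by (rule cis_pi_ratio)
  have "cis (real_of_int (n2 - n3) * x) = cis (real_of_int (m2 - m3) * x)" for x
    using assms[OF cis_torus[of 0 x "- x"]] unfolding chr_cis of_int_diff left_diff_distrib by simp
  then show "n2 - n3 = m2 - m3" by (rule cis_pi_ratio)
qed

lemma chr_minus: "h \<in> torus \<Longrightarrow> cnj (chr h (n1, n2, n3)) = chr h (- n1, - n2, - n3)"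
proof -
  assume h: "h \<in> torus"
  have "cnj (h $ i $ i) = inverse (h $ i $ i)" for i
    using torus_entries(2)[OF h, of i] by (simp add: cnj_eq_inverse)
  then show ?thesis
    by (simp add: chr_def power_int_minus power_int_inverse)
qed

lemma mexp_diag3:
  "mexp (t *\<^sub>R diag3 (\<i> * of_real x) (\<i> * of_real y) (\<i> * of_real z)) = diag3 (cis (t * x)) (cis (t * y)) (cis (t * z))"
proof (rule mexp_unique)
  fix t
  have d: "((\<lambda>t. cis (t * x)) has_vector_derivative \<i> * of_real x * cis (t * x)) (at t)" for x
  proof -
    have "((\<lambda>t. exp (\<i> * of_real x * of_real t)) has_vector_derivative \<i> * of_real x * exp (\<i> * of_real x * of_real t)) (at t)"
      by (rule has_vector_derivative_real_field) (auto intro!: derivative_eq_intros)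
    then show ?thesis by (simp add: cis_conv_exp mult_ac)
  qed
  have ex: "P i j" if "P 1 1" "P 1 2" "P 1 3" "P 2 1" "P 2 2" "P 2 3" "P 3 1" "P 3 2" "P 3 3" for P :: "3 \<Rightarrow> 3 \<Rightarrow> bool" and i j
    using that exhaust_3[of i] exhaust_3[of j] by auto
  show "((\<lambda>t. diag3 (cis (t * x)) (cis (t * y)) (cis (t * z))) has_vector_derivative
      diag3 (\<i> * of_real x) (\<i> * of_real y) (\<i> * of_real z) ** diag3 (cis (t * x)) (cis (t * y)) (cis (t * z))) (at t)"
    by (rule has_vector_derivative_matrix3, rule ex) (simp_all add: diag3_def matrix_matrix_mult_def sum_3 d)
qed (simp add: diag3_def vec_eq_iff forall_3 mat_def)

lemma mexp_torus_generators:
  "mexp (t *\<^sub>R ((- \<i>/2) *\<^sub>C (unit_mat 1 1 - unit_mat 2 2))) = diag3 (cis (- t / 2)) (cis (t / 2)) 1"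
  "mexp (t *\<^sub>R ((- \<i>/2) *\<^sub>C (unit_mat 2 2 - unit_mat 3 3))) = diag3 1 (cis (- t / 2)) (cis (t / 2))"
proof -
  have "(- \<i>/2) *\<^sub>C (unit_mat 1 1 - unit_mat 2 2) = diag3 (\<i> * of_real (- 1/2)) (\<i> * of_real (1/2)) (\<i> * of_real 0)"
    "(- \<i>/2) *\<^sub>C (unit_mat 2 2 - unit_mat 3 3) = diag3 (\<i> * of_real 0) (\<i> * of_real (- 1/2)) (\<i> * of_real (1/2))"
    by (simp_all add: diag3_def vec_eq_iff forall_3)
  then show "mexp (t *\<^sub>R ((- \<i>/2) *\<^sub>C (unit_mat 1 1 - unit_mat 2 2))) = diag3 (cis (- t / 2)) (cis (t / 2)) 1"
    "mexp (t *\<^sub>R ((- \<i>/2) *\<^sub>C (unit_mat 2 2 - unit_mat 3 3))) = diag3 1 (cis (- t / 2)) (cis (t / 2))"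
    by (simp_all only: mexp_diag3) simp_all
qed

lemma (in onb_rep) torus_highest_weight:
  assumes hw: "highest_weight_vector (p, q) R v" and h: "h \<in> torus"
  shows "act R h v = chr h (int p + int q, int q, 0) *\<^sub>C v"
proof -
  have v: "v \<in> carr R" using hw by (simp add: highest_weight_vector_def)
  define Y1 Y2 :: "complex ^ 3 ^ 3" where "Y1 = (- \<i>/2) *\<^sub>C (unit_mat 1 1 - unit_mat 2 2)"
    and "Y2 = (- \<i>/2) *\<^sub>C (unit_mat 2 2 - unit_mat 3 3)"
  have Y: "Y1 \<in> su3" "Y2 \<in> su3"
    by (auto simp: su3_def Y1_def Y2_def trace_scaleC trace_sub trace_minus trace_unit_mat vec_eq_iff)
  \<comment> \<open>A Hermitian matrix has no skew-Hermitian part, so only the second summand of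
    \<open>sl3_act\<close> survives.\<close>
  have herm: "sl3_act R ((1/2) *\<^sub>C H) v = \<i> *\<^sub>C su3_act R ((- \<i>/2) *\<^sub>C H) v" if "dagger H = H" for H
  proof -
    have "(1/2) *\<^sub>C H + (1/2) *\<^sub>C H = H" by (simp add: vec_eq_iff)
    then show ?thesis using that v by (simp add: sl3_act_def su3_act_0)
  qed
  have cancel: "x = (- \<i> * c) *\<^sub>C w" if "\<i> *\<^sub>C x = c *\<^sub>C w" for x w :: 'v and c
    using arg_cong[OF that, of "scaleC (- \<i>)"] by simp
  have e1: "su3_act R Y1 v = (- \<i> * (of_nat p / 2)) *\<^sub>C v"
    unfolding Y1_def by (rule cancel, subst herm[symmetric])
      (use hw in \<open>simp_all add: highest_weight_vector_def T_three_def\<close>)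
  have e2: "su3_act R Y2 v = (- \<i> * (of_nat q / 2)) *\<^sub>C v"
    unfolding Y2_def by (rule cancel, subst herm[symmetric])
      (use hw in \<open>simp_all add: highest_weight_vector_def U_three_def\<close>)
  \<comment> \<open>These angles give h = diag(e^{i\<alpha>}, e^{i(\<beta>-\<alpha>)},
    e^{-i\<beta>}), a product of exponentials of the two coroots; the factor -2 below compensates
    their normalization by -i/2.\<close>
  define \<alpha> \<beta> where "\<alpha> = Arg (h $ 1 $ 1)" and "\<beta> = - Arg (h $ 3 $ 3)"
  have h1: "h $ 1 $ 1 = cis \<alpha>" and h3: "h $ 3 $ 3 = cis (- \<beta>)"
    using rcis_cmod_Arg[of "h $ 1 $ 1"] rcis_cmod_Arg[of "h $ 3 $ 3"] torus_entries(2)[OF h]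
    by (simp_all add: \<alpha>_def \<beta>_def rcis_def)
  have "cis \<alpha> * cis (- \<beta>) * h $ 2 $ 2 = 1"
    using torus_entries(1)[OF h] unfolding h1 h3 by (simp add: mult_ac)
  then have "cis (\<beta> - \<alpha>) * (cis (\<alpha> - \<beta>) * h $ 2 $ 2) = cis (\<beta> - \<alpha>)"
    by (simp add: cis_mult)
  then have h2: "h $ 2 $ 2 = cis (\<beta> - \<alpha>)"
    by (simp add: mult.assoc[symmetric] cis_mult)
  have hh: "h = diag3 (cis \<alpha>) (cis (\<beta> - \<alpha>)) (cis (- \<beta>))"
    using torus_diag3[OF h] unfolding h1 h2 h3 .
  also have "\<dots> = mexp ((- 2 * \<alpha>) *\<^sub>R Y1) ** mexp ((- 2 * \<beta>) *\<^sub>R Y2)"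
    unfolding Y1_def Y2_def mexp_torus_generators
    by (simp add: diag3_def vec_eq_iff forall_3 matrix_matrix_mult_def sum_3 cis_mult)
  finally have "act R h v = act R (mexp ((- 2 * \<alpha>) *\<^sub>R Y1)) (act R (mexp ((- 2 * \<beta>) *\<^sub>R Y2)) v)"
    using act_mult[OF mexp_SU3[OF Y(1), of "- 2 * \<alpha>"] mexp_SU3[OF Y(2), of "- 2 * \<beta>"] v] by simp
  also have "\<dots> = (exp (\<i> * of_nat q * of_real \<beta>) * exp (\<i> * of_nat p * of_real \<alpha>)) *\<^sub>C v"
  proof -
    have a: "act R (mexp ((- 2 * \<alpha>) *\<^sub>R Y1)) v = exp (\<i> * of_nat p * of_real \<alpha>) *\<^sub>C v"
      "act R (mexp ((- 2 * \<beta>) *\<^sub>R Y2)) v = exp (\<i> * of_nat q * of_real \<beta>) *\<^sub>C v"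
      using act_eigen[OF Y(1) v e1, of "- 2 * \<alpha>"] act_eigen[OF Y(2) v e2, of "- 2 * \<beta>"] by (simp_all add: mult_ac)
    show ?thesis unfolding a(2) act_scale[OF mexp_SU3[OF Y(1)] v] a(1) scaleC_scaleC ..
  qed
  also have "exp (\<i> * of_nat q * of_real \<beta>) * exp (\<i> * of_nat p * of_real \<alpha>) = chr h (int p + int q, int q, 0)"
    unfolding hh chr_cis by (simp add: cis_conv_exp exp_add[symmetric] algebra_simps)
  finally show ?thesis .
qed

section \<open>Gelfand-Tsetlin labels\<close>

lemma gt_labelsE:
  assumes "((n1, n2, n3), J) \<in> gt_labels (p, q)"
  obtains rm rp where "0 \<le> rm" "rm \<le> int q" "int q \<le> rp" "rp \<le> int p + int q" "rm \<le> n3" "n3 \<le> rp"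
    "n1 = int p + 2 * int q - (rp + rm)" "n2 = rp + rm - n3" "J = real_of_int (rp - rm) / 2"
  using assms unfolding gt_labels_def by auto

lemma gt_labelsI:
  "0 \<le> rm \<Longrightarrow> rm \<le> int q \<Longrightarrow> int q \<le> rp \<Longrightarrow> rp \<le> int p + int q \<Longrightarrow> rm \<le> n3 \<Longrightarrow> n3 \<le> rp \<Longrightarrow>
   n1 = int p + 2 * int q - (rp + rm) \<Longrightarrow> n2 = rp + rm - n3 \<Longrightarrow> J = real_of_int (rp - rm) / 2 \<Longrightarrow>
   ((n1, n2, n3), J) \<in> gt_labels (p, q)"
  unfolding gt_labels_def by auto

definition hw_label :: "nat \<times> nat \<Rightarrow> gt_label" where
  "hw_label = (\<lambda>(p, q). ((int p + int q, int q, 0), real q / 2))"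

text \<open>The lowest weight, whose negative is the highest weight of the dual class; it enters
  when the adjoint operation is compared with duality.\<close>

definition lw_label :: "nat \<times> nat \<Rightarrow> gt_label" where
  "lw_label = (\<lambda>(p, q). ((0, int q, int p + int q), real p / 2))"

lemma hw_label_in: "hw_label a \<in> gt_labels a"
  by (cases a) (auto simp: hw_label_def intro!: gt_labelsI[of 0 _ "int (snd a)"])

lemma lw_label_in: "lw_label a \<in> gt_labels a"
  by (cases a) (auto simp: lw_label_def intro!: gt_labelsI[of "int (snd a)" _ "int (fst a) + int (snd a)"])

lemma finite_gt_labels: "finite (gt_labels a)"
proof -
  obtain p q where a: "a = (p, q)" by fastforce
  let ?I = "{0..int p + 2 * int q}"
  have "gt_labels a \<subseteq> (\<lambda>(rm, rp, n3). ((int p + 2 * int q - (rp + rm), rp + rm - n3, n3), real_of_int (rp - rm) / 2))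
      ` (?I \<times> ?I \<times> ?I)"
  proof
    fix l assume "l \<in> gt_labels a"
    moreover obtain n1 n2 n3 J where l: "l = ((n1, n2, n3), J)" by (metis surj_pair)
    ultimately obtain rm rp where "0 \<le> rm" "rm \<le> int q" "int q \<le> rp" "rp \<le> int p + int q" "rm \<le> n3" "n3 \<le> rp"
      "n1 = int p + 2 * int q - (rp + rm)" "n2 = rp + rm - n3" "J = real_of_int (rp - rm) / 2"
      unfolding a by (auto elim: gt_labelsE)
    then show "l \<in> (\<lambda>(rm, rp, n3). ((int p + 2 * int q - (rp + rm), rp + rm - n3, n3), real_of_int (rp - rm) / 2))
        ` (?I \<times> ?I \<times> ?I)"
      unfolding l by (intro image_eqI[of _ _ "(rm, rp, n3)"]) auto
  qed
  then show ?thesis by (rule finite_subset) auto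
qed

lemma gt_label_bounds:
  assumes "((n1, n2, n3), J) \<in> gt_labels (p, q)"
  shows "n1 + n2 + n3 = int p + 2 * int q" "0 \<le> n1" "n1 \<le> int p + int q" "0 \<le> n3" "n3 \<le> int p + int q"
  using assms by (auto elim!: gt_labelsE)

text \<open>The highest weight has multiplicity one: the fixed sum of the entries forces n3 = 0 and
  n2 = q, so r_- = 0 and r_+ = q.\<close>

lemma gt_label_highest:
  assumes "((n1, n2, n3), J) \<in> gt_labels (p, q)" "n1 - n2 = int p" "n2 - n3 = int q"
  shows "((n1, n2, n3), J) = hw_label (p, q)"
  using assms by (auto elim!: gt_labelsE simp: hw_label_def)

lemma dual_label_in: "l \<in> gt_labels a \<Longrightarrow> dual_label a l \<in> gt_labels (dual a)"
proof -
  assume l: "l \<in> gt_labels a"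
  obtain p q n1 n2 n3 J where a: "a = (p, q)" and l': "l = ((n1, n2, n3), J)" by (metis surj_pair)
  from l obtain rm rp where *: "0 \<le> rm" "rm \<le> int q" "int q \<le> rp" "rp \<le> int p + int q" "rm \<le> n3" "n3 \<le> rp"
    "n1 = int p + 2 * int q - (rp + rm)" "n2 = rp + rm - n3" "J = real_of_int (rp - rm) / 2"
    unfolding a l' by (elim gt_labelsE)
  show ?thesis unfolding a l' dual_label_def dual_def prod.case
    by (rule gt_labelsI[of "int p + int q - rp" _ "int p + int q - rm"]) (use * in auto)
qed

lemma dual_dual [simp]: "dual (dual a) = a"
  by (cases a) (simp add: dual_def)

lemma dual_label_dual_label [simp]: "dual_label (dual a) (dual_label a l) = l"
  by (cases a; cases l) (auto simp: dual_def dual_label_def)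

text \<open>If all entries equal c, then 3c = p + 2q and p - q = 3(c - q). Hence |p - q|/3 = |c -
  q|, which is the smallest possible J = r_+ - c, and the constraints on r_- = 2c - r_+ and r_+
  leave min(p, q) + 1 values.\<close>

lemma zero_weight_label:
  assumes "((n1, n2, n3), J) \<in> gt_labels a" "n1 = n2" "n2 = n3"
  shows "\<exists>\<gamma>\<in>{1..m_zero a}. ((n1, n2, n3), J) = zero_label a \<gamma>" "3 dvd int (fst a) + 2 * int (snd a)"
proof -
  obtain p q where a: "a = (p, q)" by fastforce
  from assms(1) obtain rm rp where *: "0 \<le> rm" "rm \<le> int q" "int q \<le> rp" "rp \<le> int p + int q" "rm \<le> n3" "n3 \<le> rp"
    "n1 = int p + 2 * int q - (rp + rm)" "n2 = rp + rm - n3" "J = real_of_int (rp - rm) / 2"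
    unfolding a by (elim gt_labelsE)
  have c: "3 * n3 = int p + 2 * int q" using * assms by linarith
  then show "3 dvd int (fst a) + 2 * int (snd a)" unfolding a by (metis dvd_triv_left fst_conv snd_conv)
  have c': "(int p + 2 * int q) div 3 = n3" using c by linarith
  have J: "J = rp - n3" using * assms by simp
  have d: "\<bar>real p - real q\<bar> / 3 = \<bar>n3 - int q\<bar>"
  proof -
    have "real p - real q = 3 * real_of_int (n3 - int q)" using arg_cong[OF c, of real_of_int] by simp
    then show ?thesis by (simp only: abs_mult) simp
  qed
  define \<gamma> where "\<gamma> = nat (rp - n3 - \<bar>n3 - int q\<bar> + 1)"
  have g: "int \<gamma> = rp - n3 - \<bar>n3 - int q\<bar> + 1" unfolding \<gamma>_def using * assms by auto
  have "\<gamma> \<in> {1..m_zero a}"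
    unfolding a m_zero_def using g c * assms by (auto simp: min_def)
  moreover have "real \<gamma> - 1 + \<bar>n3 - int q\<bar> = rp - n3"
    using arg_cong[OF g, of real_of_int] by simp
  then have "((n1, n2, n3), J) = zero_label a \<gamma>"
    unfolding a zero_label_def using assms c' J d by simp
  ultimately show "\<exists>\<gamma>\<in>{1..m_zero a}. ((n1, n2, n3), J) = zero_label a \<gamma>" by blast
qed

lemma zero_label_in:
  assumes "3 dvd int (fst a) + 2 * int (snd a)" "\<gamma> \<in> {1..m_zero a}"
  shows "zero_label a \<gamma> \<in> gt_labels a"
proof -
  obtain p q where a: "a = (p, q)" by fastforce
  obtain c where c: "int p + 2 * int q = 3 * c" using assms(1) unfolding a by auto
  then have c': "(int p + 2 * int q) div 3 = c" by simp
  have d: "\<bar>real p - real q\<bar> / 3 = \<bar>c - int q\<bar>"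
  proof -
    have "real p - real q = 3 * real_of_int (c - int q)" using arg_cong[OF c, of real_of_int] by simp
    then show ?thesis by (simp only: abs_mult) simp
  qed
  define j where "j = int \<gamma> - 1 + \<bar>c - int q\<bar>"
  have "((c, c, c), real_of_int j) \<in> gt_labels (p, q)"
    by (rule gt_labelsI[of "c - j" _ "c + j"]) (use assms(2) c in \<open>auto simp: j_def a m_zero_def\<close>)
  then show ?thesis unfolding a zero_label_def prod.case Let_def c' d by (simp add: j_def)
qed

lemma zero_label_inj: "zero_label a \<gamma> = zero_label a \<gamma>' \<Longrightarrow> \<gamma> = \<gamma>'"
  by (cases a) (auto simp: zero_label_def Let_def)

lemma chr_zero_label: "h \<in> torus \<Longrightarrow> chr h (fst (zero_label a \<gamma>)) = 1"
proof -
  assume h: "h \<in> torus"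
  have "chr h (c, c, c) = (h $ 1 $ 1 * h $ 2 $ 2 * h $ 3 $ 3) powi c" for c
    by (simp add: chr_def power_int_mult_distrib)
  then show ?thesis
    using torus_entries(1)[OF h] by (cases a) (simp add: zero_label_def Let_def)
qed

lemma dual_label_zero_label:
  assumes "3 dvd int (fst a) + 2 * int (snd a)"
  shows "dual_label a (zero_label a \<gamma>) = zero_label (dual a) \<gamma>"
proof -
  obtain p q where a: "a = (p, q)" by fastforce
  obtain c where c: "int p + 2 * int q = 3 * c" using assms unfolding a by auto
  then have "(int p + 2 * int q) div 3 = c" "(int q + 2 * int p) div 3 = int p + int q - c" by simp_all
  then show ?thesis
    unfolding a zero_label_def dual_label_def dual_def Let_def by (simp add: abs_minus_commute)
qed

section \<open>Representations with a Gelfand-Tsetlin basis\<close>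

lemma onb_rep_gt:
  assumes "unitary_rep R" "gt_basis a R e"
  shows "onb_rep R (gt_labels a) e"
  using assms finite_gt_labels[of a] by (cases a) (unfold_locales, auto simp: gt_basis_def)

text \<open>The matrix which \<open>gt_basis\<close> prescribes for \<open>U_minus\<close>, written
  without reference to a representation so that two realizations of a class can be compared.
  \<open>T_low\<close> does the same for \<open>T_minus\<close>.\<close>

definition U_low :: "gt_label \<Rightarrow> gt_label \<Rightarrow> complex" where
  "U_low k = (\<lambda>((n1, n2, n3), J). let u = real_of_int (n2 - n3) / 2 in
     if k = ((n1, n2 - 1, n3 + 1), J) then of_real (sqrt ((J + u) * (J - u + 1))) else 0)"

definition T_low :: "nat \<times> nat \<Rightarrow> gt_label \<Rightarrow> gt_label \<Rightarrow> complex" where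
  "T_low = (\<lambda>(p, q) k ((n1, n2, n3), J).
     let u = real_of_int (n2 - n3) / 2; P = real p; Q = real q; N = real_of_int n3 in
     (if k = ((n1 - 1, n2 + 1, n3), J - 1/2) then
        of_real (sqrt ((J - u) * (P + Q + J - u - N + 1) * (Q + J - u - N) * (u - J + N + 1)
                         / (2 * J * (2 * J + 1)))) else 0) +
     (if k = ((n1 - 1, n2 + 1, n3), J + 1/2) then
        of_real (sqrt ((J + u + 1) * (P + Q - J - u - N) * (J + u + 1 + N - Q) * (J + u + 2 + N)
                         / (2 * (J + 1) * (2 * J + 1)))) else 0))"

text \<open>Outside \<open>gt_labels\<close> the family \<open>e\<close> is arbitrary, so the
  coefficient must vanish when the target label leaves the pattern. This happens only for n3 = r_+,
  and J + u = r_+ - n3.\<close>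

lemma gt_U_boundary:
  assumes l: "((n1, n2, n3), J) \<in> gt_labels (p, q)" and u: "u = real_of_int (n2 - n3) / 2"
    and "((n1, n2 - 1, n3 + 1), J) \<notin> gt_labels (p, q)"
  shows "(J + u) * (J - u + 1) = 0"
proof -
  from l obtain rm rp where *: "0 \<le> rm" "rm \<le> int q" "int q \<le> rp" "rp \<le> int p + int q" "rm \<le> n3" "n3 \<le> rp"
    "n1 = int p + 2 * int q - (rp + rm)" "n2 = rp + rm - n3" "J = real_of_int (rp - rm) / 2"
    by (elim gt_labelsE)
  have "n3 = rp"
  proof (rule ccontr)
    assume "n3 \<noteq> rp"
    then have "((n1, n2 - 1, n3 + 1), J) \<in> gt_labels (p, q)"
      by (intro gt_labelsI[of rm _ rp]) (use * in auto)
    with assms(3) show False by simp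
  qed
  moreover have "J + u = real_of_int (rp - n3)" using * u by (simp add: field_simps)
  ultimately show ?thesis by simp
qed

text \<open>Passing to J - 1/2 raises r_-, which is blocked only by n3 = r_- or r_- = q; the factors
  are n3 - r_- and q - r_-. Passing to J + 1/2 raises r_+, blocked only by r_+ = p + q; the factor
  is p + q - r_+.\<close>

lemma gt_T_boundary:
  assumes l: "((n1, n2, n3), J) \<in> gt_labels (p, q)" and u: "u = real_of_int (n2 - n3) / 2"
  shows "((n1 - 1, n2 + 1, n3), J - 1/2) \<notin> gt_labels (p, q) \<Longrightarrow> (J - u) * (real q + J - u - real_of_int n3) = 0"
    and "((n1 - 1, n2 + 1, n3), J + 1/2) \<notin> gt_labels (p, q) \<Longrightarrow> real p + real q - J - u - real_of_int n3 = 0"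
proof -
  from l obtain rm rp where *: "0 \<le> rm" "rm \<le> int q" "int q \<le> rp" "rp \<le> int p + int q" "rm \<le> n3" "n3 \<le> rp"
    "n1 = int p + 2 * int q - (rp + rm)" "n2 = rp + rm - n3" "J = real_of_int (rp - rm) / 2"
    by (elim gt_labelsE)
  show "(J - u) * (real q + J - u - real_of_int n3) = 0"
    if "((n1 - 1, n2 + 1, n3), J - 1/2) \<notin> gt_labels (p, q)"
  proof -
    have "n3 = rm \<or> rm = int q"
    proof (rule ccontr)
      assume "\<not> (n3 = rm \<or> rm = int q)"
      then have "((n1 - 1, n2 + 1, n3), J - 1/2) \<in> gt_labels (p, q)"
        by (intro gt_labelsI[of "rm + 1" _ rp]) (use * in \<open>auto simp: field_simps\<close>)
      with that show False by simp
    qed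
    moreover have "J - u = real_of_int (n3 - rm)" using * u by (simp add: field_simps)
    ultimately show ?thesis by auto
  qed
  show "real p + real q - J - u - real_of_int n3 = 0"
    if "((n1 - 1, n2 + 1, n3), J + 1/2) \<notin> gt_labels (p, q)"
  proof -
    have "rp = int p + int q"
    proof (rule ccontr)
      assume "\<not> rp = int p + int q"
      then have "((n1 - 1, n2 + 1, n3), J + 1/2) \<in> gt_labels (p, q)"
        by (intro gt_labelsI[of rm _ "rp + 1"]) (use * in \<open>auto simp: field_simps\<close>)
      with that show False by simp
    qed
    then show ?thesis using * u by (simp add: field_simps)
  qed
qed

lemma gt_root_mat:
  assumes R: "unitary_rep R" and gt: "gt_basis a R e" and kl: "k \<in> gt_labels a" "l \<in> gt_labels a"
  shows "onb_rep.root_mat R e 3 2 k l = U_low k l" and "onb_rep.root_mat R e 2 1 k l = T_low a k l"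
proof -
  interpret onb_rep R "gt_labels a" e using R gt by (rule onb_rep_gt)
  obtain p q n1 n2 n3 J where a: "a = (p, q)" and l: "l = ((n1, n2, n3), J)" by (metis surj_pair)
  define u where "u = real_of_int (n2 - n3) / 2"
  have lab: "((n1, n2, n3), J) \<in> gt_labels (p, q)" using kl a l by simp
  \<comment> \<open>This includes labels outside \<open>gt_labels\<close>, where nothing is known
    about \<open>e l'\<close> but the coefficient is zero.\<close>
  have coeff: "ip R (e k) (c *\<^sub>C e l') = (if k = l' then c else 0)" "c *\<^sub>C e l' \<in> carr R"
    if "l' \<notin> gt_labels a \<Longrightarrow> c = 0" for c l'
    using that kl by (cases "l' \<in> gt_labels a"; auto simp: ip_scale_right e_carr e_orth ip_zero_right carr_0 carr_scale)+
  have low: "U_minus R (e l) = of_real (sqrt ((J + u) * (J - u + 1))) *\<^sub>C e ((n1, n2 - 1, n3 + 1), J)"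
    "T_minus R (e l) =
           of_real (sqrt ((J - u) * (real p + real q + J - u - n3 + 1) * (real q + J - u - n3) * (u - J + n3 + 1)
                            / (2 * J * (2 * J + 1))))
             *\<^sub>C e ((n1 - 1, n2 + 1, n3), J - 1/2) +
           of_real (sqrt ((J + u + 1) * (real p + real q - J - u - n3) * (J + u + 1 + n3 - real q) * (J + u + 2 + n3)
                            / (2 * (J + 1) * (2 * J + 1))))
             *\<^sub>C e ((n1 - 1, n2 + 1, n3), J + 1/2)"
    using gt kl(2) unfolding a l gt_basis_def u_def Let_def prod.case by blast+
  show "root_mat 3 2 k l = U_low k l"
    unfolding root_mat_def using low(1) unfolding U_minus_def
    by (simp only:, subst coeff(1)) (use gt_U_boundary[OF lab u_def] in \<open>auto simp: a l U_low_def u_def Let_def\<close>)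
  define c1 c2 where
    "c1 = complex_of_real (sqrt ((J - u) * (real p + real q + J - u - n3 + 1) * (real q + J - u - n3) * (u - J + n3 + 1)
                            / (2 * J * (2 * J + 1))))"
    and "c2 = complex_of_real (sqrt ((J + u + 1) * (real p + real q - J - u - n3) * (J + u + 1 + n3 - real q) * (J + u + 2 + n3)
                            / (2 * (J + 1) * (2 * J + 1))))"
  let ?l1 = "((n1 - 1, n2 + 1, n3), J - 1/2)" and ?l2 = "((n1 - 1, n2 + 1, n3), J + 1/2)"
  have z: "?l1 \<notin> gt_labels a \<Longrightarrow> c1 = 0" "?l2 \<notin> gt_labels a \<Longrightarrow> c2 = 0"
    using gt_T_boundary[OF lab u_def] unfolding a c1_def c2_def by auto
  have "root_mat 2 1 k l = ip R (e k) (c1 *\<^sub>C e ?l1 + c2 *\<^sub>C e ?l2)"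
    unfolding root_mat_def c1_def c2_def using low(2) unfolding T_minus_def by (simp only:)
  also have "\<dots> = (if k = ?l1 then c1 else 0) + (if k = ?l2 then c2 else 0)"
  proof -
    have i: "ip R (e k) (c1 *\<^sub>C e ?l1) = (if k = ?l1 then c1 else 0)" "c1 *\<^sub>C e ?l1 \<in> carr R"
      "ip R (e k) (c2 *\<^sub>C e ?l2) = (if k = ?l2 then c2 else 0)" "c2 *\<^sub>C e ?l2 \<in> carr R"
      by (rule coeff, erule z)+
    show ?thesis unfolding ip_add_right[OF e_carr[OF kl(1)] i(2,4)] i(1,3) ..
  qed
  also have "\<dots> = T_low a k l"
    unfolding a l T_low_def c1_def c2_def u_def Let_def prod.case ..
  finally show "root_mat 2 1 k l = T_low a k l" .
qed

lemma U_low_nonzero: "U_low k l \<noteq> 0 \<Longrightarrow> \<exists>n1 n2 n3. fst l = (n1, n2, n3) \<and> fst k = (n1, n2 - 1, n3 + 1)"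
  by (cases l) (auto simp: U_low_def Let_def split: if_splits)

lemma T_low_nonzero: "T_low a k l \<noteq> 0 \<Longrightarrow> \<exists>n1 n2 n3. fst l = (n1, n2, n3) \<and> fst k = (n1 - 1, n2 + 1, n3)"
  by (cases l; cases a) (auto simp: T_low_def Let_def split: if_splits)

lemma gt_mc_eq:
  assumes "unitary_rep R" "gt_basis a R e" "unitary_rep R'" "gt_basis a R' e'"
    and "g \<in> SU3" "k \<in> gt_labels a" "l \<in> gt_labels a"
  shows "ip R (e k) (act R g (e l)) = ip R' (e' k) (act R' g (e' l))"
  using mc_eq_if_lowering_eq[OF onb_rep_gt[OF assms(1,2)] onb_rep_gt[OF assms(3,4)] _ _ assms(5-7)]
  by (simp add: gt_root_mat[OF assms(1,2)] gt_root_mat[OF assms(3,4)]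
      onb_rep.mc_def[OF onb_rep_gt[OF assms(1,2)]] onb_rep.mc_def[OF onb_rep_gt[OF assms(3,4)]])

text \<open>Equal matrix coefficients make the map e(l) to e'(l) equivariant. Its fixed vectors form
  an invariant subspace containing e(l0), hence everything.\<close>

lemma onb_eq_if_mc_eq:
  assumes "onb_rep R L e" "onb_rep R L e'" and irr: "irreducible_rep R"
    and mc: "\<And>g k l. g \<in> SU3 \<Longrightarrow> k \<in> L \<Longrightarrow> l \<in> L \<Longrightarrow> onb_rep.mc R e k l g = onb_rep.mc R e' k l g"
    and l0: "l0 \<in> L" "e l0 = e' l0" and l: "l \<in> L"
  shows "e l = e' l"
proof -
  interpret A: onb_rep R L e by fact
  interpret B: onb_rep R L e' by fact
  define Q where "Q = (\<lambda>x. \<Sum>l\<in>L. ip R (e l) x *\<^sub>C e' l)"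
  have Qe: "Q (e l) = e' l" if "l \<in> L" for l
    using that A.finL by (simp add: Q_def A.e_orth if_distrib[of "\<lambda>c. c *\<^sub>C _"] cong: if_cong)
  have Q_act: "Q (act R g x) = act R g (Q x)" if g: "g \<in> SU3" and x: "x \<in> carr R" for g x
  proof -
    have "Q (act R g x) = (\<Sum>k\<in>L. \<Sum>l\<in>L. (A.mc k l g * ip R (e l) x) *\<^sub>C e' k)"
      unfolding Q_def using g x by (simp add: A.ip_act complex_vector.scale_sum_left)
    also have "\<dots> = (\<Sum>l\<in>L. \<Sum>k\<in>L. (A.mc k l g * ip R (e l) x) *\<^sub>C e' k)" by (rule sum.swap)
    also have "\<dots> = (\<Sum>l\<in>L. ip R (e l) x *\<^sub>C act R g (e' l))"
      using g by (intro sum.cong refl) (simp add: B.act_e mc complex_vector.scale_sum_right mult.commute)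
    also have "\<dots> = act R g (Q x)"
      unfolding Q_def using g by (simp add: A.act_sum A.carr_scale B.e_carr A.act_scale)
    finally show ?thesis .
  qed
  define N where "N = {x \<in> carr R. Q x = x}"
  have "Q (x + y) = Q x + Q y" if "x \<in> carr R" "y \<in> carr R" for x y
    using that by (simp add: Q_def A.ip_add_right A.e_carr complex_vector.scale_left_distrib sum.distrib)
  moreover have "Q (c *\<^sub>C x) = c *\<^sub>C Q x" if "x \<in> carr R" for c x
    using that by (simp add: Q_def A.ip_scale_right A.e_carr complex_vector.scale_sum_right)
  moreover have "Q 0 = 0" by (simp add: Q_def A.ip_zero_right A.e_carr)
  ultimately have "complex_vector.subspace N"
    by (intro complex_vector.subspaceI) (auto simp: N_def A.carr_0 A.carr_add A.carr_scale)
  moreover have "\<forall>g\<in>SU3. \<forall>x\<in>N. act R g x \<in> N" by (auto simp: N_def A.act_carr Q_act)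
  moreover have "e l0 \<in> N" using l0 A.e_carr[OF l0(1)] Qe[OF l0(1)] by (simp add: N_def)
  moreover have "e l0 \<noteq> 0" using A.e_orth[OF l0(1) l0(1)] A.ip_zero_right[OF A.e_carr[OF l0(1)]] by auto
  ultimately have "N = carr R" using irr unfolding irreducible_rep_def N_def by blast
  then have "e l \<in> N" using l A.e_carr by simp
  then show ?thesis using Qe[OF l] by (simp add: N_def)
qed

context unitary_mat
begin

text \<open>The family e' obtained by applying h and removing the expected phases has the same
  lowering matrices as e: conjugating a root vector by h produces a phase that cancels the
  difference of the two weights wherever the matrix entry is nonzero. It also agrees with e at the
  highest weight, so the two coincide.\<close>

lemma torus_gt:
  assumes irr: "irrep a R" and gt: "gt_basis a R e" and act: "act R = op_act \<rho>"
    and h: "h \<in> torus" and l: "l \<in> gt_labels a"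
  shows "act R h (e l) = chr h (fst l) *\<^sub>C e l"
proof -
  have R: "unitary_rep R" "irreducible_rep R" using irr by (auto simp: irrep_def)
  interpret A: onb_rep R "gt_labels a" e using R(1) gt by (rule onb_rep_gt)
  have hS: "h \<in> SU3" using h by (rule torus_SU3)
  define e' where "e' = (\<lambda>l. cnj (chr h (fst l)) *\<^sub>C act R h (e l))"
  have act_e': "act R h (e l) = chr h (fst l) *\<^sub>C e' l" for l
    using chr_cnj_mult[OF h, of "fst l"] by (simp add: e'_def mult.commute)
  have e'_carr: "e' l \<in> carr R" if "l \<in> gt_labels a" for l
    using that hS by (simp add: e'_def A.carr_scale A.act_carr A.e_carr)
  have ip_scale_left: "ip R (c *\<^sub>C x) y = cnj c * ip R x y" if "x \<in> carr R" "y \<in> carr R" for c x y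
    using that A.ip_cnj[of y "c *\<^sub>C x"] A.ip_cnj[of y x] by (simp add: A.carr_scale A.ip_scale_right)
  have ip_e': "ip R (e' k) (c *\<^sub>C act R h y) = chr h (fst k) * c * ip R (e k) y"
    if "k \<in> gt_labels a" "y \<in> carr R" for k y c
    using that hS by (simp add: e'_def ip_scale_left A.carr_scale A.act_carr A.e_carr A.ip_scale_right A.act_ip)
  interpret B: onb_rep R "gt_labels a" e'
  proof
    show "ip R (e' l) (e' l') = (if l = l' then 1 else 0)" if "l \<in> gt_labels a" "l' \<in> gt_labels a" for l l'
      using that ip_e'[of l "e l'" "cnj (chr h (fst l'))"] chr_cnj_mult[OF h]
      by (auto simp: e'_def A.e_carr A.e_orth mult.commute)
    have "x \<in> complex_vector.span (e' ` gt_labels a)" if x: "x \<in> carr R" for x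
    proof -
      let ?y = "act R (dagger h) x"
      have y: "?y \<in> carr R" using x hS by (simp add: A.act_carr SU3_dagger)
      have "x = act R h ?y"
        using x hS A.act_mult[of h "dagger h" x] by (simp add: SU3_dagger SU3_dagger_right A.act_one)
      also have "\<dots> = act R h (\<Sum>l\<in>gt_labels a. ip R (e l) ?y *\<^sub>C e l)"
        using A.expand[OF y] by simp
      also have "\<dots> = (\<Sum>l\<in>gt_labels a. (ip R (e l) ?y * chr h (fst l)) *\<^sub>C e' l)"
        using hS by (simp add: A.act_sum A.carr_scale A.e_carr A.act_scale act_e')
      finally have "x = \<dots>" .
      then show ?thesis
        by (metis (no_types, lifting) complex_vector.span_base complex_vector.span_scale complex_vector.span_sum imageI)
    qed
    moreover have "complex_vector.span (e' ` gt_labels a) \<subseteq> carr R"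
      using e'_carr A.subspace_carr by (intro complex_vector.span_minimal) auto
    ultimately show "complex_vector.span (e' ` gt_labels a) = carr R" by blast
  qed (use R A.finL e'_carr in auto)
  \<comment> \<open>Conjugation by the torus scales root vectors: the inverse of h times E_ij times
    h is cnj(h_ii) h_jj E_ij.\<close>
  have conj: "sl3_act R (unit_mat i j) (act R h y) = (cnj (h $ i $ i) * h $ j $ j) *\<^sub>C act R h (sl3_act R (unit_mat i j) y)"
    if "i \<noteq> j" for i j y
  proof -
    have "dagger h ** unit_mat i j ** h = (cnj (h $ i $ i) * h $ j $ j) *\<^sub>C unit_mat i j"
    proof -
      have off: "h $ k $ m = 0" if "k \<noteq> m" for k m using h that by (simp add: torus_def)
      have e1: "(dagger h ** unit_mat i j) $ k $ m = (if k = i \<and> m = j then cnj (h $ i $ i) else 0)" for k m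
        using off[of i k] by (auto simp: matrix_matrix_mult_def if_distrib[of "\<lambda>x. _ * x"] cong: if_cong)
      have "(dagger h ** unit_mat i j ** h) $ k $ m = ((cnj (h $ i $ i) * h $ j $ j) *\<^sub>C unit_mat i j) $ k $ m" for k m
        unfolding matrix_matrix_mult_def[of "dagger h ** unit_mat i j"] vec_lambda_beta e1
        using off[of j m] by (auto simp: if_distrib[of "\<lambda>x. x * _"] cong: if_cong)
      then show ?thesis by (simp add: vec_eq_iff)
    qed
    then have D: "dagger (\<rho> h) ** Drho (unit_mat i j) ** \<rho> h = (cnj (h $ i $ i) * h $ j $ j) *\<^sub>C Drho (unit_mat i j)"
      using Drho_conj[OF SU3_dagger[OF hS], of "unit_mat i j"] that
      by (simp add: trace_unit_mat rho_dagger[OF hS] Drho_scaleC)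
    let ?D = "Drho (unit_mat i j)"
    have "?D ** \<rho> h = \<rho> h ** (dagger (\<rho> h) ** ?D ** \<rho> h)"
      "dagger (\<rho> h) ** ?D = (dagger (\<rho> h) ** ?D ** \<rho> h) ** dagger (\<rho> h)"
      using rho_unitary(2)[OF hS] by (simp_all add: matrix_mul_assoc) (simp add: matrix_mul_assoc[symmetric])
    then have D': "?D ** \<rho> h = (cnj (h $ i $ i) * h $ j $ j) *\<^sub>C (\<rho> h ** ?D)"
      "dagger (\<rho> h) ** ?D = (cnj (h $ i $ i) * h $ j $ j) *\<^sub>C (?D ** dagger (\<rho> h))"
      unfolding D by simp_all
    have "sl3_act R (unit_mat i j) (act R h y) = (?D ** \<rho> h) ** y ** dagger (\<rho> h) - \<rho> h ** y ** (dagger (\<rho> h) ** ?D)"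
      using that hS by (simp add: sl3_act_op[OF _ act] trace_unit_mat act op_act_eq matrix_mul_assoc)
    also have "\<dots> = (cnj (h $ i $ i) * h $ j $ j) *\<^sub>C act R h (sl3_act R (unit_mat i j) y)"
      unfolding D' using that hS
      by (simp add: sl3_act_op[OF _ act] trace_unit_mat act op_act_eq matrix_mul_assoc matrix_diff_left matrix_diff_right
          complex_vector.scale_right_diff_distrib)
    finally show ?thesis .
  qed
  have sl3_scale: "sl3_act R (unit_mat i j) (c *\<^sub>C y) = c *\<^sub>C sl3_act R (unit_mat i j) y" if "i \<noteq> j" for i j c y
    using that by (simp add: sl3_act_op[OF _ act] trace_unit_mat complex_vector.scale_right_diff_distrib)
  have root: "B.root_mat i j k l = (chr h (fst k) * (cnj (chr h (fst l)) * (cnj (h $ i $ i) * h $ j $ j))) * A.root_mat i j k l"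
    if "i \<noteq> j" "k \<in> gt_labels a" "l \<in> gt_labels a" for i j k l
  proof -
    have "sl3_act R (unit_mat i j) (e' l)
        = (cnj (chr h (fst l)) * (cnj (h $ i $ i) * h $ j $ j)) *\<^sub>C act R h (sl3_act R (unit_mat i j) (e l))"
      using that by (simp add: e'_def sl3_scale conj)
    then show ?thesis
      unfolding B.root_mat_def A.root_mat_def using that by (simp add: ip_e' A.sl3_act_carr A.e_carr)
  qed
  have unit: "cnj (h $ i $ i) = inverse (h $ i $ i)" "h $ i $ i \<noteq> 0" for i
    using torus_entries(2)[OF h, of i] by (auto simp: cnj_eq_inverse)
  have "B.mc k l g = A.mc k l g" if "g \<in> SU3" "k \<in> gt_labels a" "l \<in> gt_labels a" for g k l
  proof (rule mc_eq_if_lowering_eq[OF B.onb_rep_axioms A.onb_rep_axioms _ _ that])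
    fix k l assume kl: "k \<in> gt_labels a" "l \<in> gt_labels a"
    show "B.root_mat 2 1 k l = A.root_mat 2 1 k l"
    proof (cases "A.root_mat 2 1 k l = 0")
      case False
      then obtain n1 n2 n3 where n: "fst l = (n1, n2, n3)" "fst k = (n1 - 1, n2 + 1, n3)"
        using T_low_nonzero gt_root_mat(2)[OF R(1) gt kl] by metis
      have "chr h (fst k) * (cnj (h $ 2 $ 2) * h $ 1 $ 1) = chr h (fst l)"
        unfolding n chr_def prod.case unit(1) by (simp add: power_int_diff power_int_add unit(2))
      then have "chr h (fst k) * (cnj (chr h (fst l)) * (cnj (h $ 2 $ 2) * h $ 1 $ 1)) = 1"
        unfolding mult.left_commute[of "chr h (fst k)"] using chr_cnj_mult[OF h, of "fst l"] by (simp only:)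
      then show ?thesis using kl by (simp add: root)
    qed (use kl in \<open>simp add: root\<close>)
    show "B.root_mat 3 2 k l = A.root_mat 3 2 k l"
    proof (cases "A.root_mat 3 2 k l = 0")
      case False
      then obtain n1 n2 n3 where n: "fst l = (n1, n2, n3)" "fst k = (n1, n2 - 1, n3 + 1)"
        using U_low_nonzero gt_root_mat(1)[OF R(1) gt kl] by metis
      have "chr h (fst k) * (cnj (h $ 3 $ 3) * h $ 2 $ 2) = chr h (fst l)"
        unfolding n chr_def prod.case unit(1) by (simp add: power_int_diff power_int_add unit(2))
      then have "chr h (fst k) * (cnj (chr h (fst l)) * (cnj (h $ 3 $ 3) * h $ 2 $ 2)) = 1"
        unfolding mult.left_commute[of "chr h (fst k)"] using chr_cnj_mult[OF h, of "fst l"] by (simp only:)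
      then show ?thesis using kl by (simp add: root)
    qed (use kl in \<open>simp add: root\<close>)
  qed
  moreover have "e' (hw_label a) = e (hw_label a)"
  proof -
    obtain p q where a: "a = (p, q)" by fastforce
    have "highest_weight_vector (p, q) R (e (hw_label a))"
      using gt unfolding a gt_basis_def hw_label_def by simp
    from A.torus_highest_weight[OF this h]
    have "act R h (e (hw_label a)) = chr h (fst (hw_label a)) *\<^sub>C e (hw_label a)"
      by (simp add: a hw_label_def)
    then show ?thesis using chr_cnj_mult[OF h] by (simp add: e'_def)
  qed
  ultimately have "e' l = e l"
    using onb_eq_if_mc_eq[OF B.onb_rep_axioms A.onb_rep_axioms R(2) _ hw_label_in _ l] by blast
  then show ?thesis using act_e'[of l] by simp
qed

end

section \<open>Ranks\<close>

lemma sum_fun_apply: "(\<Sum>a\<in>A. f a) x = (\<Sum>a\<in>A. f a x)" for f :: "'a \<Rightarrow> 'b \<Rightarrow> 'c::comm_monoid_add"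
  by (induction A rule: infinite_finite_induct) simp_all

text \<open>The order of the matrix is given by numbers and not by types, so columns are viewed as
  functions on \<open>nat\<close> supported in \<open>{1..m}\<close>. They lie in the span of m unit
  functions, and the exchange lemma applies.\<close>

lemma columns_independent_le:
  assumes "columns_independent m C {1..n}"
  shows "n \<le> m"
proof -
  interpret F: vector_space "\<lambda>(c::complex) (f::nat \<Rightarrow> complex) i. c * f i"
    by unfold_locales (auto simp: fun_eq_iff algebra_simps)
  define col where "col = (\<lambda>s i. if i \<in> {1..m} then C i s else 0)"
  define unit where "unit = (\<lambda>j i :: nat. if i = j then 1 else 0 :: complex)"
  have sum_col: "(\<Sum>s\<in>{1..n}. (\<lambda>i. x s * col s i)) i = (if i \<in> {1..m} then \<Sum>s\<in>{1..n}. x s * C i s else 0)" for x i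
    by (auto simp: col_def sum_fun_apply)
  have ind: "\<And>s. s \<in> {1..n} \<Longrightarrow> x s = 0" if "(\<Sum>s\<in>{1..n}. (\<lambda>i. x s * col s i)) = 0" for x
  proof -
    have "(\<Sum>s\<in>{1..n}. x s * C i s) = 0" if "i \<in> {1..m}" for i
      using fun_cong[OF \<open>(\<Sum>s\<in>{1..n}. (\<lambda>i. x s * col s i)) = 0\<close>, of i] that unfolding sum_col by simp
    then show "x s = 0" if "s \<in> {1..n}" for s
      using assms that unfolding columns_independent_def by blast
  qed
  have inj: "inj_on col {1..n}"
  proof (rule inj_onI, rule ccontr)
    fix s t assume st: "s \<in> {1..n}" "t \<in> {1..n}" "col s = col t" "s \<noteq> t"
    define x where "x = (\<lambda>r. if r = s then 1 else if r = t then - 1 else 0 :: complex)"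
    have "(\<Sum>r\<in>{1..n}. x r * col r i) = 0" for i
    proof -
      have "(\<Sum>r\<in>{1..n}. x r * col r i) = (\<Sum>r\<in>{s, t}. x r * col r i)"
        using st by (intro sum.mono_neutral_right) (auto simp: x_def)
      then show ?thesis using st by (simp add: x_def)
    qed
    then have "(\<Sum>r\<in>{1..n}. (\<lambda>i. x r * col r i)) = 0" by (simp add: fun_eq_iff sum_fun_apply)
    from ind[OF this st(1)] show False by (simp add: x_def)
  qed
  have "F.independent (col ` {1..n})"
    unfolding F.independent_explicit_finite_subsets
  proof (intro allI impI ballI)
    fix S u w assume S: "S \<subseteq> col ` {1..n}" "finite S" "(\<Sum>w\<in>S. (\<lambda>i. u w * w i)) = 0" "w \<in> S"
    define x where "x = (\<lambda>s. if col s \<in> S then u (col s) else 0)"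
    have "(\<Sum>s\<in>{1..n}. (\<lambda>i. x s * col s i)) = (\<Sum>w\<in>col ` {1..n}. (\<lambda>i. (if w \<in> S then u w else 0) * w i))"
      unfolding sum.reindex[OF inj] o_def x_def ..
    also have "\<dots> = (\<Sum>w\<in>S. (\<lambda>i. u w * w i))"
      using S by (intro sum.mono_neutral_cong_right) (auto simp: fun_eq_iff)
    finally have "(\<Sum>s\<in>{1..n}. (\<lambda>i. x s * col s i)) = 0" using S by simp
    note x0 = ind[OF this]
    obtain s where "s \<in> {1..n}" "w = col s" using S by blast
    then show "u w = 0" using x0[of s] S(4) by (simp add: x_def)
  qed
  moreover have "col ` {1..n} \<subseteq> F.span (unit ` {1..m})"
  proof
    fix w assume "w \<in> col ` {1..n}"
    then obtain s where w: "w = col s" by blast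
    have "w = (\<Sum>j\<in>{1..m}. (\<lambda>i. C j s * unit j i))"
    proof
      fix i show "w i = (\<Sum>j\<in>{1..m}. (\<lambda>i. C j s * unit j i)) i"
        by (simp add: w col_def unit_def sum_fun_apply if_distrib[of "\<lambda>x. _ * x"] cong: if_cong)
    qed
    then show "w \<in> F.span (unit ` {1..m})"
      by (simp only:) (intro F.span_sum F.span_scale F.span_base imageI)
  qed
  ultimately have "card (col ` {1..n}) \<le> card (unit ` {1..m})"
    using F.independent_span_bound by blast
  also have "\<dots> \<le> m" using card_image_le[of "{1..m}" unit] by simp
  finally show ?thesis using card_image[OF inj] by simp
qed

text \<open>With no more columns than rows, full rank is attained only by the set of all
  columns.\<close>

lemma full_rank_iff:
  assumes "n \<le> m"
  shows "full_rank m n C \<longleftrightarrow> columns_independent m C {1..n}"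
proof -
  let ?A = "{card S |S. S \<subseteq> {1..n} \<and> columns_independent m C S}"
  have fin: "finite ?A" by (rule finite_subset[of _ "card ` Pow {1..n}"]) auto
  have ne: "?A \<noteq> {}" by (auto simp: columns_independent_def intro!: exI[of _ "{}"])
  have le: "k \<le> n" if "k \<in> ?A" for k using that card_mono[of "{1..n}"] by fastforce
  show ?thesis
  proof
    assume "full_rank m n C"
    then have "Max ?A = n" using assms by (simp add: full_rank_def matrix_rank_def)
    then obtain S where "S \<subseteq> {1..n}" "columns_independent m C S" "card S = n" using Max_in[OF fin ne] by auto
    then show "columns_independent m C {1..n}" using card_subset_eq[of "{1..n}" S] by simp
  next
    assume "columns_independent m C {1..n}"
    then have "n \<in> ?A" by (intro CollectI exI[of _ "{1..n}"]) simp
    from Max_eqI[OF fin le this] have "Max ?A = n" .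
    then show "full_rank m n C" using assms by (simp add: full_rank_def matrix_rank_def)
  qed
qed

section \<open>The decomposition of the operator space\<close>

definition mip :: "complex ^ 'n ^ 'n \<Rightarrow> complex ^ 'n ^ 'n \<Rightarrow> complex" where
  "mip A B = trace (dagger A ** B)"

lemma mip_add_right: "mip A (B + C) = mip A B + mip A C"
  and mip_diff_right: "mip A (B - C) = mip A B - mip A C"
  and mip_scale_right: "mip A (c *\<^sub>C B) = c * mip A B"
  and mip_zero_right [simp]: "mip A 0 = 0"
  and mip_add_left: "mip (A + B) C = mip A C + mip B C"
  and mip_scale_left: "mip (c *\<^sub>C A) B = cnj c * mip A B"
  and mip_zero_left [simp]: "mip 0 A = 0"
  by (simp_all add: mip_def matrix_add_ldistrib matrix_add_distrib_right matrix_diff_right trace_add trace_sub trace_scaleC)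
    (simp_all add: trace_def)

lemma mip_cnj: "cnj (mip A B) = mip B A"
  by (simp add: mip_def flip: trace_dagger)

lemma mip_dagger: "mip (dagger A) (dagger B) = mip B A"
  unfolding mip_def dagger_dagger by (rule trace_mul_sym)

lemma mip_sum_right: "mip A (\<Sum>i\<in>I. f i) = (\<Sum>i\<in>I. mip A (f i))"
  by (induction I rule: infinite_finite_induct) (simp_all add: mip_add_right)

lemma mip_sum_left: "mip (\<Sum>i\<in>I. f i) A = (\<Sum>i\<in>I. mip (f i) A)"
  by (induction I rule: infinite_finite_induct) (simp_all add: mip_add_left)

lemma inner_mip: "inner A B = Re (mip A B)"
  by (simp add: inner_trace mip_def)

lemma mip_self_eq_0: "mip A A = 0 \<longleftrightarrow> A = 0"
  by (metis inner_eq_zero_iff inner_mip mip_zero_left zero_complex.sel(1))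

lemma op_rep_simps [simp]:
  "ip (restrict_rep (op_rep \<rho>) N) = mip" "act (restrict_rep (op_rep \<rho>) N) = op_act \<rho>"
  "carr (restrict_rep (op_rep \<rho>) N) = N" "ip (op_rep \<rho>) = mip"
  by (auto simp: restrict_rep_def op_rep_def mip_def fun_eq_iff)

context unitary_mat
begin

lemma op_act_add: "g \<in> SU3 \<Longrightarrow> op_act \<rho> g (A + B) = op_act \<rho> g A + op_act \<rho> g B"
  and op_act_scale: "g \<in> SU3 \<Longrightarrow> op_act \<rho> g (c *\<^sub>C A) = c *\<^sub>C op_act \<rho> g A"
  and op_act_mult: "g \<in> SU3 \<Longrightarrow> h \<in> SU3 \<Longrightarrow> op_act \<rho> (g ** h) A = op_act \<rho> g (op_act \<rho> h A)"
  and op_act_one: "op_act \<rho> (mat 1) A = A"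
  and op_act_dagger: "g \<in> SU3 \<Longrightarrow> op_act \<rho> g (dagger A) = dagger (op_act \<rho> g A)"
  by (simp_all add: op_act_eq SU3_mult matrix_add_ldistrib matrix_add_distrib_right rho_mult rho_one matrix_mul_assoc)

lemma op_act_diff: "g \<in> SU3 \<Longrightarrow> op_act \<rho> g (A - B) = op_act \<rho> g A - op_act \<rho> g B"
  by (simp add: op_act_eq matrix_diff_left matrix_diff_right)

lemma op_act_zero [simp]: "op_act \<rho> g 0 = 0"
  by (simp add: op_act_def)

lemma op_act_sum: "g \<in> SU3 \<Longrightarrow> op_act \<rho> g (\<Sum>i\<in>I. f i) = (\<Sum>i\<in>I. op_act \<rho> g (f i))"
  by (induction I rule: infinite_finite_induct) (simp_all add: op_act_add)

lemma op_act_inverse: "g \<in> SU3 \<Longrightarrow> op_act \<rho> g (op_act \<rho> (dagger g) A) = A"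
  "g \<in> SU3 \<Longrightarrow> op_act \<rho> (dagger g) (op_act \<rho> g A) = A"
  by (simp_all add: op_act_mult[symmetric] SU3_dagger SU3_dagger_left SU3_dagger_right op_act_one)

lemma trace_op_act: "g \<in> SU3 \<Longrightarrow> trace (op_act \<rho> g A) = trace A"
  using trace_mul_sym[of "\<rho> g ** A" "dagger (\<rho> g)"] rho_unitary(1)[of g]
  by (simp add: op_act_eq matrix_mul_assoc)

lemma trace_op_act_mult: "g \<in> SU3 \<Longrightarrow> trace (op_act \<rho> g A ** op_act \<rho> g B) = trace (A ** B)"
proof -
  assume g: "g \<in> SU3"
  have "op_act \<rho> g A ** op_act \<rho> g B = \<rho> g ** A ** (dagger (\<rho> g) ** \<rho> g) ** B ** dagger (\<rho> g)"
    using g by (simp add: op_act_eq matrix_mul_assoc)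
  also have "\<dots> = op_act \<rho> g (A ** B)"
    using g by (simp add: op_act_eq rho_unitary matrix_mul_assoc)
  finally show ?thesis using g by (simp add: trace_op_act)
qed

lemma mip_op_act: "g \<in> SU3 \<Longrightarrow> mip (op_act \<rho> g A) (op_act \<rho> g B) = mip A B"
  by (simp add: mip_def trace_op_act_mult flip: op_act_dagger)

lemma mip_op_act_left: "g \<in> SU3 \<Longrightarrow> mip A (op_act \<rho> g B) = mip (op_act \<rho> (dagger g) A) B"
  using mip_op_act[of g "op_act \<rho> (dagger g) A" B] by (simp add: op_act_inverse)

end

locale coupled = hw_mat \<rho> p q v for \<rho> :: "complex ^ 3 ^ 3 \<Rightarrow> complex ^ 'n ^ 'n" and p q v +
  fixes E :: "nat \<times> nat \<Rightarrow> nat \<Rightarrow> gt_label \<Rightarrow> complex ^ 'n ^ 'n"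
  assumes cb: "coupled_basis (p, q) \<rho> E"
begin

abbreviation "cgm \<equiv> cg_mult \<rho>"

definition blk :: "nat \<times> nat \<Rightarrow> nat \<Rightarrow> (complex ^ 'n ^ 'n) set" where
  "blk a s = complex_vector.span (E a s ` gt_labels a)"

definition idx :: "((nat \<times> nat) \<times> nat \<times> gt_label) set" where
  "idx = {(a, s, l). s \<in> {1..cgm a} \<and> l \<in> gt_labels a}"

lemmas cb_irrep = cb[unfolded coupled_basis_def Let_def, THEN conjunct1, rule_format]
  and cb_orth = cb[unfolded coupled_basis_def, THEN conjunct2, THEN conjunct1, rule_format]
  and cb_span = cb[unfolded coupled_basis_def, THEN conjunct2, THEN conjunct2, THEN conjunct1]
  and cb_dagger = cb[unfolded coupled_basis_def, THEN conjunct2, THEN conjunct2, THEN conjunct2, THEN conjunct1, rule_format]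
  and E_trivial = cb[unfolded coupled_basis_def, THEN conjunct2, THEN conjunct2, THEN conjunct2, THEN conjunct2]

lemma blk_irrep:
  assumes "s \<in> {1..cgm a}"
  shows "irrep a (restrict_rep (op_rep \<rho>) (blk a s))" "gt_basis a (restrict_rep (op_rep \<rho>) (blk a s)) (E a s)"
  using cb_irrep assms unfolding blk_def by blast+

lemma blk_unitary: "s \<in> {1..cgm a} \<Longrightarrow> unitary_rep (restrict_rep (op_rep \<rho>) (blk a s))"
  and blk_irreducible: "s \<in> {1..cgm a} \<Longrightarrow> irreducible_rep (restrict_rep (op_rep \<rho>) (blk a s))"
  using blk_irrep(1) by (auto simp: irrep_def)

lemma blk_onb: "s \<in> {1..cgm a} \<Longrightarrow> onb_rep (restrict_rep (op_rep \<rho>) (blk a s)) (gt_labels a) (E a s)"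
  by (intro onb_rep_gt blk_unitary blk_irrep)

lemma E_orth:
  assumes "s \<in> {1..cgm a}" "s' \<in> {1..cgm a'}" "l \<in> gt_labels a" "l' \<in> gt_labels a'"
  shows "mip (E a s l) (E a' s' l') = (if (a, s, l) = (a', s', l') then 1 else 0)"
proof (cases "(a, s) = (a', s')")
  case True
  then show ?thesis using onb_rep.e_orth[OF blk_onb[OF assms(1)]] assms by simp
next
  case False
  then have "ip (op_rep \<rho>) (E a s l) (E a' s' l') = 0"
    using cb_orth assms by blast
  with False show ?thesis by auto
qed

lemma E_nonzero: "s \<in> {1..cgm a} \<Longrightarrow> l \<in> gt_labels a \<Longrightarrow> E a s l \<noteq> 0"
  using E_orth[of s a s a l l] by auto

lemma E_blk: "l \<in> gt_labels a \<Longrightarrow> E a s l \<in> blk a s"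
  unfolding blk_def by (intro complex_vector.span_base imageI)

text \<open>The coupled basis is orthonormal in a finite-dimensional operator space. Finiteness of
  the series and of all sums over it follows.\<close>

lemma finite_idx: "finite idx"
proof -
  let ?f = "\<lambda>(a, s, l). E a s l"
  have orth: "mip (?f i) (?f j) = (if i = j then 1 else 0)" if "i \<in> idx" "j \<in> idx" for i j
    using that E_orth by (auto simp: idx_def split: if_splits)
  have "inj_on ?f idx"
    by (rule inj_onI) (metis orth zero_neq_one)
  moreover have "finite (?f ` idx)"
  proof (rule pairwise_orthogonal_imp_finite)
    show "pairwise orthogonal (?f ` idx)"
      unfolding pairwise_image by (auto simp: pairwise_def orthogonal_def inner_mip orth)
  qed
  ultimately show ?thesis using finite_imageD by blast
qed

lemma E_expand: "A = (\<Sum>(a, s, l)\<in>idx. mip (E a s l) A *\<^sub>C E a s l)"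
proof -
  have "A \<in> complex_vector.span (\<Union>a. \<Union>s\<in>{1..cgm a}. E a s ` gt_labels a)"
    unfolding cb_span ..
  then show ?thesis
  proof (induction rule: complex_vector.span_induct_alt)
    case base
    then show ?case by (simp add: case_prod_unfold)
  next
    case (step c x y)
    then obtain a s l where i: "(a, s, l) \<in> idx" and x: "x = E a s l" by (auto simp: idx_def)
    have "(\<Sum>(a', s', l')\<in>idx. mip (E a' s' l') x *\<^sub>C E a' s' l') = (\<Sum>j\<in>idx. if j = (a, s, l) then E a s l else 0)"
      using i by (intro sum.cong) (auto simp: x idx_def E_orth split: if_splits)
    also have "\<dots> = x" using i finite_idx x by simp
    finally have 1: "(\<Sum>(a', s', l')\<in>idx. mip (E a' s' l') x *\<^sub>C E a' s' l') = x" .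
    have "(\<Sum>(a', s', l')\<in>idx. mip (E a' s' l') (c *\<^sub>C x + y) *\<^sub>C E a' s' l')
      = c *\<^sub>C (\<Sum>(a', s', l')\<in>idx. mip (E a' s' l') x *\<^sub>C E a' s' l')
        + (\<Sum>(a', s', l')\<in>idx. mip (E a' s' l') y *\<^sub>C E a' s' l')"
      by (simp add: case_prod_unfold mip_add_right mip_scale_right complex_vector.scale_left_distrib
          sum.distrib complex_vector.scale_sum_right)
    then show ?case using 1 step.IH by simp
  qed
qed

lemma eq_0_if_mip_E: "(\<And>a s l. s \<in> {1..cgm a} \<Longrightarrow> l \<in> gt_labels a \<Longrightarrow> mip (E a s l) A = 0) \<Longrightarrow> A = 0"
  by (subst E_expand[of A]) (auto simp: idx_def intro!: sum.neutral)

lemma finite_cg_series: "finite (cg_series \<rho>)"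
proof -
  have "cg_series \<rho> \<subseteq> fst ` idx"
  proof
    fix a assume "a \<in> cg_series \<rho>"
    then have "(a, 1, hw_label a) \<in> idx" by (auto simp: cg_series_def idx_def hw_label_in)
    then show "a \<in> fst ` idx" by force
  qed
  then show ?thesis using finite_idx finite_subset by blast
qed

lemma cg_series_iff: "a \<in> cg_series \<rho> \<longleftrightarrow> 1 \<in> {1..cgm a}"
  by (auto simp: cg_series_def)

lemma series_if: "s \<in> {1..cgm a} \<Longrightarrow> a \<in> cg_series \<rho>"
  by (auto simp: cg_series_def)

text \<open>The Wigner function of the class, computed in the first copy; by \<open>D_rep\<close>
  every realization gives the same function.\<close>

definition D :: "nat \<times> nat \<Rightarrow> gt_label \<Rightarrow> gt_label \<Rightarrow> complex ^ 3 ^ 3 \<Rightarrow> complex" where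
  "D a k l g = mip (E a 1 k) (op_act \<rho> g (E a 1 l))"

lemma D_rep:
  assumes "a \<in> cg_series \<rho>" "unitary_rep R" "gt_basis a R e" "g \<in> SU3" "k \<in> gt_labels a" "l \<in> gt_labels a"
  shows "ip R (e k) (act R g (e l)) = D a k l g"
  using gt_mc_eq[OF assms(2,3) blk_unitary blk_irrep(2), of 1] assms cg_series_iff by (simp add: D_def)

lemma D_eq:
  assumes "s \<in> {1..cgm a}" "g \<in> SU3" "k \<in> gt_labels a" "l \<in> gt_labels a"
  shows "mip (E a s k) (op_act \<rho> g (E a s l)) = D a k l g"
  using D_rep[OF series_if blk_unitary blk_irrep(2)] assms by simp

lemma D_cnj:
  assumes "a \<in> cg_series \<rho>" "g \<in> SU3" "k \<in> gt_labels a" "l \<in> gt_labels a"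
  shows "cnj (D a k l (dagger g)) = D a l k g"
  using assms by (simp add: D_def mip_cnj mip_op_act_left[of "dagger g"] SU3_dagger)

lemma op_act_E:
  assumes "s \<in> {1..cgm a}" "g \<in> SU3" "l \<in> gt_labels a"
  shows "op_act \<rho> g (E a s l) = (\<Sum>k\<in>gt_labels a. D a k l g *\<^sub>C E a s k)"
proof -
  interpret B: onb_rep "restrict_rep (op_rep \<rho>) (blk a s)" "gt_labels a" "E a s" by (rule blk_onb[OF assms(1)])
  show ?thesis using B.act_e[OF assms(2,3)] assms by (simp add: B.mc_def D_eq)
qed

lemma mip_E_op_act:
  assumes "s \<in> {1..cgm a}" "g \<in> SU3" "k \<in> gt_labels a"
  shows "mip (E a s k) (op_act \<rho> g A) = (\<Sum>j\<in>gt_labels a. D a k j g * mip (E a s j) A)"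
proof -
  have "mip (E a s k) (op_act \<rho> g A) = mip (op_act \<rho> (dagger g) (E a s k)) A"
    using assms by (simp add: mip_op_act_left)
  also have "\<dots> = (\<Sum>j\<in>gt_labels a. cnj (D a j k (dagger g)) * mip (E a s j) A)"
    using assms by (simp add: op_act_E SU3_dagger mip_sum_left mip_scale_left)
  finally show ?thesis using assms by (simp add: D_cnj series_if)
qed

lemma op_act_blk: "s \<in> {1..cgm a} \<Longrightarrow> g \<in> SU3 \<Longrightarrow> x \<in> blk a s \<Longrightarrow> op_act \<rho> g x \<in> blk a s"
  using onb_rep.act_carr[OF blk_onb] by fastforce

lemma torus_E: "s \<in> {1..cgm a} \<Longrightarrow> h \<in> torus \<Longrightarrow> l \<in> gt_labels a \<Longrightarrow>
    op_act \<rho> h (E a s l) = chr h (fst l) *\<^sub>C E a s l"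
  using torus_gt[OF blk_irrep(1,2)] by simp

lemma subspace_blk: "complex_vector.subspace (blk a s)"
  by (simp add: blk_def)

text \<open>The common zeros of an invariant family of functionals on an irreducible block form a
  subrepresentation, so a family that is not zero on the block detects every nonzero vector. The
  scaling condition is weak enough to admit conjugate-linear functionals, which occur for the first
  entry of \<open>mip\<close> and for adjoints.\<close>

lemma blk_dichotomy:
  assumes s: "s \<in> {1..cgm a}"
    and add: "\<And>k x y. k \<in> K \<Longrightarrow> f k (x + y) = f k x + f k y"
    and scale: "\<And>k c x. k \<in> K \<Longrightarrow> f k x = 0 \<Longrightarrow> f k (c *\<^sub>C x) = (0::complex)"
    and inv: "\<And>g x. g \<in> SU3 \<Longrightarrow> x \<in> blk a s \<Longrightarrow> \<forall>k\<in>K. f k x = 0 \<Longrightarrow> \<forall>k\<in>K. f k (op_act \<rho> g x) = 0"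
    and nz: "\<exists>x\<in>blk a s. \<exists>k\<in>K. f k x \<noteq> 0" and x: "x \<in> blk a s" "x \<noteq> 0"
  shows "\<exists>k\<in>K. f k x \<noteq> 0"
proof (rule ccontr)
  assume no: "\<not> ?thesis"
  define N where "N = {x \<in> blk a s. \<forall>k\<in>K. f k x = 0}"
  have "f k 0 = 0" if "k \<in> K" for k using add[OF that, of 0 0] by simp
  then have "complex_vector.subspace N"
    by (intro complex_vector.subspaceI)
      (auto simp: N_def add scale complex_vector.subspace_0[OF subspace_blk]
        complex_vector.subspace_add[OF subspace_blk] complex_vector.subspace_scale[OF subspace_blk])
  moreover have "\<forall>g\<in>SU3. \<forall>x\<in>N. op_act \<rho> g x \<in> N"
    using inv op_act_blk[OF s] unfolding N_def by blast
  moreover have "N \<subseteq> blk a s" by (auto simp: N_def)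
  ultimately have "N = {0} \<or> N = blk a s"
    using blk_irreducible[OF s] unfolding irreducible_rep_def op_rep_simps by blast
  moreover have "x \<in> N" using no x by (simp add: N_def)
  ultimately show False using nz x(2) by (auto simp: N_def)
qed

text \<open>If f were nonzero on the block, it would be nonzero on the highest weight vector.
  Invariance under the torus would make that weight trivial, that is a = (0, 0).\<close>

lemma invariant_functional:
  assumes s: "s \<in> {1..cgm a}" and a: "a \<noteq> (0, 0)"
    and add: "\<And>x y. f (x + y) = f x + f y" and scale: "\<And>c x. f (c *\<^sub>C x) = c * f x"
    and inv: "\<And>g x. g \<in> SU3 \<Longrightarrow> f (op_act \<rho> g x) = f x" and l: "l \<in> gt_labels a"
  shows "f (E a s l) = (0::complex)"
proof (rule ccontr)
  assume nz: "f (E a s l) \<noteq> 0"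
  have "\<exists>k\<in>{()}. f (E a s (hw_label a)) \<noteq> 0"
    by (rule blk_dichotomy[OF s, where f = "\<lambda>_. f"])
      (use add scale inv nz l in \<open>auto simp: E_nonzero[OF s] hw_label_in intro: E_blk\<close>)
  then have nz': "f (E a s (hw_label a)) \<noteq> 0" by simp
  obtain p q where pq: "a = (p, q)" by fastforce
  have "chr h (int p + int q, int q, 0) = chr h (0, 0, 0)" if h: "h \<in> torus" for h
  proof -
    have "chr h (fst (hw_label a)) * f (E a s (hw_label a)) = f (E a s (hw_label a))"
      using inv[OF torus_SU3[OF h], of "E a s (hw_label a)"] torus_E[OF s h hw_label_in] scale by simp
    then have "chr h (fst (hw_label a)) = 1" using nz' by simp
    then show ?thesis by (simp add: pq hw_label_def chr_def)
  qed
  from chr_eq[OF this] have "p = 0" "q = 0" by auto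
  with a pq show False by simp
qed

lemma trivial_in_series: "(0, 0) \<in> cg_series \<rho>"
proof (rule ccontr)
  assume n: "(0, 0) \<notin> cg_series \<rho>"
  have "mat 1 = (0 :: complex ^ 'n ^ 'n)"
  proof (rule eq_0_if_mip_E)
    fix a s l assume sl: "s \<in> {1..cgm a}" "l \<in> gt_labels a"
    then have "a \<noteq> (0, 0)" using n series_if by blast
    then have "trace (E a s l) = 0"
      by (rule invariant_functional[OF sl(1)]) (auto simp: trace_add trace_scaleC trace_op_act sl)
    then show "mip (E a s l) (mat 1) = 0" by (simp add: mip_def trace_dagger)
  qed
  from arg_cong[OF this, of "\<lambda>A. A $ undefined $ undefined"] show False by (simp add: mat_def)
qed

lemma dim_irrep_pos: "dim_irrep a > 0"
  by (cases a) (simp add: dim_irrep_def)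

lemma trivial_labels: "gt_labels (0, 0) = {((0, 0, 0), 0)}"
  by (auto elim!: gt_labelsE intro!: gt_labelsI[of 0 _ 0])

text \<open>The dimension formula is contained in the normalization of the coupled basis: the
  identity divided by sqrt(dim p) has norm 1.\<close>

lemma card_eq_dim: "real CARD('n) = dim_irrep (p, q)"
proof -
  have s: "1 \<in> {1..cgm (0, 0)}" using trivial_in_series cg_series_iff by blast
  have "mip (E (0, 0) 1 ((0, 0, 0), 0)) (E (0, 0) 1 ((0, 0, 0), 0)) = 1"
    using E_orth[OF s s] by (simp add: trivial_labels)
  then have "of_real (1 / sqrt (dim_irrep (p, q)) * (1 / sqrt (dim_irrep (p, q))) * real CARD('n)) = (1 :: complex)"
  proof -
    have "mip (mat 1) (mat 1 :: complex ^ 'n ^ 'n) = of_nat CARD('n)" by (simp add: mip_def trace_I)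
    then show ?thesis
      using \<open>mip (E (0, 0) 1 ((0, 0, 0), 0)) (E (0, 0) 1 ((0, 0, 0), 0)) = 1\<close>
      unfolding E_trivial mip_scale_left mip_scale_right
      by (simp only: complex_cnj_complex_of_real of_real_mult of_real_of_nat_eq mult.assoc)
  qed
  then have "1 / sqrt (dim_irrep (p, q)) * (1 / sqrt (dim_irrep (p, q))) * real CARD('n) = 1"
    unfolding of_real_eq_1_iff .
  then show ?thesis
    using dim_irrep_pos[of "(p, q)"] by (simp add: field_simps)
qed

section \<open>The multiplicity bound\<close>

definition \<phi> :: "nat \<times> nat \<Rightarrow> nat \<Rightarrow> gt_label \<Rightarrow> complex" where
  "\<phi> a s l = vip v (E a s l *v v)"

text \<open>A torus element multiplies v by a phase, which cancels in the expectation value, so only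
  torus-invariant basis elements contribute.\<close>

lemma \<phi>_zero:
  assumes s: "s \<in> {1..cgm a}" and l: "l \<in> gt_labels a" and nz: "\<phi> a s l \<noteq> 0"
  shows "\<exists>\<gamma>\<in>{1..m_zero a}. l = zero_label a \<gamma>" "3 dvd int (fst a) + 2 * int (snd a)"
proof -
  obtain n1 n2 n3 J where l': "l = ((n1, n2, n3), J)" by (metis surj_pair)
  have "chr h (n1, n2, n3) = chr h (0, 0, 0)" if h: "h \<in> torus" for h
  proof -
    have hS: "h \<in> SU3" using h by (rule torus_SU3)
    obtain c where c: "\<rho> (dagger h) *v v = c *\<^sub>C v" "cnj c * c = 1"
    proof (rule that)
      show "\<rho> (dagger h) *v v = chr (dagger h) (int p + int q, int q, 0) *\<^sub>C v"
        using V.torus_highest_weight[OF hw dagger_torus[OF h]] by simp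
    qed (rule chr_cnj_mult[OF dagger_torus[OF h]])
    have "vip v (op_act \<rho> h (E a s l) *v v) = vip (\<rho> (dagger h) *v v) (E a s l *v (\<rho> (dagger h) *v v))"
      using hS by (simp add: op_act_eq rho_dagger matrix_vector_mul_assoc[symmetric] vip_dagger[of v "\<rho> h"])
    also have "\<dots> = \<phi> a s l"
      unfolding c(1) matrix_vector_scaleC vip_scale_left vip_scale_right
      using c(2) by (simp add: \<phi>_def mult.assoc[symmetric] mult.commute[of c])
    finally have "chr h (fst l) * \<phi> a s l = \<phi> a s l"
      unfolding torus_E[OF s h l] matrix_vector_scaleC vip_scale_right \<phi>_def .
    then show ?thesis using nz by (simp add: l' chr_def)
  qed
  from chr_eq[OF this] have "n1 = n2" "n2 = n3" by auto
  then show "\<exists>\<gamma>\<in>{1..m_zero a}. l = zero_label a \<gamma>" "3 dvd int (fst a) + 2 * int (snd a)"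
    using zero_weight_label l unfolding l' by blast+
qed

lemma vip_sum_right: "vip x (\<Sum>i\<in>I. f i) = (\<Sum>i\<in>I. vip x (f i))"
  by (induction I rule: infinite_finite_induct) (simp_all add: vip_add_right)

lemma matrix_vector_sum_left: "(\<Sum>i\<in>I. f i) *v x = (\<Sum>i\<in>I. f i *v x)" for f :: "'i \<Rightarrow> complex ^ 'n ^ 'n"
  by (induction I rule: infinite_finite_induct) (simp_all add: matrix_vector_left_distrib)

text \<open>The Berezin symbol of the combination of the highest weight elements of all copies is a
  sum of Wigner functions times the given relations, because all copies share the same Wigner
  functions. So the symbol, the combination and its coefficients vanish.\<close>

lemma \<phi>_independent:
  assumes z: "\<And>l. l \<in> gt_labels a \<Longrightarrow> (\<Sum>s\<in>{1..cgm a}. x s * \<phi> a s l) = 0" and s: "s \<in> {1..cgm a}"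
  shows "x s = 0"
proof -
  let ?l = "hw_label a"
  let ?A = "\<Sum>s\<in>{1..cgm a}. x s *\<^sub>C E a s ?l"
  have "?A = 0"
  proof (rule berezin_injective)
    fix g assume g: "g \<in> SU3"
    have "vip v (op_act \<rho> g ?A *v v) = (\<Sum>s\<in>{1..cgm a}. \<Sum>k\<in>gt_labels a. x s * (D a k ?l g * \<phi> a s k))"
      using g by (simp add: op_act_sum op_act_scale op_act_E hw_label_in matrix_vector_sum_left matrix_vector_scaleC
          vip_sum_right vip_scale_right sum_distrib_left \<phi>_def)
    also have "\<dots> = (\<Sum>k\<in>gt_labels a. D a k ?l g * (\<Sum>s\<in>{1..cgm a}. x s * \<phi> a s k))"
      by (subst sum.swap) (simp add: sum_distrib_left mult_ac)
    also have "\<dots> = 0"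
      by (intro sum.neutral ballI) (simp only: z mult_zero_right)
    finally show "vip v (op_act \<rho> g ?A *v v) = 0" .
  qed
  then have "mip (E a s ?l) ?A = 0" by simp
  moreover have "mip (E a s ?l) ?A = (\<Sum>t\<in>{1..cgm a}. if t = s then x s else 0)"
    unfolding mip_sum_right mip_scale_right using s by (intro sum.cong) (auto simp: E_orth hw_label_in)
  ultimately show ?thesis using s by simp
qed

text \<open>Some value of \<phi> must be nonzero by independence, which requires a zero weight to
  exist.\<close>

lemma series_mod_3: "a \<in> cg_series \<rho> \<Longrightarrow> 3 dvd int (fst a) + 2 * int (snd a)"
proof (rule ccontr)
  assume a: "a \<in> cg_series \<rho>" and n: "\<not> 3 dvd int (fst a) + 2 * int (snd a)"
  then have "\<phi> a s l = 0" if "s \<in> {1..cgm a}" "l \<in> gt_labels a" for s l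
    using \<phi>_zero(2) that by blast
  then have "(1::complex) = 0"
    using \<phi>_independent[of a "\<lambda>_. 1" 1] a cg_series_iff by simp
  then show False by simp
qed

lemma cg_mult_le: "cgm a \<le> m_zero a"
proof (rule columns_independent_le)
  show "columns_independent (m_zero a) (\<lambda>\<gamma> s. \<phi> a s (zero_label a \<gamma>)) {1..cgm a}"
    unfolding columns_independent_def
  proof (intro allI impI ballI)
    fix x s assume z: "\<forall>\<gamma>\<in>{1..m_zero a}. (\<Sum>s\<in>{1..cgm a}. x s * \<phi> a s (zero_label a \<gamma>)) = 0"
      and s: "s \<in> {1..cgm a}"
    show "x s = 0"
    proof (rule \<phi>_independent[OF _ s])
      fix l assume l: "l \<in> gt_labels a"
      show "(\<Sum>s\<in>{1..cgm a}. x s * \<phi> a s l) = 0"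
      proof (cases "\<exists>\<gamma>\<in>{1..m_zero a}. l = zero_label a \<gamma>")
        case True
        then show ?thesis using z by blast
      next
        case False
        then have "\<phi> a s l = 0" if "s \<in> {1..cgm a}" for s using \<phi>_zero(1)[OF that l] by blast
        then show ?thesis by simp
      qed
    qed
  qed
qed

lemma cg_mult_trivial: "cgm (0, 0) = 1"
proof -
  have s1: "1 \<in> {1..cgm (0, 0)}" using trivial_in_series cg_series_iff by blast
  have "cgm (0, 0) \<le> 1" using cg_mult_le[of "(0, 0)"] by (simp add: m_zero_def)
  with s1 show ?thesis by simp
qed

lemma zero_label_in_series: "a \<in> cg_series \<rho> \<Longrightarrow> \<gamma> \<in> {1..m_zero a} \<Longrightarrow> zero_label a \<gamma> \<in> gt_labels a"
  by (intro zero_label_in series_mod_3)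

subsection \<open>Schur's lemma and duality\<close>

text \<open>With (p, q) the class, 2x + y = 3 n1 - (p + 2q) and x + 2y = p + 2q - 3 n3, while n1 and
  n3 lie between 0 and p + q.\<close>

lemma dominance:
  assumes "k \<in> gt_labels b" "fst k = (n1, n2, n3)" "n1 - n2 = x" "n2 - n3 = y"
  shows "2 * x + y \<le> 2 * int (fst b) + int (snd b)" "x + 2 * y \<le> int (fst b) + 2 * int (snd b)"
    "2 * x + y \<ge> - (int (fst b) + 2 * int (snd b))" "x + 2 * y \<ge> - (2 * int (fst b) + int (snd b))"
proof -
  obtain J where k: "k = ((n1, n2, n3), J)" using assms(2) by (metis prod.collapse)
  note bnd = gt_label_bounds[of n1 n2 n3 J "fst b" "snd b"]
  show "2 * x + y \<le> 2 * int (fst b) + int (snd b)" "x + 2 * y \<le> int (fst b) + 2 * int (snd b)"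
    "2 * x + y \<ge> - (int (fst b) + 2 * int (snd b))" "x + 2 * y \<ge> - (2 * int (fst b) + int (snd b))"
    using bnd assms k by auto
qed

text \<open>Both copies carry labelled bases with the same Wigner functions, so the conclusion is an
  explicit matrix: zero between different classes, scalar between copies of one class.\<close>

lemma schur:
  assumes T_add: "\<And>x y. T (x + y) = T x + T y" and T_scale: "\<And>c x. T (c *\<^sub>C x) = c *\<^sub>C T x"
    and T_act: "\<And>g x. g \<in> SU3 \<Longrightarrow> T (op_act \<rho> g x) = op_act \<rho> g (T x)"
    and s: "s \<in> {1..cgm a}" and s': "s' \<in> {1..cgm a'}"
  shows "\<exists>c. \<forall>k\<in>gt_labels a'. \<forall>l\<in>gt_labels a. mip (E a' s' k) (T (E a s l)) = (if a = a' \<and> k = l then c else 0)"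
proof (cases "\<exists>k\<in>gt_labels a'. \<exists>l\<in>gt_labels a. mip (E a' s' k) (T (E a s l)) \<noteq> 0")
  case False
  then show ?thesis by (intro exI[of _ 0]) auto
next
  case True
  then obtain k0 l0 where kl0: "k0 \<in> gt_labels a'" "l0 \<in> gt_labels a" "mip (E a' s' k0) (T (E a s l0)) \<noteq> 0" by blast
  have T_sum: "T (\<Sum>i\<in>I. f i) = (\<Sum>i\<in>I. T (f i))" for f :: "gt_label \<Rightarrow> _" and I
    using T_add[of 0 0] by (induction I rule: infinite_finite_induct) (simp_all add: T_add)
  \<comment> \<open>A nonzero matrix entry anywhere propagates to the highest weight vector of the
    source here, and to that of the target in \<open>left\<close>.\<close>
  have right: "\<exists>k\<in>gt_labels a'. mip (E a' s' k) (T (E a s (hw_label a))) \<noteq> 0"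
  proof (rule blk_dichotomy[OF s, where f = "\<lambda>k x. mip (E a' s' k) (T x)"])
    show "\<forall>k\<in>gt_labels a'. mip (E a' s' k) (T (op_act \<rho> g x)) = 0"
      if "g \<in> SU3" "\<forall>k\<in>gt_labels a'. mip (E a' s' k) (T x) = 0" for g x
      using that s' by (simp add: T_act mip_E_op_act)
  qed (use kl0 in \<open>auto simp: T_add T_scale mip_add_right mip_scale_right hw_label_in E_nonzero[OF s] intro: E_blk\<close>)
  have left: "\<exists>l\<in>gt_labels a. mip (E a' s' (hw_label a')) (T (E a s l)) \<noteq> 0"
  proof (rule blk_dichotomy[OF s', where f = "\<lambda>l y. mip y (T (E a s l))"])
    show "\<forall>l\<in>gt_labels a. mip (op_act \<rho> g y) (T (E a s l)) = 0"
      if "g \<in> SU3" "\<forall>l\<in>gt_labels a. mip y (T (E a s l)) = 0" for g y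
    proof -
      have "mip (op_act \<rho> g y) B = mip y (op_act \<rho> (dagger g) B)" for B
        using that(1) mip_op_act_left[of "dagger g" y B] by (simp add: SU3_dagger)
      then show ?thesis
        using that s by (simp add: SU3_dagger T_act[symmetric] op_act_E T_sum T_scale mip_sum_right mip_scale_right)
    qed
  qed (use kl0 in \<open>auto simp: mip_add_left mip_scale_left hw_label_in E_nonzero[OF s'] intro: E_blk\<close>)
  have weight: "chr h (fst k) = chr h (fst l)"
    if "k \<in> gt_labels a'" "l \<in> gt_labels a" "mip (E a' s' k) (T (E a s l)) \<noteq> 0" "h \<in> torus" for h k l
  proof -
    have "chr h (fst l) * mip (E a' s' k) (T (E a s l)) = mip (E a' s' k) (op_act \<rho> h (T (E a s l)))"
      using that s by (simp add: T_act[OF torus_SU3, symmetric] torus_E T_scale mip_scale_right)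
    also have "\<dots> = mip (op_act \<rho> (dagger h) (E a' s' k)) (T (E a s l))"
      using that by (simp add: mip_op_act_left torus_SU3)
    also have "\<dots> = cnj (chr (dagger h) (fst k)) * mip (E a' s' k) (T (E a s l))"
      using that s' by (simp add: torus_E dagger_torus mip_scale_left)
    also have "cnj (chr (dagger h) (fst k)) = chr h (fst k)"
      by (cases "fst k") (simp add: chr_def)
    finally show ?thesis using that by simp
  qed
  obtain p1 q1 p2 q2 where pq: "a = (p1, q1)" "a' = (p2, q2)" by (metis surj_pair)
  obtain k where k: "k \<in> gt_labels a'" "mip (E a' s' k) (T (E a s (hw_label a))) \<noteq> 0" using right by blast
  obtain l where l: "l \<in> gt_labels a" "mip (E a' s' (hw_label a')) (T (E a s l)) \<noteq> 0" using left by blast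
  obtain k1 k2 k3 Jk l1 l2 l3 Jl where kl: "k = ((k1, k2, k3), Jk)" "l = ((l1, l2, l3), Jl)" by (metis surj_pair)
  have dk: "k1 - k2 = int p1" "k2 - k3 = int q1"
    using chr_eq[of k1 k2 k3 "int p1 + int q1" "int q1" 0] weight[OF k(1) hw_label_in k(2)]
    unfolding kl pq hw_label_def by auto
  have dl: "l1 - l2 = int p2" "l2 - l3 = int q2"
    using chr_eq[of l1 l2 l3 "int p2 + int q2" "int q2" 0] weight[OF hw_label_in l(1) l(2), symmetric]
    unfolding kl pq hw_label_def by auto
  \<comment> \<open>Each highest weight occurs among the weights of the other class, so each
    dominates the other.\<close>
  have aa: "a' = a"
    using dominance(1,2)[OF k(1) _ dk] dominance(1,2)[OF l(1) _ dl] unfolding kl pq by auto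
  define c where "c = mip (E a s' (hw_label a)) (T (E a s (hw_label a)))"
  \<comment> \<open>The deviation of T from c times the identification of the two copies. It
    vanishes on the highest weight vector, since that weight has multiplicity one, and hence on the
    whole block.\<close>
  define f where "f = (\<lambda>k x. mip (E a s' k) (T x) - c * mip (E a s k) x)"
  have s'': "s' \<in> {1..cgm a}" using s' aa by simp
  have hw0: "f k (E a s (hw_label a)) = 0" if k: "k \<in> gt_labels a" for k
  proof (cases "k = hw_label a")
    case True
    then show ?thesis using s by (simp add: f_def c_def E_orth hw_label_in)
  next
    case False
    have "mip (E a s' k) (T (E a s (hw_label a))) = 0"
    proof (rule ccontr)
      assume nz: "\<not> ?thesis"
      obtain k1 k2 k3 J where kk: "k = ((k1, k2, k3), J)" by (metis surj_pair)
      have "k1 - k2 = int p1" "k2 - k3 = int q1"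
        using chr_eq[of k1 k2 k3 "int p1 + int q1" "int q1" 0] weight[OF _ hw_label_in, of k] nz k
        unfolding kk pq hw_label_def aa[unfolded pq] by auto
      then show False using gt_label_highest False k unfolding kk pq by blast
    qed
    then show ?thesis using False s k by (simp add: f_def E_orth hw_label_in)
  qed
  have "\<forall>k\<in>gt_labels a. f k (E a s l) = 0" if l: "l \<in> gt_labels a" for l
  proof (rule ccontr)
    assume n: "\<not> ?thesis"
    have "\<exists>k\<in>gt_labels a. f k (E a s (hw_label a)) \<noteq> 0"
    proof (rule blk_dichotomy[OF s])
      show "\<forall>k\<in>gt_labels a. f k (op_act \<rho> g x) = 0" if "g \<in> SU3" "\<forall>k\<in>gt_labels a. f k x = 0" for g x
      proof
        fix k assume k: "k \<in> gt_labels a"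
        have "f k (op_act \<rho> g x) = (\<Sum>j\<in>gt_labels a. D a k j g * f j x)"
          using that(1) k s s'' by (simp add: f_def T_act mip_E_op_act sum_distrib_left right_diff_distrib
              sum_subtractf mult.left_commute)
        then show "f k (op_act \<rho> g x) = 0" using that(2) by simp
      qed
    qed (use n l in \<open>auto simp: f_def T_add T_scale mip_add_right mip_scale_right algebra_simps hw_label_in E_nonzero[OF s] intro: E_blk\<close>)
    then show False using hw0 by blast
  qed
  then have "mip (E a s' k) (T (E a s l)) = (if k = l then c else 0)" if "k \<in> gt_labels a" "l \<in> gt_labels a" for k l
    using that s by (auto simp: f_def E_orth)
  then show ?thesis by (intro exI[of _ c]) (simp add: aa)
qed

lemma dagger_E:
  assumes "s \<in> {1..cgm a}" "((n1, n2, n3), J) \<in> gt_labels a"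
  shows "dagger (E a s ((n1, n2, n3), J)) = ((-1) powi (n1 - n3)) *\<^sub>C E (dual a) s (dual_label a ((n1, n2, n3), J))"
  using cb_dagger assms by blast

lemma dagger_E_zero:
  assumes "s \<in> {1..cgm a}" "\<gamma> \<in> {1..m_zero a}"
  shows "dagger (E a s (zero_label a \<gamma>)) = E (dual a) s (zero_label (dual a) \<gamma>)"
proof -
  have a: "a \<in> cg_series \<rho>" using assms series_if by blast
  obtain c J where z: "zero_label a \<gamma> = ((c, c, c), J)" by (cases a) (simp add: zero_label_def Let_def)
  have "zero_label a \<gamma> \<in> gt_labels a" using zero_label_in_series a assms by blast
  then show ?thesis
    using dagger_E[OF assms(1), of c c c J] dual_label_zero_label[OF series_mod_3[OF a], of \<gamma>] unfolding z by simp
qed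

text \<open>The adjoint operation is equivariant and conjugate-linear and negates weights, so it
  relates a class to its dual; the comparison of weights is that of \<open>schur\<close> with the
  lowest weight vector as source.\<close>

lemma mip_E_dagger_nonzero:
  assumes s: "s \<in> {1..cgm a}" and s': "s' \<in> {1..cgm a'}" and kl0: "k0 \<in> gt_labels a'" "l0 \<in> gt_labels a"
    and nz: "mip (E a' s' k0) (dagger (E a s l0)) \<noteq> 0"
  shows "a' = dual a"
proof -
  have dagger_sum: "dagger (\<Sum>i\<in>I. f i) = (\<Sum>i\<in>I. dagger (f i))" for f :: "gt_label \<Rightarrow> complex ^ 'n ^ 'n" and I
    by (induction I rule: infinite_finite_induct) simp_all
  have right: "\<exists>k\<in>gt_labels a'. mip (E a' s' k) (dagger (E a s (lw_label a))) \<noteq> 0"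
  proof (rule blk_dichotomy[OF s, where f = "\<lambda>k x. mip (E a' s' k) (dagger x)"])
    show "\<forall>k\<in>gt_labels a'. mip (E a' s' k) (dagger (op_act \<rho> g x)) = 0"
      if "g \<in> SU3" "\<forall>k\<in>gt_labels a'. mip (E a' s' k) (dagger x) = 0" for g x
      using that s' by (simp add: op_act_dagger[symmetric] mip_E_op_act)
  qed (use kl0 nz in \<open>auto simp: mip_add_right mip_scale_right lw_label_in E_nonzero[OF s] intro: E_blk\<close>)
  have left: "\<exists>l\<in>gt_labels a. mip (E a' s' (hw_label a')) (dagger (E a s l)) \<noteq> 0"
  proof (rule blk_dichotomy[OF s', where f = "\<lambda>l y. mip y (dagger (E a s l))"])
    show "\<forall>l\<in>gt_labels a. mip (op_act \<rho> g y) (dagger (E a s l)) = 0"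
      if "g \<in> SU3" "\<forall>l\<in>gt_labels a. mip y (dagger (E a s l)) = 0" for g y
    proof -
      have "mip (op_act \<rho> g y) B = mip y (op_act \<rho> (dagger g) B)" for B
        using that(1) mip_op_act_left[of "dagger g" y B] by (simp add: SU3_dagger)
      then show ?thesis
        using that s by (simp add: SU3_dagger op_act_dagger op_act_E dagger_sum mip_sum_right mip_scale_right)
    qed
  qed (use kl0 nz in \<open>auto simp: mip_add_left mip_scale_left hw_label_in E_nonzero[OF s'] intro: E_blk\<close>)
  have weight: "chr h (fst k) = cnj (chr h (fst l))"
    if "k \<in> gt_labels a'" "l \<in> gt_labels a" "mip (E a' s' k) (dagger (E a s l)) \<noteq> 0" "h \<in> torus" for h k l
  proof -
    have "cnj (chr h (fst l)) * mip (E a' s' k) (dagger (E a s l)) = mip (E a' s' k) (op_act \<rho> h (dagger (E a s l)))"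
      using that s by (simp add: op_act_dagger torus_SU3 torus_E mip_scale_right)
    also have "\<dots> = mip (op_act \<rho> (dagger h) (E a' s' k)) (dagger (E a s l))"
      using that by (simp add: mip_op_act_left torus_SU3)
    also have "\<dots> = cnj (chr (dagger h) (fst k)) * mip (E a' s' k) (dagger (E a s l))"
      using that s' by (simp add: torus_E dagger_torus mip_scale_left)
    also have "cnj (chr (dagger h) (fst k)) = chr h (fst k)"
      by (cases "fst k") (simp add: chr_def)
    finally show ?thesis using that by simp
  qed
  obtain p1 q1 p2 q2 where pq: "a = (p1, q1)" "a' = (p2, q2)" by (metis surj_pair)
  obtain k where k: "k \<in> gt_labels a'" "mip (E a' s' k) (dagger (E a s (lw_label a))) \<noteq> 0" using right by blast
  obtain l where l: "l \<in> gt_labels a" "mip (E a' s' (hw_label a')) (dagger (E a s l)) \<noteq> 0" using left by blast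
  obtain k1 k2 k3 Jk l1 l2 l3 Jl where kl: "k = ((k1, k2, k3), Jk)" "l = ((l1, l2, l3), Jl)" by (metis surj_pair)
  have "chr h (k1, k2, k3) = chr h (- 0, - int q1, - (int p1 + int q1))" if "h \<in> torus" for h
    using weight[OF k(1) lw_label_in k(2) that] chr_minus[OF that] unfolding kl pq lw_label_def by simp
  from chr_eq[OF this] have dk: "k1 - k2 = int q1" "k2 - k3 = int p1" by simp_all
  have "chr h (l1, l2, l3) = chr h (- (int p2 + int q2), - int q2, - 0)" if "h \<in> torus" for h
  proof -
    have "cnj (chr h (int p2 + int q2, int q2, 0)) = chr h (l1, l2, l3)"
      using weight[OF hw_label_in l(1) l(2) that] unfolding kl pq hw_label_def by simp
    then show ?thesis using chr_minus[OF that] by simp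
  qed
  from chr_eq[OF this] have dl: "l1 - l2 = - int p2" "l2 - l3 = - int q2" by simp_all
  show ?thesis
    using dominance(1,2)[OF k(1) _ dk] dominance(3,4)[OF l(1) _ dl] unfolding kl pq dual_def by auto
qed

text \<open>If the dual class had fewer copies, the adjoint of the last copy of a would be a
  combination of copies of the dual with smaller index. These are adjoints of other copies of a and
  orthogonal to it, so it would vanish.\<close>

lemma cg_mult_le_dual: "cgm a \<le> cgm (dual a)"
proof (rule ccontr)
  assume "\<not> ?thesis"
  then have lt: "cgm (dual a) < cgm a" by simp
  define s where "s = cgm a"
  have s: "s \<in> {1..cgm a}" using lt by (auto simp: s_def)
  have "dagger (E a s (hw_label a)) = 0"
  proof (rule eq_0_if_mip_E, rule ccontr)
    fix a' s' k assume sk: "s' \<in> {1..cgm a'}" "k \<in> gt_labels a'" and nz: "mip (E a' s' k) (dagger (E a s (hw_label a))) \<noteq> 0"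
    have a': "a' = dual a" using mip_E_dagger_nonzero[OF s sk(1) sk(2) hw_label_in nz] .
    then have s': "s' \<in> {1..cgm a}" "s' \<noteq> s" using sk lt by (auto simp: s_def)
    define l where "l = dual_label a' k"
    have l: "l \<in> gt_labels a" "dual_label a l = k"
      using dual_label_in[OF sk(2)] dual_label_dual_label[of a' k] unfolding l_def a' by auto
    obtain n1 n2 n3 J where ll: "l = ((n1, n2, n3), J)" by (metis surj_pair)
    have "dagger (E a s' l) = ((-1) powi (n1 - n3)) *\<^sub>C E a' s' k"
      using dagger_E[OF s'(1), of n1 n2 n3 J] l unfolding ll a' by simp
    moreover have "mip (dagger (E a s' l)) (dagger (E a s (hw_label a))) = 0"
      using s s' l by (simp add: mip_dagger E_orth hw_label_in)
    ultimately show False using nz by (simp add: mip_scale_left)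
  qed
  then have "dagger (dagger (E a s (hw_label a))) = 0" by (simp only: dagger_0)
  then show False using E_nonzero[OF s hw_label_in] by simp
qed

lemma cg_mult_dual: "cgm (dual a) = cgm a"
  using cg_mult_le_dual[of a] cg_mult_le_dual[of "dual a"] by simp

lemma dual_in_series: "a \<in> cg_series \<rho> \<Longrightarrow> dual a \<in> cg_series \<rho>"
  by (simp add: cg_series_def cg_mult_dual)

lemma m_zero_dual [simp]: "m_zero (dual a) = m_zero a"
  by (cases a) (simp add: m_zero_def dual_def min.commute)

lemma dim_irrep_dual [simp]: "dim_irrep (dual a) = dim_irrep a"
  by (cases a) (simp add: dim_irrep_def dual_def algebra_simps)

end

section \<open>The flag manifold\<close>

lemma torus_one: "mat 1 \<in> torus"
  by (simp add: torus_def) (simp add: mat_def)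

lemma torus_mult: "g \<in> torus \<Longrightarrow> h \<in> torus \<Longrightarrow> g ** h \<in> torus"
proof -
  assume g: "g \<in> torus" and h: "h \<in> torus"
  have "(g ** h) $ i $ j = 0" if "i \<noteq> j" for i j
    using g h that exhaust_3[of i] exhaust_3[of j]
    by (auto simp: torus_def matrix_matrix_mult_def sum_3)
  then show ?thesis using g h by (auto simp: torus_def SU3_mult)
qed

lemma Rep_flag_base: "Rep_flag flag_base = torus"
proof -
  have "torus = (\<lambda>t. mat 1 ** t) ` torus" by simp
  then have "torus \<in> (\<lambda>g. (\<lambda>t. g ** t) ` torus) ` SU3" using SU3_one by blast
  then show ?thesis unfolding flag_base_def by (rule Abs_flag_inverse)
qed

lemma Rep_flag_act_base: "g \<in> SU3 \<Longrightarrow> Rep_flag (flag_act g flag_base) = (\<lambda>t. g ** t) ` torus"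
  unfolding flag_act_def Rep_flag_base by (rule Abs_flag_inverse) blast

lemma flag_cases:
  obtains g where "g \<in> SU3" "z = flag_act g flag_base"
proof -
  obtain g where g: "g \<in> SU3" "Rep_flag z = (\<lambda>t. g ** t) ` torus" using Rep_flag[of z] by blast
  then have "Rep_flag z = Rep_flag (flag_act g flag_base)" by (simp add: Rep_flag_act_base)
  then have "z = flag_act g flag_base" by (simp add: Rep_flag_inject)
  with g(1) that show ?thesis by blast
qed

lemma flag_act_base_eqD:
  assumes "g \<in> SU3" "g' \<in> SU3" "flag_act g flag_base = flag_act g' flag_base"
  obtains t where "t \<in> torus" "g' = g ** t"
proof -
  have "g' ** mat 1 \<in> Rep_flag (flag_act g' flag_base)"
    unfolding Rep_flag_act_base[OF assms(2)] using torus_one by (rule imageI)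
  then show ?thesis
    unfolding assms(3)[symmetric] Rep_flag_act_base[OF assms(1)] using that by auto
qed

lemma flag_act_act:
  assumes "g \<in> SU3" "h \<in> SU3"
  shows "flag_act g (flag_act h flag_base) = flag_act (g ** h) flag_base"
proof -
  have "(\<lambda>x. g ** x) ` (\<lambda>t. h ** t) ` torus = (\<lambda>t. g ** h ** t) ` torus"
    by (simp add: image_image matrix_mul_assoc)
  then show ?thesis
    unfolding flag_act_def[of g "flag_act h flag_base"] Rep_flag_act_base[OF assms(2)]
    by (simp add: flag_act_def[of "g ** h"] Rep_flag_base)
qed

lemma flag_act_torus: "t \<in> torus \<Longrightarrow> flag_act t flag_base = flag_base"
proof -
  assume t: "t \<in> torus"
  have "(\<lambda>s. t ** s) ` torus = torus"
  proof
    show "torus \<subseteq> (\<lambda>s. t ** s) ` torus"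
    proof
      fix s assume "s \<in> torus"
      moreover have "s = t ** (dagger t ** s)"
        by (simp add: matrix_mul_assoc SU3_dagger_right torus_SU3 t)
      ultimately show "s \<in> (\<lambda>s. t ** s) ` torus" using t torus_mult dagger_torus by blast
    qed
  qed (use t torus_mult in blast)
  then show ?thesis
    unfolding flag_act_def Rep_flag_base by (simp only: flag_base_def)
qed

section \<open>Integration of smooth functions on the flag manifold\<close>

lemma compact_SU3: "compact SU3"
  unfolding compact_eq_bounded_closed
proof
  have "norm g = norm (mat 1 :: complex ^ 3 ^ 3)" if "g \<in> SU3" for g
    using norm_unitary_mult[OF SU3_dagger_left[OF that], of "mat 1"] by simp
  then show "bounded SU3" unfolding bounded_iff by (metis order_refl)
  have c: "continuous_on UNIV (\<lambda>g :: complex ^ 3 ^ 3. dagger g ** g)"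
    by (intro bounded_bilinear.continuous_on[OF bounded_bilinear_matrix_mult]
        linear_continuous_on bounded_linear_dagger continuous_on_id)
  have d: "continuous_on UNIV (\<lambda>g :: complex ^ 3 ^ 3. det g)"
    unfolding det_3 by (intro continuous_intros)
  have "closed ({g :: complex ^ 3 ^ 3. dagger g ** g = mat 1} \<inter> {g. det g = 1})"
    by (intro closed_Int closed_Collect_eq c d continuous_on_const)
  also have "{g :: complex ^ 3 ^ 3. dagger g ** g = mat 1} \<inter> {g. det g = 1} = SU3"
    by (auto simp: SU3_def)
  finally show "closed SU3" .
qed

lemma smooth_flag_lift_continuous:
  assumes "f \<in> smooth_flag"
  shows "continuous_on SU3 (\<lambda>g. f (flag_act g flag_base))"
  unfolding continuous_on_def
proof
  fix g assume g: "g \<in> SU3"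
  then obtain U F where U: "open U" "g \<in> U" "\<And>k. Ck_on k F U" "\<And>h. h \<in> U \<inter> SU3 \<Longrightarrow> F h = f (flag_act h flag_base)"
    using assms unfolding smooth_flag_def by blast
  have "continuous_on U F" using U(3)[of 0] by simp
  then have "(F \<longlongrightarrow> F g) (at g within SU3)"
    using U(1,2) by (simp add: continuous_on_eq_continuous_at isCont_def tendsto_within_subset[OF _ subset_UNIV])
  moreover have "\<forall>\<^sub>F h in at g within SU3. F h = f (flag_act h flag_base)"
    unfolding eventually_at_topological using U(1,2,4) by blast
  ultimately have "((\<lambda>g. f (flag_act g flag_base)) \<longlongrightarrow> F g) (at g within SU3)"
    by (rule Lim_transform_eventually)
  then show "((\<lambda>g. f (flag_act g flag_base)) \<longlongrightarrow> f (flag_act g flag_base)) (at g within SU3)"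
    using U(4)[of g] U(2) g by simp
qed

text \<open>Open sets of the quotient are those with relatively open preimage in SU(3), so
  continuity of the lift gives Borel measurability.\<close>

lemma smooth_flag_measurable:
  assumes "f \<in> smooth_flag"
  shows "f \<in> borel_measurable borel"
proof (rule borel_measurableI)
  fix S :: "complex set" assume "open S"
  then have "openin (top_of_set SU3) (SU3 \<inter> (\<lambda>g. f (flag_act g flag_base)) -` S)"
    using smooth_flag_lift_continuous[OF assms] by (intro continuous_openin_preimage_gen)
  moreover have "SU3 \<inter> (\<lambda>g. f (flag_act g flag_base)) -` S = {g \<in> SU3. flag_act g flag_base \<in> f -` S}" by auto
  ultimately have "open (f -` S)" by (simp add: open_flag_def)
  then show "f -` S \<inter> space borel \<in> sets borel" by simp
qed

lemma smooth_flag_bounded: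
  assumes "f \<in> smooth_flag"
  obtains B where "\<And>z. norm (f z) \<le> B"
proof -
  have "bounded ((\<lambda>g. f (flag_act g flag_base)) ` SU3)"
    by (intro compact_imp_bounded compact_continuous_image smooth_flag_lift_continuous assms compact_SU3)
  then obtain B where "\<And>g. g \<in> SU3 \<Longrightarrow> norm (f (flag_act g flag_base)) \<le> B"
    unfolding bounded_iff by blast
  then have "norm (f z) \<le> B" for z by (metis flag_cases)
  then show ?thesis using that by blast
qed

lemma flag_act_measurable:
  assumes "h \<in> SU3"
  shows "flag_act h \<in> borel \<rightarrow>\<^sub>M borel"
proof (rule borel_measurableI)
  fix S :: "flag set" assume "open S"
  then have S: "openin (top_of_set SU3) {g \<in> SU3. flag_act g flag_base \<in> S}" by (simp add: open_flag_def)
  have "continuous_on SU3 (\<lambda>g. h ** g)"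
    by (intro bounded_bilinear.continuous_on[OF bounded_bilinear_matrix_mult] continuous_on_const continuous_on_id)
  from continuous_openin_preimage[OF this _ S]
  have "openin (top_of_set SU3) (SU3 \<inter> (\<lambda>g. h ** g) -` {g \<in> SU3. flag_act g flag_base \<in> S})"
    using assms SU3_mult by blast
  moreover have "SU3 \<inter> (\<lambda>g. h ** g) -` {g \<in> SU3. flag_act g flag_base \<in> S}
      = {g \<in> SU3. flag_act g flag_base \<in> flag_act h -` S}"
    using assms by (auto simp: flag_act_act SU3_mult)
  ultimately have "open (flag_act h -` S)" by (simp add: open_flag_def)
  then show "flag_act h -` S \<inter> space borel \<in> sets borel" by simp
qed

context
  fixes M assumes M: "invariant_flag_measure M"
begin

lemma flag_measure_sets: "sets M = sets borel"
  and flag_measure_invariant: "g \<in> SU3 \<Longrightarrow> distr M M (flag_act g) = M"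
  using M by (auto simp: invariant_flag_measure_def)

lemma flag_measure_finite: "finite_measure M" and flag_measure_total: "measure M (space M) = 1"
  using M by (auto intro!: finite_measureI simp: invariant_flag_measure_def measure_def)

lemma smooth_flag_measurable_M: "f \<in> smooth_flag \<Longrightarrow> f \<in> borel_measurable M"
  using smooth_flag_measurable measurable_cong_sets[OF flag_measure_sets refl] by blast

lemma smooth_flag_integrable:
  assumes "f \<in> smooth_flag"
  shows "integrable M f"
proof -
  interpret finite_measure M by (rule flag_measure_finite)
  obtain B where "\<And>z. norm (f z) \<le> B" using smooth_flag_bounded[OF assms] by blast
  then show ?thesis
    by (intro integrable_const_bound[of _ B] smooth_flag_measurable_M assms) simp
qed

lemma smooth_flag_integral_act:
  assumes "f \<in> smooth_flag" "g \<in> SU3"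
  shows "(LINT z|M. f (flag_act g z)) = (LINT z|M. f z)"
proof -
  have "flag_act g \<in> M \<rightarrow>\<^sub>M M"
    using flag_act_measurable[OF assms(2)] measurable_cong_sets[OF flag_measure_sets flag_measure_sets] by blast
  from integral_distr[OF this smooth_flag_measurable_M[OF assms(1)]]
  show ?thesis by (simp add: flag_measure_invariant assms(2))
qed

end

section \<open>Operator kernels\<close>

lemma trace_mult_eq_imp_eq:
  fixes X Y :: "complex ^ 'n ^ 'n"
  assumes "\<And>A. trace (A ** X) = trace (A ** Y)"
  shows "X = Y"
proof -
  have "mip (X - Y) (X - Y) = 0"
    using assms[of "dagger (X - Y)"] by (simp add: mip_def matrix_diff_right trace_sub)
  then show ?thesis by (simp add: mip_self_eq_0)
qed

text \<open>Real orthogonality to y and to i y amounts to complex orthogonality to y, so the real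
  projection onto a complex subspace is the complex one. The third property characterizes its
  values, and linearity and equivariance are derived from it.\<close>

lemma complex_orthogonal_projection:
  fixes N :: "(complex ^ 'n ^ 'n) set"
  assumes N: "complex_vector.subspace N"
  obtains P where "\<And>x. P x \<in> N" "\<And>x y. y \<in> N \<Longrightarrow> mip y (x - P x) = 0"
    "\<And>x z. z \<in> N \<Longrightarrow> (\<And>y. y \<in> N \<Longrightarrow> mip y (x - z) = 0) \<Longrightarrow> P x = z"
proof -
  obtain P where P: "\<And>x. P x \<in> N" "\<And>x y. y \<in> N \<Longrightarrow> inner (x - P x) y = 0"
    using real_orthogonal_projection[OF complex_subspace_real_subspace[OF N]] by blast
  have orth: "mip y (x - P x) = 0" if y: "y \<in> N" for x y
  proof -
    have "\<i> *\<^sub>C y \<in> N" using N y by (rule complex_vector.subspace_scale)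
    with P(2)[OF y, of x] P(2)[of "\<i> *\<^sub>C y" x]
    have "Re (mip y (x - P x)) = 0" "Re (mip (\<i> *\<^sub>C y) (x - P x)) = 0"
      by (simp_all add: inner_mip[symmetric] inner_commute[of "x - P x"])
    then show ?thesis by (simp add: complex_eq_iff mip_scale_left)
  qed
  show thesis
  proof (rule that[of P])
    fix x z assume z: "z \<in> N" "\<And>y. y \<in> N \<Longrightarrow> mip y (x - z) = 0"
    let ?d = "P x - z"
    have d: "?d \<in> N" using P(1) z(1) N by (intro complex_vector.subspace_diff)
    have "mip ?d ?d = mip ?d ((x - z) - (x - P x))" by simp
    also have "\<dots> = 0" unfolding mip_diff_right[of _ "x - z"] using z(2)[OF d] orth[OF d] by simp
    finally show "P x = z" by (simp add: mip_self_eq_0)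
  qed (use P orth in auto)
qed

context unitary_mat
begin

text \<open>Two representatives of a point differ by a torus element on the right, which K
  absorbs.\<close>

lemma op_at_eq:
  assumes K: "\<forall>t\<in>torus. op_act \<rho> t K = K" and g: "g \<in> SU3"
  shows "op_at \<rho> K (flag_act g flag_base) = op_act \<rho> g K"
  unfolding op_at_def
proof (rule the_equality)
  fix B assume "\<exists>g'\<in>SU3. flag_act g flag_base = flag_act g' flag_base \<and> B = op_act \<rho> g' K"
  then obtain g' where g': "g' \<in> SU3" "flag_act g flag_base = flag_act g' flag_base" "B = op_act \<rho> g' K" by blast
  obtain t where "t \<in> torus" "g' = g ** t" using flag_act_base_eqD[OF g g'(1,2)] .
  then show "B = op_act \<rho> g K" using g g'(3) K by (simp add: op_act_mult torus_SU3)
qed (use g in blast)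

end

context coupled
begin

definition kc :: "(nat \<times> nat \<Rightarrow> nat \<Rightarrow> nat \<Rightarrow> complex) \<Rightarrow> nat \<times> nat \<Rightarrow> nat \<Rightarrow> nat \<Rightarrow> complex" where
  "kc C a \<gamma> s = cnj (C a \<gamma> s) * of_real (sqrt (dim_irrep a / dim_irrep (p, q)))"

lemma sqrt_dim: "sqrt (dim_irrep (p, q)) \<noteq> 0" "sqrt (dim_irrep a / dim_irrep (p, q)) \<noteq> 0"
  using dim_irrep_pos[of "(p, q)"] dim_irrep_pos[of a] by auto

lemma trivial_zero_label: "zero_label (0, 0) 1 = ((0, 0, 0), 0)"
  by (simp add: zero_label_def)

text \<open>The separate identity term is the summand of the trivial class, whose only basis element
  is the identity over sqrt(dim p).\<close>

lemma kernel_of_eq: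
  assumes "C (0, 0) 1 1 = 1"
  shows "kernel_of (p, q) \<rho> E C =
    (\<Sum>a\<in>cg_series \<rho>. \<Sum>s\<in>{1..cgm a}. \<Sum>\<gamma>\<in>{1..m_zero a}. kc C a \<gamma> s *\<^sub>C E a s (zero_label a \<gamma>))"
proof -
  have "of_real (1 / dim_irrep (p, q)) *\<^sub>C mat 1
      = of_real (sqrt (1 / dim_irrep (p, q))) *\<^sub>C (of_real (1 / sqrt (dim_irrep (p, q))) *\<^sub>C (mat 1 :: complex ^ 'n ^ 'n))"
  proof -
    have "sqrt (1 / dim_irrep (p, q)) * (1 / sqrt (dim_irrep (p, q))) = 1 / dim_irrep (p, q)"
      using dim_irrep_pos[of "(p, q)"] by (simp add: real_sqrt_divide)
    then show ?thesis unfolding scaleC_scaleC of_real_mult[symmetric] by (simp only:)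
  qed
  also have "\<dots> = (\<Sum>s\<in>{1..cgm (0, 0)}. \<Sum>\<gamma>\<in>{1..m_zero (0, 0)}. kc C (0, 0) \<gamma> s *\<^sub>C E (0, 0) s (zero_label (0, 0) \<gamma>))"
    using assms trivial_zero_label E_trivial
    by (simp add: cg_mult_trivial m_zero_def kc_def dim_irrep_def)
  finally have 0: "of_real (1 / dim_irrep (p, q)) *\<^sub>C mat 1
      = (\<Sum>s\<in>{1..cgm (0, 0)}. \<Sum>\<gamma>\<in>{1..m_zero (0, 0)}. kc C (0, 0) \<gamma> s *\<^sub>C E (0, 0) s (zero_label (0, 0) \<gamma>))" .
  show ?thesis
    unfolding kernel_of_def 0 kc_def[symmetric]
    by (rule sum.remove[OF finite_cg_series trivial_in_series, symmetric])
qed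

lemma mip_kernel_of:
  assumes C: "C (0, 0) 1 1 = 1" and s: "s \<in> {1..cgm a}" and l: "l \<in> gt_labels a"
  shows "mip (E a s l) (kernel_of (p, q) \<rho> E C) = (\<Sum>\<gamma>\<in>{1..m_zero a}. if l = zero_label a \<gamma> then kc C a \<gamma> s else 0)"
proof -
  let ?f = "\<lambda>a' s' \<gamma>. kc C a' \<gamma> s' * mip (E a s l) (E a' s' (zero_label a' \<gamma>))"
  have 1: "?f a' s' \<gamma> = 0" if "a' \<in> cg_series \<rho>" "s' \<in> {1..cgm a'}" "\<gamma> \<in> {1..m_zero a'}" "(a', s') \<noteq> (a, s)" for a' s' \<gamma>
    using that s l zero_label_in_series[OF that(1,3)] by (auto simp: E_orth)
  have 2: "?f a s \<gamma> = (if l = zero_label a \<gamma> then kc C a \<gamma> s else 0)" if "\<gamma> \<in> {1..m_zero a}" for \<gamma>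
    using that s l zero_label_in_series[OF series_if[OF s] that] by (auto simp: E_orth)
  have "mip (E a s l) (kernel_of (p, q) \<rho> E C)
      = (\<Sum>a'\<in>cg_series \<rho>. \<Sum>s'\<in>{1..cgm a'}. \<Sum>\<gamma>\<in>{1..m_zero a'}. ?f a' s' \<gamma>)"
    unfolding kernel_of_eq[of C, OF C] by (simp add: mip_sum_right mip_scale_right)
  also have "\<dots> = (\<Sum>a'\<in>cg_series \<rho>. if a' = a then (\<Sum>s'\<in>{1..cgm a}. \<Sum>\<gamma>\<in>{1..m_zero a}. ?f a s' \<gamma>) else 0)"
    by (intro sum.cong refl) (auto intro!: sum.neutral 1)
  also have "\<dots> = (\<Sum>s'\<in>{1..cgm a}. \<Sum>\<gamma>\<in>{1..m_zero a}. ?f a s' \<gamma>)"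
    using finite_cg_series series_if[OF s] by simp
  also have "\<dots> = (\<Sum>s'\<in>{1..cgm a}. if s' = s then (\<Sum>\<gamma>\<in>{1..m_zero a}. ?f a s \<gamma>) else 0)"
    by (intro sum.cong refl) (auto intro!: sum.neutral 1 series_if[OF s])
  also have "\<dots> = (\<Sum>\<gamma>\<in>{1..m_zero a}. ?f a s \<gamma>)"
    using s by simp
  also have "\<dots> = (\<Sum>\<gamma>\<in>{1..m_zero a}. if l = zero_label a \<gamma> then kc C a \<gamma> s else 0)"
    by (intro sum.cong refl 2)
  finally show ?thesis .
qed

lemma mip_kernel_of_zero:
  assumes C: "C (0, 0) 1 1 = 1" and s: "s \<in> {1..cgm a}" and \<gamma>: "\<gamma> \<in> {1..m_zero a}"
  shows "mip (E a s (zero_label a \<gamma>)) (kernel_of (p, q) \<rho> E C) = kc C a \<gamma> s"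
proof -
  have "(\<Sum>\<delta>\<in>{1..m_zero a}. if zero_label a \<gamma> = zero_label a \<delta> then kc C a \<delta> s else 0)
      = (\<Sum>\<delta>\<in>{1..m_zero a}. if \<delta> = \<gamma> then kc C a \<gamma> s else 0)"
    by (intro sum.cong refl) (auto dest: zero_label_inj)
  then show ?thesis
    using mip_kernel_of[of C, OF C s zero_label_in_series[OF series_if[OF s] \<gamma>]] \<gamma> by simp
qed

lemma op_act_E_zero:
  assumes "t \<in> torus" "s \<in> {1..cgm a}" "\<gamma> \<in> {1..m_zero a}"
  shows "op_act \<rho> t (E a s (zero_label a \<gamma>)) = E a s (zero_label a \<gamma>)"
  using torus_E[OF assms(2,1) zero_label_in_series[OF series_if[OF assms(2)] assms(3)]] chr_zero_label[OF assms(1)]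
  by simp

lemma kernel_of_torus:
  assumes "C (0, 0) 1 1 = 1"
  shows "\<forall>t\<in>torus. op_act \<rho> t (kernel_of (p, q) \<rho> E C) = kernel_of (p, q) \<rho> E C"
  unfolding kernel_of_eq[of C, OF assms]
  by (auto simp: op_act_sum op_act_scale torus_SU3 op_act_E_zero intro!: sum.cong)

lemma dagger_sum: "dagger (\<Sum>i\<in>I. f i) = (\<Sum>i\<in>I. dagger (f i))"
  by (induction I rule: infinite_finite_induct) simp_all

text \<open>Adjoints exchange the summands of a and of its dual, and the condition relating C(a) and
  C of the dual class matches their coefficients.\<close>

lemma kernel_of_hermitian:
  assumes C: "characteristic_matrices \<rho> C"
  shows "dagger (kernel_of (p, q) \<rho> E C) = kernel_of (p, q) \<rho> E C"
proof -
  have C1: "C (0, 0) 1 1 = 1" using C by (simp add: characteristic_matrices_def)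
  have Cc: "cnj (C a \<gamma> s) = C (dual a) \<gamma> s" if "a \<in> cg_series \<rho>" "\<gamma> \<in> {1..m_zero a}" "s \<in> {1..cgm a}" for a \<gamma> s
    using C that unfolding characteristic_matrices_def by blast
  let ?G = "\<lambda>a. \<Sum>s\<in>{1..cgm a}. \<Sum>\<gamma>\<in>{1..m_zero a}. kc C a \<gamma> s *\<^sub>C E a s (zero_label a \<gamma>)"
  have G: "dagger (?G a) = ?G (dual a)" if a: "a \<in> cg_series \<rho>" for a
  proof -
    have "dagger (kc C a \<gamma> s *\<^sub>C E a s (zero_label a \<gamma>)) = kc C (dual a) \<gamma> s *\<^sub>C E (dual a) s (zero_label (dual a) \<gamma>)"
      if "s \<in> {1..cgm a}" "\<gamma> \<in> {1..m_zero a}" for s \<gamma>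
      using that a by (simp add: dagger_E_zero kc_def Cc[symmetric])
    then show ?thesis
      unfolding dagger_sum cg_mult_dual m_zero_dual by (intro sum.cong refl) blast
  qed
  have "dagger (\<Sum>a\<in>cg_series \<rho>. ?G a) = (\<Sum>a\<in>cg_series \<rho>. dagger (?G a))"
    by (rule dagger_sum)
  also have "\<dots> = (\<Sum>a\<in>cg_series \<rho>. ?G (dual a))"
    by (rule sum.cong[OF refl G])
  also have "\<dots> = (\<Sum>a\<in>cg_series \<rho>. ?G a)"
    by (rule sum.reindex_bij_witness[of _ dual dual]) (simp_all add: dual_in_series)
  finally show ?thesis unfolding kernel_of_eq[of C, OF C1] .
qed

lemma torus_fixed_mip:
  assumes K: "\<forall>t\<in>torus. op_act \<rho> t K = K" and s: "s \<in> {1..cgm a}" and l: "l \<in> gt_labels a"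
    and nz: "mip (E a s l) K \<noteq> 0"
  shows "\<exists>\<gamma>\<in>{1..m_zero a}. l = zero_label a \<gamma>"
proof -
  obtain n1 n2 n3 J where ll: "l = ((n1, n2, n3), J)" by (metis surj_pair)
  have "chr h (n1, n2, n3) = chr h (0, 0, 0)" if h: "h \<in> torus" for h
  proof -
    have "cnj (chr h (fst l)) * mip (E a s l) K = mip (E a s l) K"
      using mip_op_act[OF torus_SU3[OF h], of "E a s l" K] bspec[OF K h] torus_E[OF s h l] by (simp add: mip_scale_left)
    then have "cnj (chr h (fst l)) = 1" using nz by simp
    then have "chr h (fst l) = 1" by (metis complex_cnj_cnj complex_cnj_one)
    then show ?thesis by (simp add: ll chr_def)
  qed
  from chr_eq[OF this] have "n1 = n2" "n2 = n3" by auto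
  then show ?thesis using zero_weight_label(1) l unfolding ll by blast
qed

lemma sum_zero_labels:
  assumes "a \<in> cg_series \<rho>" and "\<And>l. l \<in> gt_labels a \<Longrightarrow> f l \<noteq> 0 \<Longrightarrow> \<exists>\<gamma>\<in>{1..m_zero a}. l = zero_label a \<gamma>"
  shows "(\<Sum>l\<in>gt_labels a. f l) = (\<Sum>\<gamma>\<in>{1..m_zero a}. f (zero_label a \<gamma>) :: complex)"
proof -
  have "(\<Sum>l\<in>gt_labels a. f l) = (\<Sum>l\<in>zero_label a ` {1..m_zero a}. f l)"
    using assms zero_label_in_series finite_gt_labels
    by (intro sum.mono_neutral_right) blast+
  also have "\<dots> = (\<Sum>\<gamma>\<in>{1..m_zero a}. f (zero_label a \<gamma>))"
    by (rule sum.reindex_cong[of "zero_label a"]) (auto intro: inj_onI zero_label_inj)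
  finally show ?thesis .
qed

text \<open>Since K is Hermitian, the trace is the conjugate of an inner product; this produces the
  conjugated Wigner functions of the harmonics. Torus invariance reduces the sum to zero
  labels.\<close>

lemma trace_E_op_act:
  assumes K: "\<forall>t\<in>torus. op_act \<rho> t K = K" "dagger K = K"
    and s: "s \<in> {1..cgm a}" and l: "l \<in> gt_labels a" and g: "g \<in> SU3"
  shows "trace (E a s l ** op_act \<rho> g K)
    = (\<Sum>\<gamma>\<in>{1..m_zero a}. cnj (D a l (zero_label a \<gamma>) g) * cnj (mip (E a s (zero_label a \<gamma>)) K))"
proof -
  have "trace (E a s l ** op_act \<rho> g K) = mip (dagger (E a s l)) (dagger (op_act \<rho> g K))"
    using K(2) g by (simp add: mip_def op_act_dagger[symmetric])
  also have "\<dots> = cnj (mip (E a s l) (op_act \<rho> g K))"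
    by (simp only: mip_dagger mip_cnj)
  also have "mip (E a s l) (op_act \<rho> g K) = (\<Sum>j\<in>gt_labels a. D a l j g * mip (E a s j) K)"
    using s g l by (rule mip_E_op_act)
  also have "\<dots> = (\<Sum>\<gamma>\<in>{1..m_zero a}. D a l (zero_label a \<gamma>) g * mip (E a s (zero_label a \<gamma>)) K)"
    by (rule sum_zero_labels[OF series_if[OF s]]) (use torus_fixed_mip[OF K(1) s] in auto)
  finally show ?thesis by simp
qed

lemma harmonic_eq:
  assumes a: "a \<in> cg_series \<rho>" and R: "unitary_rep R" "gt_basis a R e" and g: "g \<in> SU3"
    and \<gamma>: "\<gamma> \<in> {1..m_zero a}" and l: "l \<in> gt_labels a"
  shows "harmonic a R e \<gamma> l (flag_act g flag_base) = of_real (sqrt (dim_irrep a)) * cnj (D a l (zero_label a \<gamma>) g)"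
proof -
  let ?z = "zero_label a \<gamma>"
  have z: "?z \<in> gt_labels a" using a \<gamma> by (rule zero_label_in_series)
  have D: "wigner_D R e l ?z g = D a l ?z g" if "g \<in> SU3" for g
    unfolding wigner_D_def using a R that l z by (rule D_rep)
  show ?thesis
    unfolding harmonic_def
  proof (rule the_equality)
    fix w assume "\<exists>g'\<in>SU3. flag_act g flag_base = flag_act g' flag_base \<and>
      w = of_real (sqrt (dim_irrep a)) * cnj (wigner_D R e l ?z g')"
    then obtain g' where g': "g' \<in> SU3" "flag_act g flag_base = flag_act g' flag_base"
      "w = of_real (sqrt (dim_irrep a)) * cnj (D a l ?z g')" using D by auto
    obtain t where t: "t \<in> torus" "g' = g ** t" using flag_act_base_eqD[OF g g'(1,2)] .
    have "D a l ?z g' = D a l ?z g"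
      using t g a \<gamma> unfolding D_def cg_series_iff by (simp add: op_act_mult torus_SU3 op_act_E_zero)
    then show "w = of_real (sqrt (dim_irrep a)) * cnj (D a l ?z g)" using g'(3) by simp
  qed (use g D in auto)
qed

definition kernel_symbol :: "complex ^ 'n ^ 'n \<Rightarrow> complex ^ 'n ^ 'n \<Rightarrow> flag \<Rightarrow> complex" where
  "kernel_symbol K A z = trace (A ** op_at \<rho> K z)"

lemma kernel_symbol_eq:
  assumes "\<forall>t\<in>torus. op_act \<rho> t K = K" "g \<in> SU3"
  shows "kernel_symbol K A (flag_act g flag_base) = trace (A ** op_act \<rho> g K)"
  unfolding kernel_symbol_def op_at_eq[OF assms] ..

text \<open>The factors combine as sqrt(dim p) sqrt(dim a / dim p) = sqrt(dim a), the normalization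
  of the harmonics.\<close>

lemma kernel_symbol_E:
  assumes C: "characteristic_matrices \<rho> C" and R: "unitary_rep R" "gt_basis a R e"
    and s: "s \<in> {1..cgm a}" and l: "l \<in> gt_labels a"
  shows "kernel_symbol (kernel_of (p, q) \<rho> E C) (of_real (sqrt (dim_irrep (p, q))) *\<^sub>C E a s l) z
    = (\<Sum>\<gamma>\<in>{1..m_zero a}. C a \<gamma> s * harmonic a R e \<gamma> l z)"
proof -
  let ?K = "kernel_of (p, q) \<rho> E C"
  have C1: "C (0, 0) 1 1 = 1" using C by (simp add: characteristic_matrices_def)
  note K = kernel_of_torus[of C, OF C1] kernel_of_hermitian[OF C]
  obtain g where g: "g \<in> SU3" "z = flag_act g flag_base" by (rule flag_cases)
  have sq: "sqrt (dim_irrep (p, q)) * sqrt (dim_irrep a / dim_irrep (p, q)) = sqrt (dim_irrep a)"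
    using sqrt_dim by (simp add: real_sqrt_divide)
  have "kernel_symbol ?K (of_real (sqrt (dim_irrep (p, q))) *\<^sub>C E a s l) z
      = of_real (sqrt (dim_irrep (p, q))) * (\<Sum>\<gamma>\<in>{1..m_zero a}. cnj (D a l (zero_label a \<gamma>) g) * cnj (kc C a \<gamma> s))"
    unfolding g(2) kernel_symbol_eq[OF K(1) g(1)] matrix_scaleC_left trace_scaleC trace_E_op_act[OF K s l g(1)]
    by (intro arg_cong[of _ _ "(*) _"] sum.cong refl) (simp only: mip_kernel_of_zero[of C, OF C1 s])
  also have "\<dots> = (\<Sum>\<gamma>\<in>{1..m_zero a}. C a \<gamma> s * (of_real (sqrt (dim_irrep a)) * cnj (D a l (zero_label a \<gamma>) g)))"
    unfolding sum_distrib_left sq[symmetric] kc_def of_real_mult by (intro sum.cong refl) simp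
  also have "\<dots> = (\<Sum>\<gamma>\<in>{1..m_zero a}. C a \<gamma> s * harmonic a R e \<gamma> l z)"
    unfolding g(2) using harmonic_eq[OF series_if[OF s] R g(1) _ l] by (intro sum.cong refl) simp
  finally show ?thesis .
qed

lemma full_rank_columns: "full_rank (m_zero a) (cgm a) X \<longleftrightarrow> columns_independent (m_zero a) X {1..cgm a}"
  by (rule full_rank_iff[OF cg_mult_le])

text \<open>The orthogonal projection onto the kernel of the symbol map is equivariant, so by Schur's lemma
  it mixes the copies \<open>(a;\<sigma>)\<close> by a matrix whose columns \<open>C a\<close> annihilates.\<close>

lemma kernel_of_injective:
  assumes C: "characteristic_matrices \<rho> C"
    and A: "\<And>g. g \<in> SU3 \<Longrightarrow> trace (A ** op_act \<rho> g (kernel_of (p, q) \<rho> E C)) = 0"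
  shows "A = 0"
proof (rule ccontr)
  assume nz: "A \<noteq> 0"
  let ?K = "kernel_of (p, q) \<rho> E C"
  have C1: "C (0, 0) 1 1 = 1" using C by (simp add: characteristic_matrices_def)
  \<comment> \<open>The kernel of the symbol map, a complex subspace invariant under the
    group.\<close>
  define N where "N = {A. \<forall>g\<in>SU3. trace (A ** op_act \<rho> g ?K) = 0}"
  have sub: "complex_vector.subspace N"
    by (intro complex_vector.subspaceI)
      (auto simp: N_def matrix_add_distrib_right trace_add trace_scaleC, simp add: trace_def)
  have N_act: "op_act \<rho> h B \<in> N" if "B \<in> N" "h \<in> SU3" for B h
  proof -
    have "trace (op_act \<rho> h B ** op_act \<rho> g ?K) = 0" if g: "g \<in> SU3" for g
    proof -
      have "op_act \<rho> g ?K = op_act \<rho> h (op_act \<rho> (dagger h ** g) ?K)"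
        using \<open>h \<in> SU3\<close> g by (simp add: op_act_mult SU3_dagger op_act_inverse)
      then have "trace (op_act \<rho> h B ** op_act \<rho> g ?K) = trace (B ** op_act \<rho> (dagger h ** g) ?K)"
        using \<open>h \<in> SU3\<close> by (simp add: trace_op_act_mult)
      then show ?thesis using \<open>B \<in> N\<close> \<open>h \<in> SU3\<close> g by (simp add: N_def SU3_mult SU3_dagger)
    qed
    then show ?thesis by (simp add: N_def)
  qed
  obtain P where P: "\<And>x. P x \<in> N" "\<And>x y. y \<in> N \<Longrightarrow> mip y (x - P x) = 0"
    "\<And>x z. z \<in> N \<Longrightarrow> (\<And>y. y \<in> N \<Longrightarrow> mip y (x - z) = 0) \<Longrightarrow> P x = z"
    using complex_orthogonal_projection[OF sub] by blast
  have P_add: "P (x + y) = P x + P y" for x y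
  proof (rule P(3))
    show "mip w (x + y - (P x + P y)) = 0" if "w \<in> N" for w
      using P(2)[OF that, of x] P(2)[OF that, of y] by (simp add: mip_diff_right mip_add_right)
  qed (intro complex_vector.subspace_add sub P)
  have P_scale: "P (c *\<^sub>C x) = c *\<^sub>C P x" for c x
  proof (rule P(3))
    show "mip w (c *\<^sub>C x - c *\<^sub>C P x) = 0" if "w \<in> N" for w
      using P(2)[OF that, of x] by (simp add: mip_diff_right mip_scale_right)
  qed (intro complex_vector.subspace_scale sub P)
  have P_act: "P (op_act \<rho> g x) = op_act \<rho> g (P x)" if g: "g \<in> SU3" for g x
  proof (rule P(3))
    show "mip w (op_act \<rho> g x - op_act \<rho> g (P x)) = 0" if "w \<in> N" for w
      using P(2)[OF N_act[OF that SU3_dagger[OF g]], of x] g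
      by (simp add: op_act_diff[symmetric] mip_op_act_left)
  qed (intro N_act g P)
  have PA: "P A = A" by (rule P(3)) (use A in \<open>auto simp: N_def\<close>)
  \<comment> \<open>P fixes the nonzero A, so it cannot vanish on the whole coupled basis.\<close>
  have "\<exists>a s l. s \<in> {1..cgm a} \<and> l \<in> gt_labels a \<and> P (E a s l) \<noteq> 0"
  proof (rule ccontr)
    assume no: "\<not> ?thesis"
    have P_sum: "P (\<Sum>i\<in>I. f i) = (\<Sum>i\<in>I. P (f i))" for f :: "(nat \<times> nat) \<times> nat \<times> gt_label \<Rightarrow> _" and I
      using P_add[of 0 0] by (induction I rule: infinite_finite_induct) (simp_all add: P_add)
    have "P A = (\<Sum>i\<in>idx. P (case i of (a, s, l) \<Rightarrow> mip (E a s l) A *\<^sub>C E a s l))"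
      by (subst E_expand[of A]) (rule P_sum)
    also have "\<dots> = 0"
      using no by (intro sum.neutral) (auto simp: idx_def P_scale)
    finally show False using PA nz by simp
  qed
  then obtain a s l where sl: "s \<in> {1..cgm a}" "l \<in> gt_labels a" "P (E a s l) \<noteq> 0" by blast
  have "\<exists>c. \<forall>k\<in>gt_labels a'. \<forall>l\<in>gt_labels a. mip (E a' s' k) (P (E a s l)) = (if a = a' \<and> k = l then c else 0)"
    if "s' \<in> {1..cgm a'}" for a' s'
    using P_add P_scale P_act sl(1) that by (rule schur)
  then have "\<forall>a' s'. \<exists>c. s' \<in> {1..cgm a'} \<longrightarrow>
      (\<forall>k\<in>gt_labels a'. \<forall>l\<in>gt_labels a. mip (E a' s' k) (P (E a s l)) = (if a = a' \<and> k = l then c else 0))"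
    by blast
  then obtain c where "\<forall>a' s'. s' \<in> {1..cgm a'} \<longrightarrow>
      (\<forall>k\<in>gt_labels a'. \<forall>l\<in>gt_labels a. mip (E a' s' k) (P (E a s l)) = (if a = a' \<and> k = l then c a' s' else 0))"
    unfolding choice_iff by blast
  then have c: "\<And>a' s' k l. s' \<in> {1..cgm a'} \<Longrightarrow> k \<in> gt_labels a' \<Longrightarrow> l \<in> gt_labels a \<Longrightarrow>
      mip (E a' s' k) (P (E a s l)) = (if a = a' \<and> k = l then c a' s' else 0)" by blast
  \<comment> \<open>By Schur's lemma the coefficients do not depend on the label l, so the relation
    found at zero labels governs the whole copy.\<close>
  have PE: "P (E a s l) = (\<Sum>s'\<in>{1..cgm a}. c a s' *\<^sub>C E a s' l)" if l: "l \<in> gt_labels a" for l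
  proof -
    have "mip (E a' s' k) (P (E a s l) - (\<Sum>s'\<in>{1..cgm a}. c a s' *\<^sub>C E a s' l)) = 0"
      if s': "s' \<in> {1..cgm a'}" "k \<in> gt_labels a'" for a' s' k
    proof -
      have "mip (E a' s' k) (\<Sum>t\<in>{1..cgm a}. c a t *\<^sub>C E a t l)
          = (\<Sum>t\<in>{1..cgm a}. if t = s' then (if a = a' \<and> k = l then c a' s' else 0) else 0)"
        unfolding mip_sum_right mip_scale_right using s' l by (intro sum.cong refl) (auto simp: E_orth)
      also have "\<dots> = (if a = a' \<and> k = l then c a' s' else 0)" using s' by auto
      finally show ?thesis using c[OF s' l] by (simp add: mip_diff_right)
    qed
    from eq_0_if_mip_E[OF this] show ?thesis by simp
  qed
  \<comment> \<open>The projected vector lies in N, so its symbol vanishes at the base point. At a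
    zero label this value is, up to a nonzero factor, row \<gamma> of C(a) applied to c.\<close>
  have "(\<Sum>s'\<in>{1..cgm a}. c a s' * C a \<gamma> s') = 0" if \<gamma>: "\<gamma> \<in> {1..m_zero a}" for \<gamma>
  proof -
    have z: "zero_label a \<gamma> \<in> gt_labels a" using series_if[OF sl(1)] \<gamma> by (rule zero_label_in_series)
    have "trace (P (E a s (zero_label a \<gamma>)) ** ?K) = 0"
      using P(1)[of "E a s (zero_label a \<gamma>)"] SU3_one unfolding N_def by (auto simp: op_act_one dest!: bspec[of _ _ "mat 1"])
    then have "cnj (mip ?K (P (E a s (zero_label a \<gamma>)))) = 0"
      by (simp add: mip_def kernel_of_hermitian[OF C] trace_mul_sym[of ?K])
    then have "mip (P (E a s (zero_label a \<gamma>))) ?K = 0" by (simp only: mip_cnj)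
    then have "(\<Sum>s'\<in>{1..cgm a}. cnj (c a s') * mip (E a s' (zero_label a \<gamma>)) ?K) = 0"
      unfolding PE[OF z] mip_sum_left mip_scale_left .
    moreover have "(\<Sum>s'\<in>{1..cgm a}. cnj (c a s') * mip (E a s' (zero_label a \<gamma>)) ?K)
        = (\<Sum>s'\<in>{1..cgm a}. cnj (c a s') * kc C a \<gamma> s')"
      by (intro sum.cong refl) (simp only: mip_kernel_of_zero[of C, OF C1 _ \<gamma>])
    ultimately have "(\<Sum>s'\<in>{1..cgm a}. cnj (c a s') * kc C a \<gamma> s') = 0" by simp
    then have "cnj (\<Sum>s'\<in>{1..cgm a}. c a s' * C a \<gamma> s') * of_real (sqrt (dim_irrep a / dim_irrep (p, q))) = 0"
      unfolding kc_def cnj_sum complex_cnj_mult sum_distrib_right by (simp only: mult.assoc)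
    then show ?thesis using sqrt_dim(2)[of a] by (simp del: cnj_sum)
  qed
  moreover have "columns_independent (m_zero a) (C a) {1..cgm a}"
    using C series_if[OF sl(1)] full_rank_columns unfolding characteristic_matrices_def by blast
  ultimately have "\<forall>s'\<in>{1..cgm a}. c a s' = 0"
    unfolding columns_independent_def by blast
  then show False using PE[OF sl(2)] sl(3) by simp
qed

text \<open>Subtracting the right multiple of the trace leaves an invariant functional that vanishes
  on the identity, hence on the trivial block, and on all other blocks by
  \<open>invariant_functional\<close>.\<close>

lemma invariant_functional_trace:
  assumes add: "\<And>x y. f (x + y) = f x + f y" and scale: "\<And>c x. f (c *\<^sub>C x) = c * f x"
    and inv: "\<And>g x. g \<in> SU3 \<Longrightarrow> f (op_act \<rho> g x) = f x"
  shows "f A = f (mat 1) * trace A / of_real (dim_irrep (p, q))"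
proof -
  let ?h = "\<lambda>A. f A - f (mat 1) * trace A / of_real (dim_irrep (p, q))"
  have dn: "complex_of_real (dim_irrep (p, q)) \<noteq> 0" using dim_irrep_pos[of "(p, q)"] by simp
  have h_add: "?h (x + y) = ?h x + ?h y" and h_scale: "?h (c *\<^sub>C x) = c * ?h x" for x y c
    by (simp_all add: add scale trace_add trace_scaleC algebra_simps add_divide_distrib)
  have h1: "?h (mat 1) = 0"
    using dn by (simp add: trace_I card_eq_dim[symmetric])
  have h_E: "?h (E a s l) = 0" if sl: "s \<in> {1..cgm a}" "l \<in> gt_labels a" for a s l
  proof (cases "a = (0, 0)")
    case True
    then have "s = 1" "l = ((0, 0, 0), 0)" using sl cg_mult_trivial trivial_labels by auto
    then have "?h (E a s l) = of_real (1 / sqrt (dim_irrep (p, q))) * ?h (mat 1)"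
      unfolding True by (simp only: E_trivial h_scale)
    then show ?thesis by (simp only: h1 mult_zero_right)
  next
    case False
    show ?thesis
      by (rule invariant_functional[OF sl(1) False _ _ _ sl(2)]) (simp_all only: h_add h_scale inv trace_op_act)
  qed
  have h0: "?h 0 = 0" using h_scale[of 0 0] by simp
  have h_sum: "?h (\<Sum>i\<in>I. F i) = (\<Sum>i\<in>I. ?h (F i))" for F :: "(nat \<times> nat) \<times> nat \<times> gt_label \<Rightarrow> _" and I
    by (induction I rule: infinite_finite_induct) (simp_all only: h0 h_add sum.infinite sum.empty sum.insert not_False_eq_True)
  have "?h A = (\<Sum>i\<in>idx. ?h (case i of (a, s, l) \<Rightarrow> mip (E a s l) A *\<^sub>C E a s l))"
    by (subst (1 2) E_expand[of A]) (rule h_sum)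
  also have "\<dots> = 0"
    by (intro sum.neutral ballI) (clarsimp simp only: idx_def mem_Collect_eq case_prod_conv h_scale h_E mult_zero_right)
  finally show ?thesis by simp
qed

theorem symbol_correspondence_if_kernel:
  assumes M: "invariant_flag_measure M" and smooth: "W \<in> UNIV \<rightarrow> smooth_flag"
    and C: "characteristic_matrices \<rho> C"
    and W: "\<And>A z. W A z = kernel_symbol (kernel_of (p, q) \<rho> E C) A z"
  shows "symbol_correspondence (p, q) \<rho> M W"
proof -
  let ?K = "kernel_of (p, q) \<rho> E C"
  have C1: "C (0, 0) 1 1 = 1" using C by (simp add: characteristic_matrices_def)
  note K = kernel_of_torus[of C, OF C1] kernel_of_hermitian[OF C]
  have We: "W A (flag_act g flag_base) = trace (A ** op_act \<rho> g ?K)" if "g \<in> SU3" for A g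
    unfolding W using K(1) that by (rule kernel_symbol_eq)
  have add: "W (A + B) z = W A z + W B z" and scale: "W (c *\<^sub>C A) z = c * W A z" for A B c z
    unfolding W kernel_symbol_def by (simp_all add: matrix_add_distrib_right trace_add trace_scaleC)
  have inj: "inj W"
  proof (rule injI)
    fix A B assume "W A = W B"
    have "A - B = 0"
    proof (rule kernel_of_injective[OF C])
      fix g assume "g \<in> SU3"
      then show "trace ((A - B) ** op_act \<rho> g ?K) = 0"
        using We[of g A] We[of g B] \<open>W A = W B\<close> by (simp add: matrix_diff_left trace_sub)
    qed
    then show "A = B" by simp
  qed
  have equiv: "W (op_act \<rho> g A) z = W A (flag_act (matrix_inv g) z)" if g: "g \<in> SU3" for g A z
  proof -
    obtain h where h: "h \<in> SU3" "z = flag_act h flag_base" by (rule flag_cases)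
    have "trace (op_act \<rho> g A ** op_act \<rho> h ?K) = trace (op_act \<rho> g A ** op_act \<rho> g (op_act \<rho> (dagger g ** h) ?K))"
      using g h by (simp add: op_act_mult SU3_dagger op_act_inverse)
    then show ?thesis
      using g h by (simp add: matrix_inv_SU3 flag_act_act SU3_dagger SU3_mult We trace_op_act_mult)
  qed
  have real: "W (dagger A) z = cnj (W A z)" for A z
  proof -
    obtain h where h: "h \<in> SU3" "z = flag_act h flag_base" by (rule flag_cases)
    have "cnj (trace (A ** op_act \<rho> h ?K)) = trace (op_act \<rho> h ?K ** dagger A)"
      using h K(2) by (simp add: trace_dagger[symmetric] op_act_dagger[symmetric])
    then show ?thesis
      using h trace_mul_sym[of "dagger A" "op_act \<rho> h ?K"] by (simp add: We)
  qed
  have sm: "W A \<in> smooth_flag" for A using smooth by auto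
  \<comment> \<open>The integral is an invariant functional of A, because the measure is invariant;
    its value on the identity determines it.\<close>
  have int: "(LINT z|M. W A z) = trace A / of_real (dim_irrep (p, q))" for A
  proof -
    let ?f = "\<lambda>A. LINT z|M. W A z"
    have "?f A = ?f (mat 1) * trace A / of_real (dim_irrep (p, q))"
    proof (rule invariant_functional_trace)
      show "?f (op_act \<rho> g x) = ?f x" if "g \<in> SU3" for g x
        using that by (simp add: equiv smooth_flag_integral_act[OF M sm] matrix_inv_SU3 SU3_dagger)
    qed (simp_all add: add scale Bochner_Integration.integral_add smooth_flag_integrable[OF M sm])
    \<comment> \<open>The component of the kernel on the trivial class is its trace up to
      normalization, and C(0,0) = 1 makes that trace 1.\<close>
    moreover have "W (mat 1) z = 1" for z
    proof -
      obtain h where h: "h \<in> SU3" "z = flag_act h flag_base" by (rule flag_cases)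
      have s1: "1 \<in> {1..cgm (0, 0)}" and g1: "1 \<in> {1..m_zero (0, 0)}" by (simp_all add: cg_mult_trivial m_zero_def)
      have "mip (E (0, 0) 1 (zero_label (0, 0) 1)) ?K = of_real (1 / sqrt (dim_irrep (p, q)))"
        using mip_kernel_of_zero[of C, OF C1 s1 g1] C1 by (simp add: kc_def dim_irrep_def real_sqrt_divide)
      then have "of_real (1 / sqrt (dim_irrep (p, q))) * trace ?K = of_real (1 / sqrt (dim_irrep (p, q)))"
        unfolding trivial_zero_label E_trivial mip_scale_left by (simp add: mip_def)
      then have "trace ?K = 1" using sqrt_dim(1) by simp
      then show ?thesis using h by (simp add: We trace_op_act)
    qed
    ultimately show ?thesis by (simp add: flag_measure_total[OF M])
  qed
  show ?thesis
    unfolding symbol_correspondence_def using smooth add scale inj equiv real int by blast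
qed

theorem kernel_if_symbol_correspondence:
  assumes M: "invariant_flag_measure M" and sc: "symbol_correspondence (p, q) \<rho> M W"
  obtains C where "characteristic_matrices \<rho> C" "\<And>A z. W A z = kernel_symbol (kernel_of (p, q) \<rho> E C) A z"
proof -
  have add: "W (A + B) z = W A z + W B z" and scale: "W (c *\<^sub>C A) z = c * W A z" and inj: "inj W"
    and equiv: "g \<in> SU3 \<Longrightarrow> W (op_act \<rho> g A) z = W A (flag_act (matrix_inv g) z)"
    and real: "W (dagger A) z = cnj (W A z)"
    and int: "(LINT z|M. W A z) = trace A / of_real (dim_irrep (p, q))" for A B c z g
    using sc unfolding symbol_correspondence_def by blast+
  let ?\<phi> = "\<lambda>A. W A flag_base"
  \<comment> \<open>The Riesz representative of the functional at the base point: the adjoint of a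
    basis element receives the value on that element as coefficient.\<close>
  define K where "K = (\<Sum>(a, s, l)\<in>idx. ?\<phi> (E a s l) *\<^sub>C dagger (E a s l))"
  have trace_sum: "trace (\<Sum>i\<in>I. F i) = (\<Sum>i\<in>I. trace (F i))" for F :: "(nat \<times> nat) \<times> nat \<times> gt_label \<Rightarrow> complex ^ 'n ^ 'n" and I
    by (induction I rule: infinite_finite_induct) (simp_all add: trace_add, simp_all add: trace_def)
  have matrix_sum: "B ** (\<Sum>i\<in>I. F i) = (\<Sum>i\<in>I. B ** F i)" for B and F :: "(nat \<times> nat) \<times> nat \<times> gt_label \<Rightarrow> complex ^ 'n ^ 'n" and I
    by (induction I rule: infinite_finite_induct) (simp_all add: matrix_add_ldistrib)
  have \<phi>_sum: "?\<phi> (\<Sum>i\<in>I. F i) = (\<Sum>i\<in>I. ?\<phi> (F i))" for F :: "(nat \<times> nat) \<times> nat \<times> gt_label \<Rightarrow> complex ^ 'n ^ 'n" and I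
    using scale[of 0 0] by (induction I rule: infinite_finite_induct) (simp_all add: add)
  have \<phi>: "?\<phi> A = trace (A ** K)" for A
  proof -
    have "trace (A ** K) = (\<Sum>(a, s, l)\<in>idx. ?\<phi> (E a s l) * trace (A ** dagger (E a s l)))"
      unfolding K_def by (simp add: matrix_sum trace_sum case_prod_unfold trace_scaleC)
    also have "\<dots> = (\<Sum>(a, s, l)\<in>idx. ?\<phi> (mip (E a s l) A *\<^sub>C E a s l))"
      unfolding scale mip_def by (simp add: trace_mul_sym[of A] mult.commute)
    also have "\<dots> = ?\<phi> A"
      by (subst (2) E_expand[of A]) (simp add: \<phi>_sum case_prod_unfold)
    finally show ?thesis by simp
  qed
  have WK: "W A (flag_act g flag_base) = trace (A ** op_act \<rho> g K)" if g: "g \<in> SU3" for A g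
  proof -
    have "W (op_act \<rho> (dagger g) A) flag_base = W A (flag_act g flag_base)"
      using equiv[OF SU3_dagger[OF g]] g by (simp add: matrix_inv_SU3 SU3_dagger)
    then have "W A (flag_act g flag_base) = trace (op_act \<rho> (dagger g) A ** K)" by (simp add: \<phi>)
    also have "\<dots> = trace (A ** op_act \<rho> g K)"
      using trace_op_act_mult[OF g, of "op_act \<rho> (dagger g) A" K] g by (simp add: op_act_inverse)
    finally show ?thesis .
  qed
  have Kt: "\<forall>t\<in>torus. op_act \<rho> t K = K"
  proof
    fix t assume t: "t \<in> torus"
    show "op_act \<rho> t K = K"
      by (rule trace_mult_eq_imp_eq) (use WK[OF torus_SU3[OF t]] flag_act_torus[OF t] \<phi> in simp)
  qed
  have Kh: "dagger K = K"
  proof (rule trace_mult_eq_imp_eq)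
    fix A
    have "trace (A ** K) = cnj (trace (dagger A ** K))"
      using real[of "dagger A" flag_base] unfolding \<phi> by simp
    also have "\<dots> = trace (dagger K ** A)" by (simp add: trace_dagger[symmetric])
    finally show "trace (A ** dagger K) = trace (A ** K)" by (simp add: trace_mul_sym[of A])
  qed
  have trK: "trace K = 1"
  proof -
    have "W (mat 1) z = trace K" for z
    proof -
      obtain h where h: "h \<in> SU3" "z = flag_act h flag_base" by (rule flag_cases)
      then show ?thesis by (simp add: WK trace_op_act)
    qed
    then have "trace K = trace (mat 1 :: complex ^ 'n ^ 'n) / of_real (dim_irrep (p, q))"
      using int[of "mat 1"] by (simp add: flag_measure_total[OF M])
    then show ?thesis
      using dim_irrep_pos[of "(p, q)"] by (simp add: trace_I card_eq_dim[symmetric])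
  qed
  \<comment> \<open>The inverse of \<open>kc\<close>, which gives the kernel the same components as
    K at zero labels; at other labels both have none.\<close>
  define C where "C = (\<lambda>a \<gamma> s. cnj (mip (E a s (zero_label a \<gamma>)) K) / of_real (sqrt (dim_irrep a / dim_irrep (p, q))))"
  have kcC: "kc C a \<gamma> s = mip (E a s (zero_label a \<gamma>)) K" for a \<gamma> s
    using sqrt_dim(2)[of a] by (simp add: kc_def C_def)
  have C1: "C (0, 0) 1 1 = 1"
  proof -
    have "mip (E (0, 0) 1 (zero_label (0, 0) 1)) K = of_real (1 / sqrt (dim_irrep (p, q)))"
      unfolding trivial_zero_label E_trivial mip_scale_left by (simp add: mip_def trK)
    then show ?thesis
      using sqrt_dim(1) by (simp add: C_def dim_irrep_def real_sqrt_divide)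
  qed
  have C_cnj: "cnj (C a \<gamma> s) = C (dual a) \<gamma> s" if "a \<in> cg_series \<rho>" "\<gamma> \<in> {1..m_zero a}" "s \<in> {1..cgm a}" for a \<gamma> s
  proof -
    have "mip (E (dual a) s (zero_label (dual a) \<gamma>)) K = mip (dagger (E a s (zero_label a \<gamma>))) (dagger K)"
      using that by (simp add: dagger_E_zero Kh)
    also have "\<dots> = cnj (mip (E a s (zero_label a \<gamma>)) K)" by (simp only: mip_dagger mip_cnj)
    finally show ?thesis by (simp add: C_def)
  qed
  \<comment> \<open>A relation between the columns would kill the symbol of the corresponding
    combination of highest weight elements of the copies, against the injectivity of W.\<close>
  have C_ind: "columns_independent (m_zero a) (C a) {1..cgm a}" for a
    unfolding columns_independent_def
  proof (intro allI impI ballI)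
    fix x s assume x: "\<forall>\<gamma>\<in>{1..m_zero a}. (\<Sum>s\<in>{1..cgm a}. x s * C a \<gamma> s) = 0" and s: "s \<in> {1..cgm a}"
    let ?l = "hw_label a"
    let ?A = "\<Sum>s\<in>{1..cgm a}. x s *\<^sub>C E a s ?l"
    have "W ?A z = W 0 z" for z
    proof -
      obtain g where g: "g \<in> SU3" "z = flag_act g flag_base" by (rule flag_cases)
      have "trace (?A ** op_act \<rho> g K) = (\<Sum>s\<in>{1..cgm a}. x s * trace (E a s ?l ** op_act \<rho> g K))"
      proof -
        have "trace ((\<Sum>s\<in>S. x s *\<^sub>C E a s ?l) ** op_act \<rho> g K) = (\<Sum>s\<in>S. x s * trace (E a s ?l ** op_act \<rho> g K))" for S
          by (induction S rule: infinite_finite_induct)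
            (simp_all add: matrix_add_distrib_right trace_add trace_scaleC, simp_all add: trace_def)
        then show ?thesis .
      qed
      also have "\<dots> = (\<Sum>s\<in>{1..cgm a}. \<Sum>\<gamma>\<in>{1..m_zero a}. x s *
          (cnj (D a ?l (zero_label a \<gamma>) g) * cnj (mip (E a s (zero_label a \<gamma>)) K)))"
        unfolding sum_distrib_left[symmetric]
        by (intro sum.cong refl arg_cong[of _ _ "(*) _"] trace_E_op_act Kt Kh hw_label_in g)
      also have "\<dots> = (\<Sum>\<gamma>\<in>{1..m_zero a}. \<Sum>s\<in>{1..cgm a}. x s *
          (cnj (D a ?l (zero_label a \<gamma>) g) * cnj (mip (E a s (zero_label a \<gamma>)) K)))"
        by (rule sum.swap)
      also have "\<dots> = (\<Sum>\<gamma>\<in>{1..m_zero a}. cnj (D a ?l (zero_label a \<gamma>) g)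
          * of_real (sqrt (dim_irrep a / dim_irrep (p, q))) * (\<Sum>s\<in>{1..cgm a}. x s * C a \<gamma> s))"
        unfolding sum_distrib_left kcC[symmetric] kc_def by (intro sum.cong refl) (simp add: mult_ac)
      also have "\<dots> = 0" using x by (intro sum.neutral ballI) (metis mult_zero_right)
      finally show ?thesis using g scale[of 0 0 z] by (simp add: WK)
    qed
    then have "?A = 0" using inj by (auto dest: injD)
    then have "mip (E a s ?l) ?A = 0" by simp
    moreover have "mip (E a s ?l) ?A = (\<Sum>t\<in>{1..cgm a}. if t = s then x s else 0)"
      unfolding mip_sum_right mip_scale_right using s by (intro sum.cong refl) (auto simp: E_orth hw_label_in)
    ultimately show "x s = 0" using s by simp
  qed
  have "characteristic_matrices \<rho> C"
    unfolding characteristic_matrices_def using C1 C_cnj C_ind full_rank_columns by blast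
  moreover have "kernel_of (p, q) \<rho> E C = K"
  proof -
    have "mip (E a s l) (kernel_of (p, q) \<rho> E C - K) = 0" if sl: "s \<in> {1..cgm a}" "l \<in> gt_labels a" for a s l
    proof (cases "\<exists>\<gamma>\<in>{1..m_zero a}. l = zero_label a \<gamma>")
      case True
      then obtain \<gamma> where "\<gamma> \<in> {1..m_zero a}" "l = zero_label a \<gamma>" by blast
      then show ?thesis using mip_kernel_of_zero[of C, OF C1 sl(1)] kcC by (simp add: mip_diff_right)
    next
      case False
      then have "mip (E a s l) K = 0" using torus_fixed_mip[OF Kt sl] by blast
      moreover have "mip (E a s l) (kernel_of (p, q) \<rho> E C) = 0"
        unfolding mip_kernel_of[of C, OF C1 sl] using False by (intro sum.neutral) auto
      ultimately show ?thesis by (simp add: mip_diff_right)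
    qed
    from eq_0_if_mip_E[OF this] show ?thesis by simp
  qed
  then have "W A z = kernel_symbol (kernel_of (p, q) \<rho> E C) A z" for A z
    by (metis flag_cases kernel_symbol_eq[OF Kt] WK)
  ultimately show ?thesis by (rule that)
qed

end

theorem theorem5p9:
  fixes p :: "nat \<times> nat"
    and \<rho> :: "complex ^ 3 ^ 3 \<Rightarrow> complex ^ 'n ^ 'n"
    and E :: "nat \<times> nat \<Rightarrow> nat \<Rightarrow> gt_label \<Rightarrow> complex ^ 'n ^ 'n"
    and H :: "nat \<times> nat \<Rightarrow> 'v::complex_normed_vector rep"
    and e :: "nat \<times> nat \<Rightarrow> gt_label \<Rightarrow> 'v"
    and M :: "flag measure"
    and W :: "complex ^ 'n ^ 'n \<Rightarrow> flag \<Rightarrow> complex"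
  assumes "p \<noteq> (0, 0)"
    and "irrep p (vec_rep \<rho>)"
    and "coupled_basis p \<rho> E"
    and "\<And>a. a \<in> cg_series \<rho> \<Longrightarrow> irrep a (H a)"
    and "\<And>a. a \<in> cg_series \<rho> \<Longrightarrow> gt_basis a (H a) (e a)"
    and "invariant_flag_measure M"
    and "W \<in> UNIV \<rightarrow> smooth_flag"
  shows "(symbol_correspondence p \<rho> M W \<longleftrightarrow>
           (\<exists>C. characteristic_matrices \<rho> C \<and>
                (\<forall>A z. W A z = trace (A ** op_at \<rho> (kernel_of p \<rho> E C) z)))) \<and>
         (\<forall>C. characteristic_matrices \<rho> C \<and>
              (\<forall>A z. W A z = trace (A ** op_at \<rho> (kernel_of p \<rho> E C) z)) \<longrightarrow>
              (\<forall>a\<in>cg_series \<rho>. \<forall>s\<in>{1..cg_mult \<rho> a}. \<forall>l\<in>gt_labels a. \<forall>z.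
                 W (of_real (sqrt (dim_irrep p)) *\<^sub>C E a s l) z =
                 (\<Sum>\<gamma>\<in>{1..m_zero a}. C a \<gamma> s * harmonic a (H a) (e a) \<gamma> l z)))"
proof -
  obtain p1 q1 where p: "p = (p1, q1)" by fastforce
  obtain v where v: "highest_weight_vector (p1, q1) (vec_rep \<rho>) v"
    and irr: "irreducible_rep (vec_rep \<rho>)" and uni: "unitary_rep (vec_rep \<rho>)"
    using assms(2) unfolding p irrep_def by blast
  interpret coupled \<rho> p1 q1 v E
    by unfold_locales (use v irr uni assms(3) in \<open>simp_all add: p\<close>)
  have H: "unitary_rep (H a)" "gt_basis a (H a) (e a)" if "a \<in> cg_series \<rho>" for a
    using assms(4,5)[OF that] by (auto simp: irrep_def)
  show ?thesis
    unfolding p kernel_symbol_def[symmetric]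
  proof (intro conjI iffI allI impI ballI)
    assume "symbol_correspondence (p1, q1) \<rho> M W"
    then show "\<exists>C. characteristic_matrices \<rho> C \<and> (\<forall>A z. W A z = kernel_symbol (kernel_of (p1, q1) \<rho> E C) A z)"
      using kernel_if_symbol_correspondence[OF assms(6)] by metis
  next
    assume "\<exists>C. characteristic_matrices \<rho> C \<and> (\<forall>A z. W A z = kernel_symbol (kernel_of (p1, q1) \<rho> E C) A z)"
    then show "symbol_correspondence (p1, q1) \<rho> M W"
      using symbol_correspondence_if_kernel[OF assms(6,7)] by blast
  next
    fix C a s l z
    assume C: "characteristic_matrices \<rho> C \<and> (\<forall>A z. W A z = kernel_symbol (kernel_of (p1, q1) \<rho> E C) A z)"
      and a: "a \<in> cg_series \<rho>" "s \<in> {1..cg_mult \<rho> a}" "l \<in> gt_labels a"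
    then show "W (of_real (sqrt (dim_irrep (p1, q1))) *\<^sub>C E a s l) z =
        (\<Sum>\<gamma>\<in>{1..m_zero a}. C a \<gamma> s * harmonic a (H a) (e a) \<gamma> l z)"
      using kernel_symbol_E[of C "H a" a "e a" s l z] H by simp
  qed
qed

end
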